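(* Let $\Sigma$ be a complete simplicial rational fan in $\mathbb R^n$ with $m$ one-dimensional cones (some of which may be empty), with $m-n=2\ell$ even, and let $\mathcal K_\Sigma$ be its underlying simplicial complex on $[m]$. Let $X_\Sigma=U(\mathcal K_\Sigma)/G_\Sigma$ be the corresponding toric variety, and let $\mathcal Z_{\mathcal K_\Sigma}$ be the moment-angle manifold with the complex structure of the quotient $U(\mathcal K_\Sigma)/C_{\Psi,\Sigma}$. Then: (a) the toric variety $X_\Sigma$ is identified, as a topological space, with the quotient of $\mathcal Z_{\mathcal K_\Sigma}$ by the holomorphic action of $G_\Sigma/C_{\Psi,\Sigma}$; (b) if the fan $\Sigma$ is regular, then $X_\Sigma$ is the base of a holomorphic principal bundle with total space $\mathcal Z_{\mathcal K_\Sigma}$ and fibre the compact complex torus $G_\Sigma/C_{\Psi,\Sigma}$ of complex dimension $\ell$.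
   Context: A fan in $\mathbb R^n$ is a finite collection of strongly convex polyhedral cones closed under taking faces and with any two cones meeting in a common face. It is complete if the cones cover $\mathbb R^n$; rational if all cones are generated by vectors of $\mathbb Z^n$; simplicial (respectively, regular) if every cone is generated by part of a basis of $\mathbb R^n$ (respectively, of $\mathbb Z^n$). Let $\boldsymbol a_i=(a_{i1},\ldots,a_{in})\in\mathbb Z^n$ be the primitive integral generator of the $i$th one-dimensional cone. For a formally added 'empty' one-dimensional cone set $\boldsymbol a_i=0$; such an $i$ is a ghost vertex (contained in no simplex of $\mathcal K_\Sigma$). The complex $\mathcal K=\mathcal K_\Sigma$ on $[m]$ consists of the sets $I$ of indices of nonempty one-dimensional cones such that $\{\boldsymbol a_i:i\in I\}$ spans a cone of $\Sigma$ (including $\varnothing$). For $W\subset X$ put $(X,W)^{\mathcal K}=\bigcup_{I\in\mathcal K}\{(x_1,\ldots,x_m)\in X^m:x_j\in W\text{ for }j\notin I\}$. Set $U(\mathcal K)=(\mathbb C,\mathbb C^\times)^{\mathcal K}\subset\mathbb C^m$ and $\mathcal Z_{\mathcal K}=(\mathbb D,\mathbb T)^{\mathcal K}$ (closed unit disc, unit circle). Let $\Lambda_{\mathbb R}\colon\mathbb R^m\to\mathbb R^n$ be the linear map $\boldsymbol e_i\mapsto\boldsymbol a_i$, and let $G_\Sigma$ be the kernel of $(\mathbb C^\times)^m\to(\mathbb C^\times)^n$, $(z_1,\ldots,z_m)\mapsto(\prod_i z_i^{a_{i1}},\ldots,\prod_i z_i^{a_{in}})$. It acts on $U(\mathcal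 K)$ by coordinatewise multiplication. Choose a $\mathbb C$-linear map $\Psi\colon\mathbb C^\ell\to\mathbb C^m$ such that $\mathrm{Re}\circ\Psi\colon\mathbb C^\ell\to\mathbb R^m$ is injective and $\Lambda_{\mathbb R}\circ\mathrm{Re}\circ\Psi=0$ ($\mathrm{Re}$ is the coordinatewise real part), and let $C_{\Psi,\Sigma}=\exp\Psi(\mathbb C^\ell)\subset(\mathbb C^\times)^m$ (componentwise exponential). It is contained in $G_\Sigma$. It acts freely, properly and holomorphically on $U(\mathcal K)$, every orbit meets $\mathcal Z_{\mathcal K}\subset U(\mathcal K)$ in exactly one point, and $\mathcal Z_{\mathcal K}$ is given the complex structure of the compact complex manifold $U(\mathcal K)/C_{\Psi,\Sigma}$ via the resulting bijection $\mathcal Z_{\mathcal K}\to U(\mathcal K)/C_{\Psi,\Sigma}$. The group $G_\Sigma/C_{\Psi,\Sigma}$ acts on $U(\mathcal K)/C_{\Psi,\Sigma}\cong\mathcal Z_{\mathcal K}$ in the induced way. *)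

theory Defs
  imports "HOL-Analysis.Analysis" "HOL-Algebra.Group_Action"
begin

section \<open>Fans\<close>

definition int_vec :: "int^'n \<Rightarrow> real^'n" where
  "int_vec v = (\<chi> j. of_int (v $ j))"

text \<open>The subgroup generated by a finite set \<open>B\<close>.\<close>
definition int_span :: "'a::real_vector set \<Rightarrow> 'a set" where
  "int_span B = {(\<Sum>b\<in>B. of_int (k b) *\<^sub>R b) | k :: 'a \<Rightarrow> int. True}"

definition strongly_convex_polyhedral_cone :: "(real^'n) set \<Rightarrow> bool" where
  "strongly_convex_polyhedral_cone \<sigma> \<longleftrightarrow>
     (\<exists>S. finite S \<and> \<sigma> = convex_cone hull S) \<and> (\<forall>x. x \<in> \<sigma> \<and> - x \<in> \<sigma> \<longrightarrow> x = 0)"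

text \<open>The empty set is a face in the sense of \<^const>\<open>face_of\<close>, but not a face of a cone.\<close>
definition cone_face :: "(real^'n) set \<Rightarrow> (real^'n) set \<Rightarrow> bool" where
  "cone_face \<tau> \<sigma> \<longleftrightarrow> \<tau> face_of \<sigma> \<and> \<tau> \<noteq> {}"

definition fan :: "(real^'n) set set \<Rightarrow> bool" where
  "fan \<Sigma> \<longleftrightarrow> finite \<Sigma>
     \<and> (\<forall>\<sigma>\<in>\<Sigma>. strongly_convex_polyhedral_cone \<sigma>)
     \<and> (\<forall>\<sigma>\<in>\<Sigma>. \<forall>\<tau>. cone_face \<tau> \<sigma> \<longrightarrow> \<tau> \<in> \<Sigma>)
     \<and> (\<forall>\<sigma>\<in>\<Sigma>. \<forall>\<tau>\<in>\<Sigma>. cone_face (\<sigma> \<inter> \<tau>) \<sigma> \<and> cone_face (\<sigma> \<inter> \<tau>) \<tau>)"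

definition complete_fan :: "(real^'n) set set \<Rightarrow> bool" where
  "complete_fan \<Sigma> \<longleftrightarrow> fan \<Sigma> \<and> \<Union>\<Sigma> = UNIV"

definition rational_fan :: "(real^'n) set set \<Rightarrow> bool" where
  "rational_fan \<Sigma> \<longleftrightarrow> fan \<Sigma> \<and>
     (\<forall>\<sigma>\<in>\<Sigma>. \<exists>S. finite S \<and> S \<subseteq> range int_vec \<and> \<sigma> = convex_cone hull S)"

definition simplicial_fan :: "(real^'n) set set \<Rightarrow> bool" where
  "simplicial_fan \<Sigma> \<longleftrightarrow> fan \<Sigma> \<and>
     (\<forall>\<sigma>\<in>\<Sigma>. \<exists>B S. independent B \<and> span B = UNIV \<and> S \<subseteq> B \<and> \<sigma> = convex_cone hull S)"

definition regular_fan :: "(real^'n) set set \<Rightarrow> bool" where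
  "regular_fan \<Sigma> \<longleftrightarrow> fan \<Sigma> \<and>
     (\<forall>\<sigma>\<in>\<Sigma>. \<exists>B S. independent B \<and> int_span B = range int_vec \<and> S \<subseteq> B \<and>
        \<sigma> = convex_cone hull S)"

text \<open>The index type \<open>'m\<close> plays the role of \<open>[m]\<close>. Indices with \<open>a i = 0\<close> are the formally
  added empty one-dimensional cones; all the other ones enumerate, without repetition, the
  one-dimensional cones of the fan by their primitive generators.\<close>
definition ray_generators :: "(real^'n) set set \<Rightarrow> ('m \<Rightarrow> int^'n) \<Rightarrow> bool" where
  "ray_generators \<Sigma> a \<longleftrightarrow>
     bij_betw (\<lambda>i. convex_cone hull {int_vec (a i)}) {i. a i \<noteq> 0} {\<sigma> \<in> \<Sigma>. dim \<sigma> = 1} \<and>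
     (\<forall>i. a i \<noteq> 0 \<longrightarrow> Gcd (range (($) (a i))) = 1)"

definition fan_complex :: "(real^'n) set set \<Rightarrow> ('m \<Rightarrow> int^'n) \<Rightarrow> 'm set set" where
  "fan_complex \<Sigma> a =
     {I. (\<forall>i\<in>I. a i \<noteq> 0) \<and> convex_cone hull ((\<lambda>i. int_vec (a i)) ` I) \<in> \<Sigma>}"

section \<open>Polyhedral products and the groups acting on them\<close>

definition polyhedral_product :: "'a set \<Rightarrow> 'a set \<Rightarrow> 'm set set \<Rightarrow> ('a^'m) set" where
  "polyhedral_product X W K = (\<Union>I\<in>K. {x. (\<forall>j. x $ j \<in> X) \<and> (\<forall>j. j \<notin> I \<longrightarrow> x $ j \<in> W)})"

definition arrangement_complement :: "'m set set \<Rightarrow> (complex^'m) set" where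
  "arrangement_complement K = polyhedral_product UNIV (- {0}) K"

definition moment_angle :: "'m set set \<Rightarrow> (complex^'m) set" where
  "moment_angle K = polyhedral_product (cball 0 1) (sphere 0 1) K"

definition Lambda_R :: "('m::finite \<Rightarrow> int^'n) \<Rightarrow> real^'m \<Rightarrow> real^'n" where
  "Lambda_R a x = (\<Sum>i\<in>UNIV. x $ i *\<^sub>R int_vec (a i))"

definition Re_vec :: "complex^'m \<Rightarrow> real^'m" where
  "Re_vec z = (\<chi> i. Re (z $ i))"

definition G_fan :: "('m::finite \<Rightarrow> int^'n) \<Rightarrow> (complex^'m) set" where
  "G_fan a = {z. (\<forall>i. z $ i \<noteq> 0) \<and> (\<forall>j. (\<Prod>i\<in>UNIV. (z $ i) powi (a i $ j)) = 1)}"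

definition C_sub :: "(complex^'l \<Rightarrow> complex^'m) \<Rightarrow> (complex^'m) set" where
  "C_sub \<Psi> = range (\<lambda>w. \<chi> i. exp (\<Psi> w $ i))"

text \<open>Multiplication and unit of \<open>complex^'m\<close> are coordinatewise.\<close>
definition mult_group :: "(complex^'m) set \<Rightarrow> (complex^'m) monoid" where
  "mult_group S = \<lparr>carrier = S, mult = (*), one = 1\<rparr>"

definition add_group :: "(complex^'l) monoid" where
  "add_group = \<lparr>carrier = UNIV, mult = (+), one = 0\<rparr>"

section \<open>Quotient topology\<close>

definition quotient_topology :: "'a topology \<Rightarrow> ('a \<Rightarrow> 'b) \<Rightarrow> 'b topology" where
  "quotient_topology X p =
     topology (\<lambda>V. V \<subseteq> p ` topspace X \<and> openin X {x \<in> topspace X. p x \<in> V})"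

lemma openin_quotient_topology:
  "openin (quotient_topology X p) V \<longleftrightarrow>
     V \<subseteq> p ` topspace X \<and> openin X {x \<in> topspace X. p x \<in> V}"
proof -
  have "istopology (\<lambda>V. V \<subseteq> p ` topspace X \<and> openin X {x \<in> topspace X. p x \<in> V})"
    unfolding istopology_def
  proof (intro conjI allI impI, goal_cases)
    case (2 S T)
    have "{x \<in> topspace X. p x \<in> S \<inter> T} =
          {x \<in> topspace X. p x \<in> S} \<inter> {x \<in> topspace X. p x \<in> T}" by auto
    with 2 show ?case by auto
  next
    case (4 \<K>)
    have "{x \<in> topspace X. p x \<in> \<Union>\<K>} = (\<Union>S\<in>\<K>. {x \<in> topspace X. p x \<in> S})" by auto
    with 4 show ?case by auto
  qed auto
  then show ?thesis
    by (simp add: quotient_topology_def)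
qed

lemma quotient_map_quotient_topology: "quotient_map X (quotient_topology X p) p"
proof -
  have *: "{x \<in> topspace X. p x \<in> p ` topspace X} = topspace X" by auto
  have "openin (quotient_topology X p) (p ` topspace X)"
    unfolding openin_quotient_topology * by simp
  then have "topspace (quotient_topology X p) = p ` topspace X"
    unfolding topspace_def[of "quotient_topology X p"] openin_quotient_topology
    using openin_quotient_topology[of X p] by blast
  then show ?thesis
    by (simp add: quotient_map_def openin_quotient_topology)
qed

section \<open>Complex manifolds\<close>

text \<open>For subsets that are not open, holomorphic means being locally the restriction of a
  holomorphic map.\<close>
definition holo_on :: "(complex^'a \<Rightarrow> complex^'b) \<Rightarrow> (complex^'a) set \<Rightarrow> bool" where
  "holo_on f S \<longleftrightarrow> (\<forall>x\<in>S. \<exists>O' g. open O' \<and> x \<in> O' \<and> (\<forall>y\<in>O' \<inter> S. g y = f y) \<and>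
     (\<forall>y\<in>O'. \<exists>D. Vector_Spaces.linear (*s) (*s) D \<and> (g has_derivative D) (at y)))"

type_synonym ('a, 'd) chart = "'a set \<times> ('a \<Rightarrow> complex^'d)"

definition chart_on :: "'a topology \<Rightarrow> ('a, 'd::finite) chart \<Rightarrow> bool" where
  "chart_on X = (\<lambda>(V, \<phi>). openin X V \<and> open (\<phi> ` V) \<and>
     homeomorphic_map (subtopology X V) (top_of_set (\<phi> ` V)) \<phi>)"

text \<open>The complex dimension is \<open>CARD('d)\<close>.\<close>
definition complex_manifold :: "'a topology \<Rightarrow> ('a, 'd::finite) chart set \<Rightarrow> bool" where
  "complex_manifold X A \<longleftrightarrow> Hausdorff_space X \<and> second_countable X \<and>
     (\<forall>c\<in>A. chart_on X c) \<and> \<Union>(fst ` A) = topspace X \<and>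
     (\<forall>(V, \<phi>)\<in>A. \<forall>(W, \<psi>)\<in>A. holo_on (\<psi> \<circ> inv_into V \<phi>) (\<phi> ` (V \<inter> W)))"

definition holomorphic_map ::
  "'a topology \<Rightarrow> ('a, 'd::finite) chart set \<Rightarrow> 'b topology \<Rightarrow> ('b, 'e::finite) chart set \<Rightarrow> ('a \<Rightarrow> 'b) \<Rightarrow> bool" where
  "holomorphic_map X A Y B f \<longleftrightarrow> continuous_map X Y f \<and>
     (\<forall>(V, \<phi>)\<in>A. \<forall>(W, \<psi>)\<in>B. holo_on (\<psi> \<circ> f \<circ> inv_into V \<phi>) (\<phi> ` {x \<in> V. f x \<in> W}))"

definition biholomorphic_map ::
  "'a topology \<Rightarrow> ('a, 'd::finite) chart set \<Rightarrow> 'b topology \<Rightarrow> ('b, 'e::finite) chart set \<Rightarrow> ('a \<Rightarrow> 'b) \<Rightarrow> bool" where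
  "biholomorphic_map X A Y B f \<longleftrightarrow>
     (\<exists>g. homeomorphic_maps X Y f g \<and> holomorphic_map X A Y B f \<and> holomorphic_map Y B X A g)"

definition sub_atlas :: "('a, 'd::finite) chart set \<Rightarrow> 'a set \<Rightarrow> ('a, 'd::finite) chart set" where
  "sub_atlas A V = (\<lambda>(W, \<phi>). (V \<inter> W, \<phi>)) ` A"

definition vec_join :: "'k^'d \<Rightarrow> 'k^'e \<Rightarrow> 'k^('d + 'e)" where
  "vec_join x y = (\<chi> i. case i of Inl j \<Rightarrow> x $ j | Inr j \<Rightarrow> y $ j)"

definition prod_atlas ::
  "('a, 'd::finite) chart set \<Rightarrow> ('b, 'e::finite) chart set \<Rightarrow> ('a \<times> 'b, 'd + 'e) chart set" where
  "prod_atlas A B =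
     {(V \<times> W, \<lambda>(x, y). vec_join (\<phi> x) (\<psi> y)) | V \<phi> W \<psi>. (V, \<phi>) \<in> A \<and> (W, \<psi>) \<in> B}"

definition pullback_atlas ::
  "'a set \<Rightarrow> ('a \<Rightarrow> 'b) \<Rightarrow> ('b, 'd::finite) chart set \<Rightarrow> ('a, 'd::finite) chart set" where
  "pullback_atlas Z j A = (\<lambda>(V, \<phi>). ({z \<in> Z. j z \<in> V}, \<phi> \<circ> j)) ` A"

text \<open>The complex structure of a quotient of a complex submanifold \<open>S\<close> of \<open>complex^'m\<close>: the
  charts of the quotient space in which the projection \<open>p\<close> is a holomorphic submersion, that
  is, is holomorphic and has a local holomorphic section through every point of \<open>S\<close>. These
  charts are always holomorphically compatible; it is for a given \<open>S\<close> and \<open>p\<close> to be proved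
  that they cover the quotient.\<close>
definition quotient_atlas :: "(complex^'m) set \<Rightarrow> (complex^'m \<Rightarrow> 'a) \<Rightarrow> ('a, 'd::finite) chart set" where
  "quotient_atlas S p =
     {(V, \<phi>). chart_on (quotient_topology (top_of_set S) p) (V, \<phi>) \<and>
        holo_on (\<phi> \<circ> p) {u \<in> S. p u \<in> V} \<and>
        (\<forall>u\<in>S. p u \<in> V \<longrightarrow>
           (\<exists>W s. open W \<and> \<phi> (p u) \<in> W \<and> W \<subseteq> \<phi> ` V \<and> holo_on s W \<and> s (\<phi> (p u)) = u \<and>
              (\<forall>w\<in>W. s w \<in> S \<and> p (s w) = inv_into V \<phi> w)))}"

section \<open>Complex Lie groups, tori and holomorphic principal bundles\<close>

definition complex_lie_group ::
  "('g, 'x) monoid_scheme \<Rightarrow> 'g topology \<Rightarrow> ('g, 'd::finite) chart set \<Rightarrow> bool" where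
  "complex_lie_group H T A \<longleftrightarrow> group H \<and> topspace T = carrier H \<and> complex_manifold T A \<and>
     holomorphic_map (prod_topology T T) (prod_atlas A A) T A (\<lambda>(x, y). mult H x y) \<and>
     holomorphic_map T A T A (m_inv H)"

definition holomorphic_action ::
  "('g, 'x) monoid_scheme \<Rightarrow> 'g topology \<Rightarrow> ('g, 'd::finite) chart set \<Rightarrow>
   'a topology \<Rightarrow> ('a, 'e::finite) chart set \<Rightarrow> ('g \<Rightarrow> 'a \<Rightarrow> 'a) \<Rightarrow> bool" where
  "holomorphic_action H T AH X A act \<longleftrightarrow>
     complex_lie_group H T AH \<and> complex_manifold X A \<and> group_action H (topspace X) act \<and>
     holomorphic_map (prod_topology T X) (prod_atlas AH A) X A (\<lambda>(h, x). act h x)"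

text \<open>A left action, which for the commutative groups considered here makes no difference.\<close>
definition holomorphic_principal_bundle ::
  "'e topology \<Rightarrow> ('e, 'de::finite) chart set \<Rightarrow> 'b topology \<Rightarrow> ('b, 'db::finite) chart set \<Rightarrow> ('e \<Rightarrow> 'b) \<Rightarrow>
   ('g, 'x) monoid_scheme \<Rightarrow> 'g topology \<Rightarrow> ('g, 'dg::finite) chart set \<Rightarrow> ('g \<Rightarrow> 'e \<Rightarrow> 'e) \<Rightarrow> bool" where
  "holomorphic_principal_bundle P AP B AB p H T AH act \<longleftrightarrow>
     holomorphic_action H T AH P AP act \<and> complex_manifold B AB \<and> holomorphic_map P AP B AB p \<and>
     (\<forall>b\<in>topspace B. \<exists>V \<tau>. openin B V \<and> b \<in> V \<and>
        biholomorphic_map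
          (prod_topology (subtopology B V) T) (prod_atlas (sub_atlas AB V) AH)
          (subtopology P {e \<in> topspace P. p e \<in> V}) (sub_atlas AP {e \<in> topspace P. p e \<in> V}) \<tau> \<and>
        (\<forall>x\<in>V. \<forall>h\<in>carrier H. p (\<tau> (x, h)) = x \<and>
           (\<forall>g\<in>carrier H. \<tau> (x, mult H g h) = act g (\<tau> (x, h)))))"

text \<open>A complex Lie group isomorphic to the quotient of \<open>complex^'d\<close> by the subgroup generated
  by a real basis.\<close>
definition compact_complex_torus ::
  "('g, 'x) monoid_scheme \<Rightarrow> 'g topology \<Rightarrow> ('g, 'd::finite) chart set \<Rightarrow> bool" where
  "compact_complex_torus H T A \<longleftrightarrow> complex_lie_group H T A \<and>
     (\<exists>(B :: (complex^'d) set) L f. independent B \<and> span B = UNIV \<and> L = int_span B \<and>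
        f \<in> iso (add_group Mod L) H \<and>
        biholomorphic_map
          (quotient_topology euclidean (r_coset add_group L))
          (quotient_atlas UNIV (r_coset add_group L) :: (_, 'd) chart set) T A f)"

section \<open>The spaces and groups of a fan\<close>

definition toric_proj :: "('m::finite \<Rightarrow> int^'n) \<Rightarrow> complex^'m \<Rightarrow> (complex^'m) set" where
  "toric_proj a = orbit (mult_group (G_fan a)) (*)"

definition toric_variety ::
  "(real^'n) set set \<Rightarrow> ('m::finite \<Rightarrow> int^'n) \<Rightarrow> (complex^'m) set topology" where
  "toric_variety \<Sigma> a =
     quotient_topology (top_of_set (arrangement_complement (fan_complex \<Sigma> a))) (toric_proj a)"

definition toric_atlas ::
  "(real^'n) set set \<Rightarrow> ('m::finite \<Rightarrow> int^'n) \<Rightarrow> ((complex^'m) set, 'n) chart set" where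
  "toric_atlas \<Sigma> a =
     quotient_atlas (arrangement_complement (fan_complex \<Sigma> a)) (toric_proj a)"

definition C_orbit :: "(complex^'l \<Rightarrow> complex^'m) \<Rightarrow> complex^'m \<Rightarrow> (complex^'m) set" where
  "C_orbit \<Psi> = orbit (mult_group (C_sub \<Psi>)) (*)"

text \<open>The complex structure of \<open>U(K)/C\<close>, carried over to the moment-angle manifold by the map
  sending a point to its \<open>C\<close>-orbit. Its dimension is \<open>m - \<ell> = n + \<ell>\<close>.\<close>
definition moment_angle_atlas ::
  "(real^'n) set set \<Rightarrow> ('m::finite \<Rightarrow> int^'n) \<Rightarrow> (complex^'l \<Rightarrow> complex^'m) \<Rightarrow>
   (complex^'m, 'n + 'l) chart set" where
  "moment_angle_atlas \<Sigma> a \<Psi> =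
     pullback_atlas (moment_angle (fan_complex \<Sigma> a)) (C_orbit \<Psi>)
       (quotient_atlas (arrangement_complement (fan_complex \<Sigma> a)) (C_orbit \<Psi>))"

definition GC_group ::
  "('m::finite \<Rightarrow> int^'n) \<Rightarrow> (complex^'l \<Rightarrow> complex^'m) \<Rightarrow> (complex^'m) set monoid" where
  "GC_group a \<Psi> = mult_group (G_fan a) Mod C_sub \<Psi>"

definition GC_topology ::
  "('m::finite \<Rightarrow> int^'n) \<Rightarrow> (complex^'l \<Rightarrow> complex^'m) \<Rightarrow> (complex^'m) set topology" where
  "GC_topology a \<Psi> =
     quotient_topology (top_of_set (G_fan a)) (r_coset (mult_group (G_fan a)) (C_sub \<Psi>))"

definition GC_atlas ::
  "('m::finite \<Rightarrow> int^'n) \<Rightarrow> (complex^'l \<Rightarrow> complex^'m) \<Rightarrow> ((complex^'m) set, 'l) chart set" where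
  "GC_atlas a \<Psi> = quotient_atlas (G_fan a) (r_coset (mult_group (G_fan a)) (C_sub \<Psi>))"

text \<open>A coset \<open>\<gamma>\<close> sends the orbit \<open>C z\<close> to the orbit \<open>\<gamma> z\<close>; the action on the moment-angle
  manifold is transported along the bijection \<open>z \<mapsto> C z\<close>. The restriction is
  demanded by \<^const>\<open>group_action\<close>.\<close>
definition GC_action ::
  "(real^'n) set set \<Rightarrow> ('m::finite \<Rightarrow> int^'n) \<Rightarrow> (complex^'l \<Rightarrow> complex^'m) \<Rightarrow>
   (complex^'m) set \<Rightarrow> complex^'m \<Rightarrow> complex^'m" where
  "GC_action \<Sigma> a \<Psi> \<gamma> =
     (\<lambda>z \<in> moment_angle (fan_complex \<Sigma> a).
        inv_into (moment_angle (fan_complex \<Sigma> a)) (C_orbit \<Psi>)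
          {g * u | g u. g \<in> \<gamma> \<and> u \<in> C_orbit \<Psi> z})"

end

theory Submission
  imports Defs
begin

text \<open>Each vector is a nonnegative combination of the generators of exactly one cone, with unique
  coefficients. In logarithmic absolute values this says that every orbit of \<open>C_sub \<Psi>\<close> in \<open>U(K)\<close>
  meets the moment-angle manifold exactly once, and the same uniqueness gives the properness of the
  action of \<open>G_fan a\<close>, hence the continuity of the retraction onto the moment-angle manifold and
  the Hausdorff property of the quotients.

  The kernel of the complexified \<open>Lambda_R\<close> is the direct sum of the image of \<open>\<Psi>\<close> and its complex
  conjugate. Exponentiating this decomposition gives explicit slices, hence charts, for
  \<open>U(K)/C_sub \<Psi>\<close> and \<open>G_fan a / C_sub \<Psi>\<close>. If the fan is regular, the dual basis of a
  maximal cone \<open>J\<close> consists of characters, which split the set of points with nonzero coordinates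
  outside \<open>J\<close> as \<open>G_fan a\<close> times an affine space; this trivializes the bundle, and the same
  dual basis yields a basis of the period lattice of the fibre.\<close>

section \<open>Holomorphic maps of several variables\<close>

text \<open>\<open>quotient_atlas\<close> describes charts by local holomorphic sections, so every
  space of the theorem is treated as a quotient of a subset of some complex coordinate space
  (\<open>quot_mfd\<close>). A map between such quotients is holomorphic once it has local
  holomorphic lifts, and the lifts that occur are explicit: products, inverses, exponentials,
  logarithms and monomials. The moment-angle manifold fits in only because its complex structure
  comes from the quotient of \<open>U\<close> and not from the inclusion into
  \<open>complex^'m\<close>. Two obstacles shape the middle part. Logarithms of absolute values
  break down at vanishing coordinates, so existence and uniqueness of nonnegative representations
  are needed in a stronger form, with coefficients of arbitrary sign on the simplex of vanishing
  coordinates (\<open>star_cover\<close>, \<open>star_uniq\<close>). Moreover, explicit coordinates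
  need a simplex of exactly n elements (\<open>pure\<close>): the 2\<ell> real coordinates outside
  it are as many as the real dimension of \<open>complex^'l\<close>, so that real parts there can be
  inverted linearly.\<close>

definition cdiff_at :: "(complex^'a \<Rightarrow> complex) \<Rightarrow> complex^'a \<Rightarrow> bool" where
  "cdiff_at f y \<longleftrightarrow> (\<exists>D. (f has_derivative D) (at y) \<and> (\<forall>c v. D (c *s v) = c * D v))"

text \<open>The condition that \<open>holo_on\<close> imposes at each point of the neighbourhood,
  split off so that the rules of differential calculus can be stated for it.\<close>

definition holo_at :: "(complex^'a \<Rightarrow> complex^'b) \<Rightarrow> complex^'a \<Rightarrow> bool" where
  "holo_at f y \<longleftrightarrow> (\<exists>D. Vector_Spaces.linear (*s) (*s) D \<and> (f has_derivative D) (at y))"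

lemma cdiff_at_const: "cdiff_at (\<lambda>z. c) y"
  unfolding cdiff_at_def by (rule exI[of _ "\<lambda>_. 0"]) auto

lemma cdiff_at_nth: "cdiff_at (\<lambda>z. z $ i) y"
  unfolding cdiff_at_def
  by (rule exI[of _ "\<lambda>z. z $ i"]) (auto intro!: bounded_linear_imp_has_derivative
      bounded_linear_vec_nth)

lemma cdiff_at_add:
  assumes "cdiff_at f y" "cdiff_at g y"
  shows "cdiff_at (\<lambda>z. f z + g z) y"
proof -
  obtain D E where "(f has_derivative D) (at y)" "(g has_derivative E) (at y)"
     and "\<forall>c v. D (c *s v) = c * D v" "\<forall>c v. E (c *s v) = c * E v"
    using assms unfolding cdiff_at_def by blast
  then show ?thesis unfolding cdiff_at_def
    by (intro exI[of _ "\<lambda>h. D h + E h"]) (auto intro!: has_derivative_add simp: algebra_simps)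
qed

lemma cdiff_at_mult:
  assumes "cdiff_at f y" "cdiff_at g y"
  shows "cdiff_at (\<lambda>z. f z * g z) y"
proof -
  obtain D E where "(f has_derivative D) (at y)" "(g has_derivative E) (at y)"
     and "\<forall>c v. D (c *s v) = c * D v" "\<forall>c v. E (c *s v) = c * E v"
    using assms unfolding cdiff_at_def by blast
  then show ?thesis unfolding cdiff_at_def
    using has_derivative_mult[of f D y UNIV g E]
    by (intro exI[of _ "\<lambda>h. f y * E h + D h * g y"]) (auto simp: algebra_simps)
qed

lemma cdiff_at_compose:
  assumes "cdiff_at f y" "(g has_field_derivative g') (at (f y))"
  shows "cdiff_at (\<lambda>z. g (f z)) y"
proof -
  obtain D where D: "(f has_derivative D) (at y)" "\<forall>c v. D (c *s v) = c * D v"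
    using assms unfolding cdiff_at_def by blast
  have "((\<lambda>z. g (f z)) has_derivative (\<lambda>h. g' * D h)) (at y)"
    using has_derivative_compose[OF D(1)] assms(2) unfolding has_field_derivative_def by blast
  then show ?thesis unfolding cdiff_at_def
    using D(2) by (intro exI[of _ "\<lambda>h. g' * D h"]) (auto simp: algebra_simps)
qed

lemma cdiff_at_exp: "cdiff_at f y \<Longrightarrow> cdiff_at (\<lambda>z. exp (f z)) y"
  by (erule cdiff_at_compose) (rule DERIV_exp)

lemma cdiff_at_Ln: "cdiff_at f y \<Longrightarrow> f y \<notin> \<real>\<^sub>\<le>\<^sub>0 \<Longrightarrow> cdiff_at (\<lambda>z. Ln (f z)) y"
  by (erule cdiff_at_compose) (rule has_field_derivative_Ln)

lemma cdiff_at_inverse: "cdiff_at f y \<Longrightarrow> f y \<noteq> 0 \<Longrightarrow> cdiff_at (\<lambda>z. inverse (f z)) y"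
  by (erule cdiff_at_compose) (rule DERIV_inverse)

lemma cdiff_at_divide:
  "cdiff_at f y \<Longrightarrow> cdiff_at g y \<Longrightarrow> g y \<noteq> 0 \<Longrightarrow> cdiff_at (\<lambda>z. f z / g z) y"
  unfolding divide_inverse by (intro cdiff_at_mult cdiff_at_inverse)

lemma cdiff_at_sum: "(\<And>i. i \<in> I \<Longrightarrow> cdiff_at (f i) y) \<Longrightarrow> cdiff_at (\<lambda>z. \<Sum>i\<in>I. f i z) y"
  by (induction I rule: infinite_finite_induct) (auto intro!: cdiff_at_const cdiff_at_add)

lemma cdiff_at_prod: "(\<And>i. i \<in> I \<Longrightarrow> cdiff_at (f i) y) \<Longrightarrow> cdiff_at (\<lambda>z. \<Prod>i\<in>I. f i z) y"
  by (induction I rule: infinite_finite_induct) (auto intro!: cdiff_at_const cdiff_at_mult)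

lemma cdiff_at_power: "cdiff_at f y \<Longrightarrow> cdiff_at (\<lambda>z. f z ^ k) y"
  by (induction k) (auto intro!: cdiff_at_const cdiff_at_mult)

lemma cdiff_at_powi: "cdiff_at f y \<Longrightarrow> f y \<noteq> 0 \<Longrightarrow> cdiff_at (\<lambda>z. f z powi k) y"
  by (cases "k \<ge> 0") (auto simp: power_int_def intro!: cdiff_at_power cdiff_at_inverse)

text \<open>Differentiability and complex linearity of the derivative can both be tested on
  components. All calculus is therefore done with scalar functions, where products and compositions
  with one-variable functions are available.\<close>

lemma holo_at_iff: "holo_at f y \<longleftrightarrow> (\<forall>i. cdiff_at (\<lambda>z. f z $ i) y)"
proof
  assume "holo_at f y"
  then obtain D where D: "Vector_Spaces.linear (*s) (*s) D" "(f has_derivative D) (at y)"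
    unfolding holo_at_def by blast
  show "\<forall>i. cdiff_at (\<lambda>z. f z $ i) y"
  proof
    fix i
    have "((\<lambda>z. f z $ i) has_derivative (\<lambda>h. D h $ i)) (at y)"
      using bounded_linear.has_derivative[OF bounded_linear_vec_nth D(2)] .
    then show "cdiff_at (\<lambda>z. f z $ i) y"
      unfolding cdiff_at_def
      by (intro exI[of _ "\<lambda>h. D h $ i"]) (auto simp: vec.linear_scale[OF D(1)])
  qed
next
  assume "\<forall>i. cdiff_at (\<lambda>z. f z $ i) y"
  then obtain D where D: "\<And>i. ((\<lambda>z. f z $ i) has_derivative D i) (at y)"
      "\<And>i c v. D i (c *s v) = c * D i v"
    unfolding cdiff_at_def by metis
  have lin: "linear (D i)" for i
    using D(1) has_derivative_linear by blast
  have "(f has_derivative (\<lambda>h. \<chi> i. D i h)) (at y)"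
  proof (subst has_derivative_componentwise_within, intro ballI)
    fix b :: "complex^'b" assume "b \<in> Basis"
    then obtain i u where b: "b = axis i u" "u \<in> Basis" by (auto simp: Basis_vec_def)
    have *: "x \<bullet> b = (x $ i) \<bullet> u" for x :: "complex^'b"
      by (simp add: b inner_axis)
    show "((\<lambda>x. f x \<bullet> b) has_derivative (\<lambda>x. (\<chi> i. D i x) \<bullet> b)) (at y)"
      unfolding * using has_derivative_inner_left[OF D(1)[of i], of u] by simp
  qed
  moreover have "Vector_Spaces.linear (*s) (*s) (\<lambda>h. \<chi> i. D i h)"
    by (unfold_locales) (auto simp: vec_eq_iff D(2) linear_add[OF lin])
  ultimately show "holo_at f y" unfolding holo_at_def by blast
qed

lemma holo_at_compose: "holo_at f y \<Longrightarrow> holo_at g (f y) \<Longrightarrow> holo_at (g \<circ> f) y"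
  unfolding holo_at_def
  using diff_chain_at Vector_Spaces.linear_compose by blast

lemma holo_at_imp_isCont: "holo_at f y \<Longrightarrow> isCont f y"
  unfolding holo_at_def using has_derivative_continuous by blast

lemma holo_at_imp_continuous_on: "(\<And>y. y \<in> N \<Longrightarrow> holo_at f y) \<Longrightarrow> continuous_on N f"
  by (meson continuous_at_imp_continuous_on holo_at_imp_isCont)

definition holo_near :: "(complex^'a \<Rightarrow> complex^'b) \<Rightarrow> (complex^'a) set \<Rightarrow> complex^'a \<Rightarrow> bool" where
  "holo_near f S x \<longleftrightarrow> (\<exists>N g. open N \<and> x \<in> N \<and> (\<forall>y\<in>N \<inter> S. g y = f y) \<and> (\<forall>y\<in>N. holo_at g y))"

lemma holo_on_iff: "holo_on f S \<longleftrightarrow> (\<forall>x\<in>S. holo_near f S x)"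
  unfolding holo_on_def holo_near_def holo_at_def ..

lemma holo_nearI:
  assumes "open N" "x \<in> N" "\<And>y. y \<in> N \<Longrightarrow> y \<in> S \<Longrightarrow> g y = f y" "\<And>y. y \<in> N \<Longrightarrow> holo_at g y"
  shows "holo_near f S x"
  unfolding holo_near_def by (rule exI[of _ N], rule exI[of _ g]) (simp add: assms)

lemma holo_onE:
  assumes "holo_on f S" "x \<in> S"
  obtains N g where "open N" "x \<in> N" "\<And>y. y \<in> N \<Longrightarrow> y \<in> S \<Longrightarrow> g y = f y"
    "\<And>y. y \<in> N \<Longrightarrow> holo_at g y"
  using assms(1)[unfolded holo_on_iff, rule_format, OF assms(2)] unfolding holo_near_def
  using that by (elim exE conjE) (metis IntI)

lemma holo_onI:
  assumes "\<And>x. x \<in> S \<Longrightarrow> \<exists>N. open N \<and> x \<in> N \<and> holo_on f (N \<inter> S)"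
  shows "holo_on f S"
  unfolding holo_on_iff
proof
  fix x assume x: "x \<in> S"
  then obtain N where N: "open N" "x \<in> N" "holo_on f (N \<inter> S)"
    using assms by blast
  obtain M h where "open M" "x \<in> M" "\<And>y. y \<in> M \<Longrightarrow> y \<in> N \<inter> S \<Longrightarrow> h y = f y"
      "\<And>y. y \<in> M \<Longrightarrow> holo_at h y"
    using holo_onE[OF N(3)] x N(2) by blast
  then show "holo_near f S x"
    using N by (intro holo_nearI[of "M \<inter> N" x S h f]) auto
qed

lemma holo_on_openI: "open N \<Longrightarrow> (\<And>y. y \<in> N \<Longrightarrow> holo_at f y) \<Longrightarrow> holo_on f N"
  unfolding holo_on_iff by (intro ballI holo_nearI[of N _ N f]) auto

lemma holo_on_subset:
  assumes "holo_on f S" "T \<subseteq> S"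
  shows "holo_on f T"
  unfolding holo_on_iff
proof
  fix x assume "x \<in> T"
  with assms(2) have "x \<in> S" by blast
  from holo_onE[OF assms(1) this] obtain N g where N: "open N" "x \<in> N"
      "\<And>y. y \<in> N \<Longrightarrow> y \<in> S \<Longrightarrow> g y = f y" "\<And>y. y \<in> N \<Longrightarrow> holo_at g y"
    by metis
  show "holo_near f T x"
    by (rule holo_nearI[of N x T g f]) (use N assms(2) in auto)
qed

lemma holo_on_cong:
  assumes "holo_on f S" "\<And>x. x \<in> S \<Longrightarrow> g x = f x"
  shows "holo_on g S"
  unfolding holo_on_iff
proof
  fix x assume "x \<in> S"
  from holo_onE[OF assms(1) this] obtain N h where N: "open N" "x \<in> N"
      "\<And>y. y \<in> N \<Longrightarrow> y \<in> S \<Longrightarrow> h y = f y" "\<And>y. y \<in> N \<Longrightarrow> holo_at h y"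
    by metis
  show "holo_near g S x"
    by (rule holo_nearI[of N x S h g]) (use N assms(2) in auto)
qed

text \<open>Off \<open>S\<close> the local extension \<open>f'\<close> may leave \<open>T\<close>.
  This does no harm, because \<open>g'\<close> is holomorphic on the open set \<open>M\<close>, and
  \<open>f'\<close> is continuous, so shrinking to the preimage of \<open>M\<close>
  suffices.\<close>

lemma holo_on_compose:
  assumes "holo_on f S" "holo_on g T" "f ` S \<subseteq> T"
  shows "holo_on (g \<circ> f) S"
  unfolding holo_on_iff
proof
  fix x assume x: "x \<in> S"
  obtain N f' where N: "open N" "x \<in> N" "\<And>y. y \<in> N \<Longrightarrow> y \<in> S \<Longrightarrow> f' y = f y"
      "\<And>y. y \<in> N \<Longrightarrow> holo_at f' y"
    using holo_onE[OF assms(1) x] by metis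
  have "f x \<in> T" using x assms(3) by blast
  from holo_onE[OF assms(2) this]
  obtain M g' where M: "open M" "f x \<in> M" "\<And>y. y \<in> M \<Longrightarrow> y \<in> T \<Longrightarrow> g' y = g y"
      "\<And>y. y \<in> M \<Longrightarrow> holo_at g' y"
    by metis
  show "holo_near (g \<circ> f) S x"
  proof (rule holo_nearI[of "N \<inter> f' -` M" x S "g' \<circ> f'" "g \<circ> f"])
    show "open (N \<inter> f' -` M)"
      using continuous_on_open_vimage[OF N(1)] holo_at_imp_continuous_on[of N f'] N(4) M(1)
      by (metis Int_commute)
    show "x \<in> N \<inter> f' -` M" using N(2,3) M(2) x by simp
    fix y assume y: "y \<in> N \<inter> f' -` M"
    show "holo_at (g' \<circ> f') y" using y N(4) M(4) by (intro holo_at_compose) auto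
    assume "y \<in> S"
    then have "f' y = f y" "f y \<in> T" using y N(3) assms(3) by auto
    then show "(g' \<circ> f') y = (g \<circ> f) y" using y M(3) by simp
  qed
qed

lemma holo_on_imp_continuous_on:
  assumes "holo_on f S"
  shows "continuous_on S f"
proof (rule continuous_on_eq_continuous_within[THEN iffD2], intro ballI)
  fix x assume x: "x \<in> S"
  obtain N f' where N: "open N" "x \<in> N" "\<And>y. y \<in> N \<Longrightarrow> y \<in> S \<Longrightarrow> f' y = f y"
      "\<And>y. y \<in> N \<Longrightarrow> holo_at f' y"
    using holo_onE[OF assms(1) x] by metis
  have "continuous (at x within S) f'"
    using N holo_at_imp_isCont continuous_at_imp_continuous_at_within by blast
  then show "continuous (at x within S) f"
  proof (rule continuous_transform_within_openin)
    show "openin (top_of_set S) (S \<inter> N)" using N by auto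
  qed (use N x in auto)
qed

lemma holo_on_id: "holo_on (\<lambda>x. x) S"
  by (rule holo_on_subset[OF _ subset_UNIV], rule holo_on_openI)
    (simp_all add: holo_at_iff cdiff_at_nth)

section \<open>Coordinates of products\<close>

definition vec_left :: "'k^('d::finite + 'e::finite) \<Rightarrow> 'k^'d" where "vec_left x = (\<chi> j. x $ Inl j)"
definition vec_right :: "'k^('d::finite + 'e::finite) \<Rightarrow> 'k^'e" where "vec_right x = (\<chi> j. x $ Inr
    j)"

lemma vec_left_join [simp]: "vec_left (vec_join x y) = x"
  and vec_right_join [simp]: "vec_right (vec_join x y) = y"
  and vec_join_left_right [simp]: "vec_join (vec_left z) (vec_right z) = z"
  by (auto simp: vec_left_def vec_right_def vec_join_def vec_eq_iff split: sum.split)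

lemma vec_left_nth [simp]: "vec_left x $ j = x $ Inl j"
  and vec_right_nth [simp]: "vec_right x $ k = x $ Inr k"
  and vec_join_nth [simp]: "vec_join u v $ Inl j = u $ j" "vec_join u v $ Inr k = v $ k"
  by (auto simp: vec_left_def vec_right_def vec_join_def)

lemma vec_join_eq_iff [simp]: "vec_join x y = vec_join x' y' \<longleftrightarrow> x = x' \<and> y = y'"
  by (metis vec_left_join vec_right_join)

lemma holo_at_vec_join:
  assumes "holo_at f y" "holo_at g y"
  shows "holo_at (\<lambda>z. vec_join (f z) (g z)) y"
  unfolding holo_at_iff
proof
  fix i show "cdiff_at (\<lambda>z. vec_join (f z) (g z) $ i) y"
    using assms unfolding holo_at_iff by (cases i) (auto simp: vec_join_def)
qed

lemma holo_on_vec_join: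
  assumes "holo_on f S" "holo_on g S"
  shows "holo_on (\<lambda>z. vec_join (f z) (g z)) S"
  unfolding holo_on_iff
proof
  fix x assume x: "x \<in> S"
  obtain N f' where N: "open N" "x \<in> N" "\<And>y. y \<in> N \<Longrightarrow> y \<in> S \<Longrightarrow> f' y = f y"
      "\<And>y. y \<in> N \<Longrightarrow> holo_at f' y"
    using holo_onE[OF assms(1) x] by metis
  obtain M g' where M: "open M" "x \<in> M" "\<And>y. y \<in> M \<Longrightarrow> y \<in> S \<Longrightarrow> g' y = g y"
      "\<And>y. y \<in> M \<Longrightarrow> holo_at g' y"
    using holo_onE[OF assms(2) x] by metis
  show "holo_near (\<lambda>z. vec_join (f z) (g z)) S x"
    by (rule holo_nearI[of "N \<inter> M" x S "\<lambda>z. vec_join (f' z) (g' z)"])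
      (use N M in \<open>auto intro!: holo_at_vec_join\<close>)
qed

lemma holo_on_vec_left: "holo_on vec_left S" and holo_on_vec_right: "holo_on vec_right S"
  by (rule holo_on_subset[OF _ subset_UNIV], rule holo_on_openI;
      simp add: holo_at_iff cdiff_at_nth)+

lemma continuous_on_vec_join:
  "continuous_on S (\<lambda>(x, y). vec_join x y :: complex^('d::finite + 'e::finite))"
proof -
  have "continuous_on S (\<lambda>z. case i of Inl j \<Rightarrow> fst z $ j | Inr k \<Rightarrow> (snd z $ k :: complex))"
    for i :: "'d + 'e" and S :: "((complex^'d) \<times> (complex^'e)) set"
    by (cases i) (auto intro!: continuous_intros)
  then have "continuous_on S (\<lambda>z. \<chi> i::'d + 'e. (case i of Inl j \<Rightarrow> fst z $ j | Inr k \<Rightarrow> (snd z $ k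
      :: complex)))"
    by (intro continuous_on_vec_lambda)
  then show ?thesis
    by (simp add: vec_join_def case_prod_beta)
qed

lemma continuous_on_vec_left: "continuous_on S (vec_left :: complex^('d::finite + 'e::finite) \<Rightarrow> _)"
  and continuous_on_vec_right: "continuous_on S (vec_right :: complex^('d::finite + 'e::finite) \<Rightarrow>
      _)"
  using holo_on_imp_continuous_on holo_on_vec_left holo_on_vec_right by blast+

section \<open>Quotients of subsets of complex space by maps with local holomorphic sections\<close>

text \<open>A chart of the quotient described entirely on \<open>S\<close>. Neither the quotient
  topology nor the property of being a homeomorphism is mentioned: the latter follows from the local
  sections, as \<open>mem_quotient_atlas_iff\<close> shows.\<close>

definition qchart :: "(complex^'m) set \<Rightarrow> (complex^'m \<Rightarrow> 'a) \<Rightarrow> 'a set \<Rightarrow> ('a \<Rightarrow> complex^'d) \<Rightarrow> bool"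
    where
  "qchart S p V \<phi> \<longleftrightarrow> V \<subseteq> p ` S \<and> openin (top_of_set S) {u \<in> S. p u \<in> V} \<and>
     holo_on (\<phi> \<circ> p) {u \<in> S. p u \<in> V} \<and> inj_on \<phi> V \<and>
     (\<forall>u\<in>S. p u \<in> V \<longrightarrow> (\<exists>W s. open W \<and> \<phi> (p u) \<in> W \<and> holo_on s W \<and> s (\<phi> (p u)) = u \<and>
        (\<forall>w\<in>W. s w \<in> S \<and> p (s w) \<in> V \<and> \<phi> (p (s w)) = w)))"

lemma qchartD:
  assumes "qchart S p V \<phi>"
  shows "V \<subseteq> p ` S" "openin (top_of_set S) {u \<in> S. p u \<in> V}"
    "holo_on (\<phi> \<circ> p) {u \<in> S. p u \<in> V}" "inj_on \<phi> V"
  using assms unfolding qchart_def by simp_all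

lemma qchart_section:
  assumes "qchart S p V \<phi>" "u \<in> S" "p u \<in> V"
  obtains W s where "open W" "\<phi> (p u) \<in> W" "holo_on s W" "s (\<phi> (p u)) = u"
    "\<And>w. w \<in> W \<Longrightarrow> s w \<in> S" "\<And>w. w \<in> W \<Longrightarrow> p (s w) \<in> V" "\<And>w. w \<in> W \<Longrightarrow> \<phi> (p (s w)) = w"
    "\<And>w. w \<in> W \<Longrightarrow> inv_into V \<phi> w = p (s w)"
proof -
  obtain W s where W: "open W" "\<phi> (p u) \<in> W" "holo_on s W" "s (\<phi> (p u)) = u"
    "\<forall>w\<in>W. s w \<in> S \<and> p (s w) \<in> V \<and> \<phi> (p (s w)) = w"
    using assms unfolding qchart_def by meson
  moreover have "inv_into V \<phi> w = p (s w)" if "w \<in> W" for w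
    using W(5) that inv_into_f_f[OF qchartD(4)[OF assms(1)], of "p (s w)"] by metis
  ultimately show thesis using that by blast
qed

lemma qchart_open_preimage:
  assumes "qchart S p V \<phi>" "open W"
  shows "openin (top_of_set S) {u \<in> S. p u \<in> V \<and> \<phi> (p u) \<in> W}"
proof -
  have "openin (top_of_set {u \<in> S. p u \<in> V}) ({u \<in> S. p u \<in> V} \<inter> (\<phi> \<circ> p) -` W)"
    using holo_on_imp_continuous_on[OF qchartD(3)[OF assms(1)]] assms(2)
    by (rule continuous_openin_preimage_gen)
  moreover have "{u \<in> S. p u \<in> V} \<inter> (\<phi> \<circ> p) -` W = {u \<in> S. p u \<in> V \<and> \<phi> (p u) \<in> W}" by auto
  ultimately show ?thesis using openin_trans[OF _ qchartD(2)[OF assms(1)]] by simp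
qed

lemma open_section_preimage:
  assumes "open W" "holo_on s W" "\<And>w. w \<in> W \<Longrightarrow> s w \<in> S" "openin (top_of_set S) N"
  shows "open {w \<in> W. s w \<in> N}"
proof -
  have "openin (top_of_set W) (W \<inter> s -` N)"
    by (rule continuous_openin_preimage[OF holo_on_imp_continuous_on[OF assms(2)] _ assms(4)])
      (use assms(3) in auto)
  moreover have "W \<inter> s -` N = {w \<in> W. s w \<in> N}" by auto
  ultimately show ?thesis using assms(1) by (simp add: openin_open_eq)
qed

lemma topspace_quotient_topology: "topspace (quotient_topology X p) = p ` topspace X"
  using quotient_map_quotient_topology[of X p] by (simp add: quotient_map_def)

text \<open>The sections make \<open>\<phi>\<close> an open map. If \<open>U\<close> is open in the
  quotient, then a section \<open>s\<close> pulls the open set above \<open>U\<close> back to an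
  open set of points \<open>w = \<phi> (p (s w))\<close>, all of them in the image of
  \<open>U\<close>. Continuity is inherited from \<open>\<phi> \<circ> p\<close>, so an injective
  \<open>\<phi>\<close> is a homeomorphism onto an open set.\<close>

lemma mem_quotient_atlas_iff:
  fixes \<phi> :: "'a \<Rightarrow> complex^'d"
  shows "(V, \<phi>) \<in> quotient_atlas S p \<longleftrightarrow> qchart S p V \<phi>"
proof
  assume "(V, \<phi>) \<in> quotient_atlas S p"
  then have c: "chart_on (quotient_topology (top_of_set S) p) (V, \<phi>)"
    and h: "holo_on (\<phi> \<circ> p) {u \<in> S. p u \<in> V}"
    and s: "\<forall>u\<in>S. p u \<in> V \<longrightarrow>
           (\<exists>W s. open W \<and> \<phi> (p u) \<in> W \<and> W \<subseteq> \<phi> ` V \<and> holo_on s W \<and> s (\<phi> (p u)) = u \<and>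
              (\<forall>w\<in>W. s w \<in> S \<and> p (s w) = inv_into V \<phi> w))"
    unfolding quotient_atlas_def by auto
  have V: "V \<subseteq> p ` S" "openin (top_of_set S) {u \<in> S. p u \<in> V}"
    using c unfolding chart_on_def openin_quotient_topology by auto
  have "inj_on \<phi> (topspace (subtopology (quotient_topology (top_of_set S) p) V))"
    using c unfolding chart_on_def
    by (auto dest: homeomorphic_imp_injective_map)
  then have inj: "inj_on \<phi> V"
    using V(1) by (simp add: topspace_quotient_topology Int_absorb1)
  show "qchart S p V \<phi>"
    unfolding qchart_def
  proof (intro conjI V h inj ballI impI)
    fix u assume "u \<in> S" "p u \<in> V"
    then obtain W s where W: "open W" "\<phi> (p u) \<in> W" "W \<subseteq> \<phi> ` V" "holo_on s W" "s (\<phi> (p u)) = u"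
       "\<forall>w\<in>W. s w \<in> S \<and> p (s w) = inv_into V \<phi> w" using s by meson
    then show "\<exists>W s. open W \<and> \<phi> (p u) \<in> W \<and> holo_on s W \<and> s (\<phi> (p u)) = u \<and>
        (\<forall>w\<in>W. s w \<in> S \<and> p (s w) \<in> V \<and> \<phi> (p (s w)) = w)"
      by (intro exI[of _ W] exI[of _ s]) (auto intro: inv_into_into f_inv_into_f)
  qed
next
  assume q: "qchart S p V \<phi>"
  let ?X = "quotient_topology (top_of_set S) p"
  note V = qchartD[OF q]
  have oX: "openin ?X U \<longleftrightarrow> U \<subseteq> p ` S \<and> openin (top_of_set S) {u \<in> S. p u \<in> U}" for U
    by (simp add: openin_quotient_topology)
  have oV: "openin ?X V" using V oX by blast
  have om: "open (\<phi> ` U)" if U: "openin ?X U" "U \<subseteq> V" for U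
  proof (subst open_subopen, intro ballI)
    fix y assume "y \<in> \<phi> ` U"
    then obtain u where u: "u \<in> S" "p u \<in> U" "y = \<phi> (p u)" using U V(1) by blast
    then have "p u \<in> V" using U by blast
    obtain W s where W: "open W" "\<phi> (p u) \<in> W" "holo_on s W" "s (\<phi> (p u)) = u"
      "\<And>w. w \<in> W \<Longrightarrow> s w \<in> S" "\<And>w. w \<in> W \<Longrightarrow> p (s w) \<in> V" "\<And>w. w \<in> W \<Longrightarrow> \<phi> (p (s w)) = w"
      using qchart_section[OF q u(1) \<open>p u \<in> V\<close>] by metis
    have "openin (top_of_set S) {u \<in> S. p u \<in> U}" using U oX by blast
    from open_section_preimage[OF W(1,3,5) this]
    have "open {w \<in> W. s w \<in> {u \<in> S. p u \<in> U}}" .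
    moreover have "{w \<in> W. s w \<in> {u \<in> S. p u \<in> U}} \<subseteq> \<phi> ` U"
    proof
      fix w assume w: "w \<in> {w \<in> W. s w \<in> {u \<in> S. p u \<in> U}}"
      then have "w = \<phi> (p (s w))" "p (s w) \<in> U" using W(7)[of w] by auto
      then show "w \<in> \<phi> ` U" by blast
    qed
    ultimately show "\<exists>T. open T \<and> y \<in> T \<and> T \<subseteq> \<phi> ` U"
      using W(2,4) u by (intro exI[of _ "{w \<in> W. s w \<in> {u \<in> S. p u \<in> U}}"]) auto
  qed
  have ts: "topspace (subtopology ?X V) = V"
    using V(1) by (simp add: topspace_quotient_topology Int_absorb1)
  have hom: "homeomorphic_map (subtopology ?X V) (top_of_set (\<phi> ` V)) \<phi>"
  proof (rule bijective_open_imp_homeomorphic_map)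
    show "continuous_map (subtopology ?X V) (top_of_set (\<phi> ` V)) \<phi>"
      unfolding continuous_map_in_subtopology
    proof
      show "continuous_map (subtopology ?X V) euclidean \<phi>"
        unfolding continuous_map_alt ts
      proof (intro conjI allI impI)
        fix W :: "(complex^'d) set" assume "openin euclidean W"
        then have "openin (top_of_set S) {u \<in> S. p u \<in> V \<and> \<phi> (p u) \<in> W}"
          by (intro qchart_open_preimage[OF q]) auto
        moreover have "{u \<in> S. p u \<in> V \<and> \<phi> (p u) \<in> W} = {u \<in> S. p u \<in> \<phi> -` W \<inter> V}" by auto
        ultimately have "openin ?X (\<phi> -` W \<inter> V)"
          using V(1) by (auto simp: oX)
        then show "openin (subtopology ?X V) (\<phi> -` W \<inter> V)"
          using oV by (simp add: openin_open_subtopology)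
      qed auto
    qed (simp add: ts)
    show "open_map (subtopology ?X V) (top_of_set (\<phi> ` V)) \<phi>"
      unfolding open_map_def
    proof (intro allI impI)
      fix U assume "openin (subtopology ?X V) U"
      then have U: "openin ?X U" "U \<subseteq> V" using oV by (auto simp: openin_open_subtopology)
      then show "openin (top_of_set (\<phi> ` V)) (\<phi> ` U)"
        by (metis image_mono om open_subset)
    qed
  qed (use V ts in auto)
  have c: "chart_on ?X (V, \<phi>)"
    unfolding chart_on_def using oV om[OF oV] hom by simp
  show "(V, \<phi>) \<in> quotient_atlas S p"
    unfolding quotient_atlas_def
  proof (intro CollectI case_prodI conjI c V(3) ballI impI)
    fix u assume u: "u \<in> S" "p u \<in> V"
    obtain W s where W: "open W" "\<phi> (p u) \<in> W" "holo_on s W" "s (\<phi> (p u)) = u"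
      "\<And>w. w \<in> W \<Longrightarrow> s w \<in> S" "\<And>w. w \<in> W \<Longrightarrow> p (s w) \<in> V" "\<And>w. w \<in> W \<Longrightarrow> \<phi> (p (s w)) = w"
      "\<And>w. w \<in> W \<Longrightarrow> inv_into V \<phi> w = p (s w)"
      using qchart_section[OF q u] by metis
    have "W \<subseteq> \<phi> ` V"
    proof
      fix w assume "w \<in> W" then show "w \<in> \<phi> ` V" using W(6,7)[of w] by (metis imageI)
    qed
    with W show "\<exists>W s. open W \<and> \<phi> (p u) \<in> W \<and> W \<subseteq> \<phi> ` V \<and> holo_on s W \<and> s (\<phi> (p u)) = u \<and>
              (\<forall>w\<in>W. s w \<in> S \<and> p (s w) = inv_into V \<phi> w)"
      by (intro exI[of _ W] exI[of _ s]) simp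
  qed
qed

lemma second_countable_euclidean: "second_countable (euclidean :: 'a::second_countable_topology
    topology)"
proof -
  obtain B :: "'a set set" where "countable B"
      "topological_basis B" using ex_countable_basis by blast
  then show ?thesis unfolding second_countable_def
    by (intro exI[of _ B]) (metis open_openin topological_basisE topological_basis_open)
qed

text \<open>Topology and atlas are parameters here, since open subsets, products and the pullback to
  the moment-angle manifold come with topologies and atlases of their own. It is enough that their
  charts are of the kind \<open>qchart\<close> and cover the space.\<close>

definition quot_mfd :: "'a topology \<Rightarrow> ('a, 'd::finite) chart set \<Rightarrow> (complex^'m) set \<Rightarrow> (complex^'m
    \<Rightarrow> 'a) \<Rightarrow> bool" where
  "quot_mfd X A S p \<longleftrightarrow> quotient_map (top_of_set S) X p \<and> (\<forall>(V, \<phi>)\<in>A. qchart S p V \<phi>) \<and>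
     \<Union>(fst ` A) = topspace X"

lemma quotient_map_imp_eq_quotient_topology:
  assumes "quotient_map X Y p"
  shows "Y = quotient_topology X p"
  using assms unfolding topology_eq openin_quotient_topology quotient_map_def
  by (metis openin_subset)

lemma quot_mfd_quotient_atlas:
  assumes "\<And>u. u \<in> S \<Longrightarrow> \<exists>V \<phi>. qchart S p V (\<phi> :: _ \<Rightarrow> complex^'d) \<and> p u \<in> V"
  shows "quot_mfd (quotient_topology (top_of_set S) p) (quotient_atlas S p :: (_, 'd) chart set)
      S p"
proof -
  have "\<Union>(fst ` (quotient_atlas S p :: (_, 'd) chart set)) = p ` S"
  proof (intro equalityI subsetI)
    fix x assume "x \<in> \<Union>(fst ` (quotient_atlas S p :: (_, 'd) chart set))"
    then obtain V and \<phi> :: "_ \<Rightarrow> complex^'d" where "(V, \<phi>) \<in> quotient_atlas S p" "x \<in> V" by auto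
    then show "x \<in> p ` S" using qchartD(1)[of S p V \<phi>] by (auto simp: mem_quotient_atlas_iff)
  next
    fix x assume "x \<in> p ` S"
    then obtain u where "u \<in> S" "x = p u" by auto
    then obtain V and \<phi> :: "_ \<Rightarrow> complex^'d" where "(V, \<phi>) \<in> quotient_atlas S p" "x \<in> V"
      using assms[of u] by (auto simp: mem_quotient_atlas_iff)
    then show "x \<in> \<Union>(fst ` (quotient_atlas S p :: (_, 'd) chart set))" by force
  qed
  then show ?thesis
    unfolding quot_mfd_def using quotient_map_quotient_topology[of "top_of_set S" p]
    by (auto simp: topspace_quotient_topology mem_quotient_atlas_iff)
qed

context
  fixes X :: "'a topology" and A :: "('a, 'd::finite) chart set" and S :: "(complex^'m) set" and p
  assumes Q: "quot_mfd X A S p"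
begin

lemma quot_mfd_topspace: "topspace X = p ` S"
  using Q unfolding quot_mfd_def quotient_map_def by simp

lemma quot_mfd_topology: "X = quotient_topology (top_of_set S) p"
  using Q quotient_map_imp_eq_quotient_topology unfolding quot_mfd_def by blast

lemma quot_mfd_openin: "openin X U \<longleftrightarrow> U \<subseteq> p ` S \<and> openin (top_of_set S) {u \<in> S. p u \<in> U}"
  using quot_mfd_topology openin_quotient_topology[of "top_of_set S" p U] by simp

lemma quot_mfd_qchart: "(V, \<phi>) \<in> A \<Longrightarrow> qchart S p V \<phi>"
  using Q unfolding quot_mfd_def by blast

lemma quot_mfd_chart:
  assumes "u \<in> S"
  obtains V \<phi> where "(V, \<phi>) \<in> A" "p u \<in> V" "qchart S p V \<phi>"
proof -
  have "p u \<in> \<Union>(fst ` A)" using assms Q quot_mfd_topspace unfolding quot_mfd_def by simp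
  then obtain V \<phi> where "(V, \<phi>) \<in> A" "p u \<in> V" by auto
  then show thesis using that quot_mfd_qchart by blast
qed

lemma quot_mfd_chart_open:
  assumes "(V, \<phi>) \<in> A" "open W"
  shows "openin X {x \<in> V. \<phi> x \<in> W}"
  unfolding quot_mfd_openin
proof
  note q = quot_mfd_qchart[OF assms(1)]
  show "{x \<in> V. \<phi> x \<in> W} \<subseteq> p ` S" using qchartD(1)[OF q] by auto
  show "openin (top_of_set S) {u \<in> S. p u \<in> {x \<in> V. \<phi> x \<in> W}}"
    using qchart_open_preimage[OF q assms(2)] by simp
qed

text \<open>Openness of \<open>p\<close> comes from the sections alone, without any group. Near the
  image of \<open>u\<close>, each point \<open>y\<close> equals \<open>p (s (\<phi> y))\<close>, and
  \<open>s (\<phi> y)\<close> stays in the neighbourhood \<open>N\<close> of \<open>u\<close> by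
  continuity.\<close>

lemma quot_mfd_open_image:
  assumes "openin (top_of_set S) N"
  shows "openin X (p ` N)"
proof (subst openin_subopen, intro ballI)
  fix x assume "x \<in> p ` N"
  then obtain u where u: "u \<in> N" "x = p u" by auto
  then have "u \<in> S" using assms openin_subset by fastforce
  then obtain V \<phi> where V: "(V, \<phi>) \<in> A" "p u \<in> V" "qchart S p V \<phi>" using quot_mfd_chart by blast
  obtain W s where W: "open W" "\<phi> (p u) \<in> W" "holo_on s W" "s (\<phi> (p u)) = u"
      "\<And>w. w \<in> W \<Longrightarrow> s w \<in> S" "\<And>w. w \<in> W \<Longrightarrow> p (s w) \<in> V" "\<And>w. w \<in> W \<Longrightarrow> \<phi> (p (s w)) = w"
    using qchart_section[OF V(3) \<open>u \<in> S\<close> V(2)] by metis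
  let ?W = "{w \<in> W. s w \<in> N}"
  have "open ?W" by (rule open_section_preimage[OF W(1,3,5) assms])
  then have "openin X {x \<in> V. \<phi> x \<in> ?W}" using quot_mfd_chart_open[OF V(1)] by blast
  moreover have "{x \<in> V. \<phi> x \<in> ?W} \<subseteq> p ` N"
  proof
    fix y assume y: "y \<in> {x \<in> V. \<phi> x \<in> ?W}"
    then have "\<phi> y \<in> W" by simp
    then have "\<phi> (p (s (\<phi> y))) = \<phi> y" "p (s (\<phi> y)) \<in> V" using W by auto
    then have "p (s (\<phi> y)) = y" using y qchartD(4)[OF V(3)] by (auto dest: inj_onD)
    then show "y \<in> p ` N" using y image_eqI[of y p "s (\<phi> y)" N] by simp
  qed
  moreover have "x \<in> {x \<in> V. \<phi> x \<in> ?W}" using u V W by simp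
  ultimately show "\<exists>T. openin X T \<and> x \<in> T \<and> T \<subseteq> p ` N" by blast
qed

text \<open>For an open projection the Hausdorff property follows from closedness of the relation
  \<open>p x = p y\<close>. As \<open>S\<close> lies in a metric space, closedness may be tested on
  sequences; they are picked from balls of radius \<open>1 / (n + 1)\<close>.\<close>

lemma quot_mfd_Hausdorff:
  assumes "\<And>xs ys x y. xs \<longlonglongrightarrow> x \<Longrightarrow> ys \<longlonglongrightarrow> y \<Longrightarrow> (\<And>n. xs n \<in> S) \<Longrightarrow> (\<And>n. ys n \<in> S) \<Longrightarrow> x \<in> S \<Longrightarrow> y \<in> S
     \<Longrightarrow> (\<And>n::nat. p (xs n) = p (ys n)) \<Longrightarrow> p x = p y"
  shows "Hausdorff_space X"
  unfolding Hausdorff_space_def quot_mfd_topspace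
proof (intro allI impI, elim conjE imageE)
  fix a b x y assume a: "a \<noteq> b" "a = p x" "b = p y" "x \<in> S" "y \<in> S"
  let ?B = "\<lambda>x n. S \<inter> ball x (inverse (real (Suc n)))"
  have o: "openin X (p ` ?B x n)" for x n by (intro quot_mfd_open_image) auto
  have "\<exists>n. disjnt (p ` ?B x n) (p ` ?B y n)"
  proof (rule ccontr)
    assume "\<not> ?thesis"
    then have "\<forall>n. \<exists>u v. u \<in> ?B x n \<and> v \<in> ?B y n \<and> p u = p v"
      unfolding disjnt_iff by (metis (no_types, lifting) imageE)
    then obtain xs ys where xy: "\<And>n. xs n \<in> ?B x n" "\<And>n. ys n \<in> ?B y n" "\<And>n. p (xs n) = p (ys n)"
      by metis
    have lim: "zs \<longlonglongrightarrow> z" if "\<And>n. zs n \<in> ?B z n" for zs z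
    proof (rule metric_tendsto_imp_tendsto[OF LIMSEQ_inverse_real_of_nat])
      show "\<forall>\<^sub>F n in sequentially. dist (zs n) z \<le> dist (inverse (real (Suc n))) 0"
        using that by (intro always_eventually allI) (simp add: dist_commute less_imp_le)
    qed
    have "p x = p y" using lim[of xs x] lim[of ys y] xy a by (intro assms[of xs x ys y]) auto
    then show False using a by simp
  qed
  then obtain n where "disjnt (p ` ?B x n) (p ` ?B y n)" by blast
  then show "\<exists>U V. openin X U \<and> openin X V \<and> a \<in> U \<and> b \<in> V \<and> disjnt U V"
    using o a by (intro exI[of _ "p ` ?B x n"] exI[of _ "p ` ?B y n"]) auto
qed

lemma quot_mfd_second_countable: "second_countable X"
proof (rule second_countable_open_map_image)
  show "continuous_map (top_of_set S) X p"
    using Q unfolding quot_mfd_def by (simp add: quotient_imp_continuous_map)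
  show "open_map (top_of_set S) X p"
    unfolding open_map_def using quot_mfd_open_image by blast
  show "p ` topspace (top_of_set S) = topspace X" by (simp add: quot_mfd_topspace)
  show "second_countable (top_of_set S)"
    by (intro second_countable_subtopology second_countable_euclidean)
qed

end

text \<open>In coordinates \<open>F\<close> is locally
  \<open>\<psi> \<circ> p' \<circ> f \<circ> s\<close>, with a section \<open>s\<close> of the
  source and a lift \<open>f\<close>, hence a composite of holomorphic maps. The lift has to exist
  only locally, which leaves room for branches of the logarithm.\<close>

lemma qchart_holo:
  assumes V: "qchart S p V \<phi>" and W: "qchart S' p' W \<psi>"
    and lift: "\<And>u. u \<in> S \<Longrightarrow> \<exists>N f. open N \<and> u \<in> N \<and> holo_on f (N \<inter> S) \<and> (\<forall>x\<in>N \<inter> S. f x \<in> S' \<and>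
        p' (f x) = F (p x))"
  shows "holo_on (\<psi> \<circ> F \<circ> inv_into V \<phi>) (\<phi> ` {x \<in> V. F x \<in> W})"
proof (rule holo_onI)
  let ?D = "\<phi> ` {x \<in> V. F x \<in> W}"
  fix y assume "y \<in> ?D"
  then obtain u where u: "u \<in> S" "p u \<in> V" "y = \<phi> (p u)" using qchartD(1)[OF V] by blast
  obtain N f where N: "open N" "u \<in> N" "holo_on f (N \<inter> S)" "\<forall>x\<in>N \<inter> S. f x \<in> S' \<and> p' (f x) = F (p x)"
    using lift[OF u(1)] by blast
  obtain U s where U: "open U" "\<phi> (p u) \<in> U" "holo_on s U" "s (\<phi> (p u)) = u"
      "\<And>w. w \<in> U \<Longrightarrow> s w \<in> S" "\<And>w. w \<in> U \<Longrightarrow> p (s w) \<in> V" "\<And>w. w \<in> U \<Longrightarrow> \<phi> (p (s w)) = w"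
      "\<And>w. w \<in> U \<Longrightarrow> inv_into V \<phi> w = p (s w)"
    using qchart_section[OF V u(1,2)] by metis
  let ?U = "{w \<in> U. s w \<in> N \<inter> S}"
  have "openin (top_of_set S) (N \<inter> S)"
    using openin_open_Int[OF N(1), of S] by (simp add: Int_commute)
  with U(5) have "open ?U" by (intro open_section_preimage[OF U(1,3), of S]) auto
  moreover have "y \<in> ?U" using u N U by simp
  moreover have "holo_on (\<psi> \<circ> F \<circ> inv_into V \<phi>) (?U \<inter> ?D)"
  proof (rule holo_on_cong)
    have "holo_on (f \<circ> s) (?U \<inter> ?D)"
      by (rule holo_on_compose[OF holo_on_subset[OF U(3)] N(3)]) auto
    then show "holo_on ((\<psi> \<circ> p') \<circ> (f \<circ> s)) (?U \<inter> ?D)"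
    proof (rule holo_on_compose[OF _ qchartD(3)[OF W]], intro image_subsetI)
      fix w assume w: "w \<in> ?U \<inter> ?D"
      then obtain x where x: "x \<in> V" "F x \<in> W" "w = \<phi> x" by auto
      have "inv_into V \<phi> w = x" using x qchartD(4)[OF V] by (simp add: inv_into_f_f)
      then have "p (s w) = x" using w U(8) by simp
      then show "(f \<circ> s) w \<in> {v \<in> S'. p' v \<in> W}" using w x N(4) by simp
    qed
    fix w assume "w \<in> ?U \<inter> ?D"
    then show "(\<psi> \<circ> F \<circ> inv_into V \<phi>) w = ((\<psi> \<circ> p') \<circ> (f \<circ> s)) w"
      using U(8)[of w] N(4) by simp
  qed
  ultimately show "\<exists>N. open N \<and> y \<in> N \<and> holo_on (\<psi> \<circ> F \<circ> inv_into V \<phi>) (N \<inter> ?D)" by blast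
qed

lemma complex_manifold_quot_mfd:
  assumes Q: "quot_mfd X A S p" and "Hausdorff_space X"
  shows "complex_manifold X A"
  unfolding complex_manifold_def
proof (intro conjI ballI)
  show "second_countable X" using quot_mfd_second_countable[OF Q] .
  show "\<Union>(fst ` A) = topspace X" using Q unfolding quot_mfd_def by blast
next
  fix c assume "c \<in> A"
  then have "c \<in> quotient_atlas S p" using Q mem_quotient_atlas_iff unfolding quot_mfd_def
    by (metis (no_types, lifting) case_prodE)
  then show "chart_on X c" unfolding quot_mfd_topology[OF Q] quotient_atlas_def by auto
next
  fix c assume "c \<in> A"
  then obtain V \<phi> where c: "c = (V, \<phi>)" "qchart S p V \<phi>"
    using quot_mfd_qchart[OF Q] by (metis surj_pair)
  have "holo_on (\<psi> \<circ> inv_into V \<phi>) (\<phi> ` (V \<inter> W))" if "(W, \<psi>) \<in> A" for W \<psi>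
  proof -
    \<comment> \<open>A change of charts is the coordinate form of the identity, which is lifted by
      the identity.\<close>
    have "holo_on (\<psi> \<circ> id \<circ> inv_into V \<phi>) (\<phi> ` {x \<in> V. id x \<in> W})"
    proof (rule qchart_holo[OF c(2) quot_mfd_qchart[OF Q that]])
      fix u show "\<exists>N f. open N \<and> u \<in> N \<and> holo_on f (N \<inter> S) \<and> (\<forall>x\<in>N \<inter> S. f x \<in> S \<and>
          p (f x) = id (p x))"
        by (intro exI[of _ UNIV] exI[of _ "\<lambda>x. x"]) (auto simp: holo_on_id)
    qed
    then show ?thesis by (simp add: Int_def)
  qed
  then show "case c of (V, \<phi>) \<Rightarrow> \<forall>(W, \<psi>)\<in>A. holo_on (\<psi> \<circ> inv_into V \<phi>) (\<phi> ` (V \<inter> W))"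
    using c by auto
qed (use assms in auto)

lemma holomorphic_map_quot_mfd:
  assumes Q: "quot_mfd X A S p" and Q': "quot_mfd Y B S' p'"
    and lift: "\<And>u. u \<in> S \<Longrightarrow> \<exists>N f. open N \<and> u \<in> N \<and> holo_on f (N \<inter> S) \<and> (\<forall>x\<in>N \<inter> S. f x \<in> S' \<and>
        p' (f x) = F (p x))"
  shows "holomorphic_map X A Y B F"
  unfolding holomorphic_map_def
proof (intro conjI ballI)
  show "continuous_map X Y F"
  proof (rule continuous_compose_quotient_map)
    show "quotient_map (top_of_set S) X p" using Q unfolding quot_mfd_def by blast
    show "continuous_map (top_of_set S) Y (F \<circ> p)"
      unfolding continuous_map_def
    proof (intro conjI allI impI)
      show "F \<circ> p \<in> topspace (top_of_set S) \<rightarrow> topspace Y"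
        unfolding quot_mfd_topspace[OF Q'] using lift by force
      fix U assume U: "openin Y U"
      show "openin (top_of_set S) {x \<in> topspace (top_of_set S). (F \<circ> p) x \<in> U}"
      proof (subst openin_subopen, intro ballI)
        fix u assume u: "u \<in> {x \<in> topspace (top_of_set S). (F \<circ> p) x \<in> U}"
        then obtain N f where N: "open N" "u \<in> N" "holo_on f (N \<inter> S)" "\<forall>x\<in>N \<inter> S. f x \<in> S' \<and>
            p' (f x) = F (p x)"
          using lift[of u] by auto
        have "openin (top_of_set (N \<inter> S)) (N \<inter> S \<inter> f -` {v \<in> S'. p' v \<in> U})"
          by (rule continuous_openin_preimage[OF holo_on_imp_continuous_on[OF N(3)], of S'])
            (use N(4) U quot_mfd_openin[OF Q'] in auto)
        moreover have "openin (top_of_set S) (N \<inter> S)" using openin_open_Int[OF N(1), of S] by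
            (simp add: Int_commute)
        ultimately have "openin (top_of_set S) (N \<inter> S \<inter> f -` {v \<in> S'. p' v \<in> U})"
          using openin_trans by blast
        then show "\<exists>T. openin (top_of_set S) T \<and> u \<in> T \<and>
            T \<subseteq> {x \<in> topspace (top_of_set S). (F \<circ> p) x \<in> U}"
          using N u by (intro exI[of _ "N \<inter> S \<inter> f -` {v \<in> S'. p' v \<in> U}"]) auto
      qed
    qed
  qed
  fix c assume "c \<in> A"
  then obtain V \<phi> where c: "c = (V, \<phi>)" "qchart S p V \<phi>"
    using quot_mfd_qchart[OF Q] by (metis surj_pair)
  have "holo_on (\<psi> \<circ> F \<circ> inv_into V \<phi>) (\<phi> ` {x \<in> V. F x \<in> W})" if "(W, \<psi>) \<in> B" for W \<psi>
    using qchart_holo[OF c(2) quot_mfd_qchart[OF Q' that] lift] .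
  then show "case c of (V, \<phi>) \<Rightarrow> \<forall>(W, \<psi>)\<in>B. holo_on (\<psi> \<circ> F \<circ> inv_into V \<phi>) (\<phi> ` {x \<in> V. F x \<in> W})"
    using c by auto
qed

corollary holomorphic_map_lift:
  assumes "quot_mfd X A S p" "quot_mfd Y B S' p'" and f: "holo_on f S"
    and lift: "\<And>u. u \<in> S \<Longrightarrow> f u \<in> S' \<and> p' (f u) = F (p u)"
  shows "holomorphic_map X A Y B F"
proof (rule holomorphic_map_quot_mfd[OF assms(1,2)])
  fix u
  show "\<exists>N f. open N \<and> u \<in> N \<and> holo_on f (N \<inter> S) \<and>
      (\<forall>x\<in>N \<inter> S. f x \<in> S' \<and> p' (f x) = F (p x))"
    using f lift by (intro exI[of _ UNIV] exI[of _ f]) auto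
qed

section \<open>Open subsets and products of quotients\<close>

lemma qchart_restrict:
  assumes q: "qchart S p W \<phi>" and V: "openin (top_of_set S) {u \<in> S. p u \<in> V}"
  shows "qchart {u \<in> S. p u \<in> V} p (V \<inter> W) \<phi>"
  unfolding qchart_def
proof (intro conjI ballI impI)
  let ?S = "{u \<in> S. p u \<in> V}"
  show "V \<inter> W \<subseteq> p ` ?S" using qchartD(1)[OF q] by auto
  have *: "{u \<in> ?S. p u \<in> V \<inter> W} = ?S \<inter> {u \<in> S. p u \<in> W}" by auto
  show "openin (top_of_set ?S) {u \<in> ?S. p u \<in> V \<inter> W}"
    unfolding * using qchartD(2)[OF q]
    by (metis (no_types, lifting) V inf.cobounded1 openin_Int openin_subset_trans openin_imp_subset)
  show "holo_on (\<phi> \<circ> p) {u \<in> ?S. p u \<in> V \<inter> W}"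
    unfolding * using qchartD(3)[OF q] by (rule holo_on_subset) auto
  show "inj_on \<phi> (V \<inter> W)" using qchartD(4)[OF q] inj_on_subset by blast
  fix u assume u: "u \<in> ?S" "p u \<in> V \<inter> W"
  then have u': "u \<in> S" "p u \<in> W" by auto
  obtain U s where U: "open U" "\<phi> (p u) \<in> U" "holo_on s U" "s (\<phi> (p u)) = u"
      "\<And>w. w \<in> U \<Longrightarrow> s w \<in> S" "\<And>w. w \<in> U \<Longrightarrow> p (s w) \<in> W" "\<And>w. w \<in> U \<Longrightarrow> \<phi> (p (s w)) = w"
    using qchart_section[OF q u'] by metis
  let ?U = "{w \<in> U. s w \<in> ?S}"
  have "open ?U" using U V by (intro open_section_preimage[OF U(1,3), of S]) auto
  then show "\<exists>W' s. open W' \<and> \<phi> (p u) \<in> W' \<and> holo_on s W' \<and> s (\<phi> (p u)) = u \<and>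
        (\<forall>w\<in>W'. s w \<in> ?S \<and> p (s w) \<in> V \<inter> W \<and> \<phi> (p (s w)) = w)"
    using U u by (intro exI[of _ ?U] exI[of _ s]) (auto intro: holo_on_subset[OF U(3)])
qed

lemma quot_mfd_sub_atlas:
  assumes Q: "quot_mfd X A S p" and V: "openin X V"
  shows "quot_mfd (subtopology X V) (sub_atlas A V) {u \<in> S. p u \<in> V} p"
  unfolding quot_mfd_def
proof (intro conjI ballI)
  have VS: "V \<subseteq> p ` S" "openin (top_of_set S) {u \<in> S. p u \<in> V}"
    using V quot_mfd_openin[OF Q] by blast+
  have "quotient_map (subtopology (top_of_set S) {u \<in> S. p u \<in> V}) (subtopology X V) p"
    by (rule quotient_map_restriction) (use Q V in \<open>auto simp: quot_mfd_def\<close>)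
  then show "quotient_map (top_of_set {u \<in> S. p u \<in> V}) (subtopology X V) p"
    by (simp add: subtopology_subtopology Int_def conj_commute conj_left_commute)
  show "case c of (W, \<phi>) \<Rightarrow> qchart {u \<in> S. p u \<in> V} p W \<phi>" if "c \<in> sub_atlas A V" for c
    using that quot_mfd_qchart[OF Q] unfolding sub_atlas_def by (auto intro!: qchart_restrict VS)
  have "\<Union>(fst ` sub_atlas A V) = V \<inter> \<Union>(fst ` A)"
    unfolding sub_atlas_def by force
  then show "\<Union>(fst ` sub_atlas A V) = topspace (subtopology X V)"
    using Q by (simp add: quot_mfd_def Int_commute)
qed

text \<open>The product is placed in one coordinate space over the sum of the index types. In this
  way a product of two quotients is again a quotient of a subset of a complex space, and the lifting
  criterion applies to group multiplications and actions.\<close>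

definition vec_prod :: "(complex^'m) set \<Rightarrow> (complex^'k) set \<Rightarrow> (complex^('m::finite + 'k::finite))
    set" where
  "vec_prod S T = {u. vec_left u \<in> S \<and> vec_right u \<in> T}"

definition pair_map :: "(complex^'m \<Rightarrow> 'a) \<Rightarrow> (complex^'k \<Rightarrow> 'b) \<Rightarrow> complex^('m::finite + 'k::finite)
    \<Rightarrow> 'a \<times> 'b" where
  "pair_map p q u = (p (vec_left u), q (vec_right u))"

lemma vec_join_in_vec_prod [simp]: "vec_join u v \<in> vec_prod S T \<longleftrightarrow> u \<in> S \<and> v \<in> T"
  by (simp add: vec_prod_def)

lemma pair_map_join [simp]: "pair_map p q (vec_join u v) = (p u, q v)"
  by (simp add: pair_map_def)

lemma openin_vec_prod_preimage:
  assumes "openin (top_of_set S) M" "openin (top_of_set T) N"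
  shows "openin (top_of_set (vec_prod S T)) {u. vec_left u \<in> M \<and> vec_right u \<in> N}"
proof -
  obtain M' N' where M: "open M'" "M = S \<inter> M'" "open N'" "N = T \<inter> N'"
    using assms openin_open by metis
  have "open (vec_left -` M' \<inter> vec_right -` N' :: (complex^('a + 'b)) set)"
    using M continuous_on_vec_left continuous_on_vec_right
    by (intro open_Int open_vimage) auto
  moreover have "{u. vec_left u \<in> M \<and> vec_right u \<in> N} = vec_prod S T \<inter> (vec_left -` M' \<inter>
      vec_right -` N')"
    using M by (auto simp: vec_prod_def)
  ultimately show ?thesis by auto
qed

lemma qchart_prod:
  assumes V: "qchart S p V \<phi>" and W: "qchart T q W \<psi>"
  shows "qchart (vec_prod S T) (pair_map p q) (V \<times> W) (\<lambda>(x, y). vec_join (\<phi> x) (\<psi> y))"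
  unfolding qchart_def
proof (intro conjI ballI impI)
  let ?P = "vec_prod S T" and ?\<chi> = "\<lambda>(x, y). vec_join (\<phi> x) (\<psi> y)"
  have *: "{u \<in> ?P. pair_map p q u \<in> V \<times> W} =
     {u. vec_left u \<in> {u \<in> S. p u \<in> V} \<and> vec_right u \<in> {u \<in> T. q u \<in> W}}"
    by (auto simp: vec_prod_def pair_map_def)
  show "V \<times> W \<subseteq> pair_map p q ` ?P"
  proof
    fix z assume "z \<in> V \<times> W"
    then obtain u v where "u \<in> S" "v \<in> T" "z = (p u, q v)"
      using qchartD(1)[OF V] qchartD(1)[OF W] by blast
    then show "z \<in> pair_map p q ` ?P" by (intro image_eqI[of _ _ "vec_join u v"]) auto
  qed
  show "openin (top_of_set ?P) {u \<in> ?P. pair_map p q u \<in> V \<times> W}"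
    unfolding * using qchartD(2)[OF V] qchartD(2)[OF W] by (rule openin_vec_prod_preimage)
  have "holo_on (\<lambda>u. vec_join (((\<phi> \<circ> p) \<circ> vec_left) u) (((\<psi> \<circ> q) \<circ> vec_right) u))
      {u. vec_left u \<in> {u \<in> S. p u \<in> V} \<and> vec_right u \<in> {u \<in> T. q u \<in> W}}"
    by (intro holo_on_vec_join holo_on_compose[OF holo_on_vec_left qchartD(3)[OF V]]
          holo_on_compose[OF holo_on_vec_right qchartD(3)[OF W]]) auto
  then show "holo_on (?\<chi> \<circ> pair_map p q) {u \<in> ?P. pair_map p q u \<in> V \<times> W}"
    unfolding * by (rule holo_on_cong) (simp add: pair_map_def)
  show "inj_on ?\<chi> (V \<times> W)"
    using qchartD(4)[OF V] qchartD(4)[OF W] by (auto simp: inj_on_def)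
  fix u assume u: "u \<in> ?P" "pair_map p q u \<in> V \<times> W"
  then have u': "vec_left u \<in> S" "p (vec_left u) \<in> V" "vec_right u \<in> T" "q (vec_right u) \<in> W"
    by (auto simp: vec_prod_def pair_map_def)
  obtain M s where M: "open M" "\<phi> (p (vec_left u)) \<in> M" "holo_on s M"
      "s (\<phi> (p (vec_left u))) = vec_left u"
      "\<And>w. w \<in> M \<Longrightarrow> s w \<in> S" "\<And>w. w \<in> M \<Longrightarrow> p (s w) \<in> V" "\<And>w. w \<in> M \<Longrightarrow> \<phi> (p (s w)) = w"
    using qchart_section[OF V u'(1,2)] by metis
  obtain N t where N: "open N" "\<psi> (q (vec_right u)) \<in> N" "holo_on t N"
      "t (\<psi> (q (vec_right u))) = vec_right u"
      "\<And>w. w \<in> N \<Longrightarrow> t w \<in> T" "\<And>w. w \<in> N \<Longrightarrow> q (t w) \<in> W" "\<And>w. w \<in> N \<Longrightarrow> \<psi> (q (t w)) = w"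
    using qchart_section[OF W u'(3,4)] by metis
  let ?L = "{w. vec_left w \<in> M \<and> vec_right w \<in> N}"
  let ?s = "\<lambda>w. vec_join ((s \<circ> vec_left) w) ((t \<circ> vec_right) w)"
  have "open ?L" using openin_vec_prod_preimage[of UNIV M UNIV N] M(1) N(1)
    by (auto simp: vec_prod_def)
  moreover have "holo_on ?s ?L"
    by (intro holo_on_vec_join holo_on_compose[OF holo_on_vec_left M(3)]
          holo_on_compose[OF holo_on_vec_right N(3)]) auto
  ultimately show "\<exists>W' s. open W' \<and> ?\<chi> (pair_map p q u) \<in> W' \<and> holo_on s W' \<and>
      s (?\<chi> (pair_map p q u)) = u \<and>
        (\<forall>w\<in>W'. s w \<in> ?P \<and> pair_map p q (s w) \<in> V \<times> W \<and> ?\<chi> (pair_map p q (s w)) = w)"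
    using M N by (intro exI[of _ ?L] exI[of _ ?s]) (auto simp: pair_map_def)
qed

text \<open>A product of quotient maps need not be a quotient map, but a product of open surjections
  is open. The openness established in \<open>quot_mfd_open_image\<close> is what saves the
  argument.\<close>

lemma quot_mfd_prod_atlas:
  assumes Q: "quot_mfd X A S p" and Q': "quot_mfd Y B T q"
  shows "quot_mfd (prod_topology X Y) (prod_atlas A B) (vec_prod S T) (pair_map p q)"
  unfolding quot_mfd_def
proof (intro conjI ballI)
  let ?P = "vec_prod S T"
  note oX = quot_mfd_openin[OF Q] and oY = quot_mfd_openin[OF Q']
  note tops = quot_mfd_topspace[OF Q] quot_mfd_topspace[OF Q']
  have im: "pair_map p q ` ?P = p ` S \<times> q ` T"
  proof (intro equalityI subsetI)
    fix z assume "z \<in> p ` S \<times> q ` T"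
    then obtain u v where "u \<in> S" "v \<in> T" "z = (p u, q v)" by auto
    then show "z \<in> pair_map p q ` ?P" by (intro image_eqI[of _ _ "vec_join u v"]) auto
  qed (auto simp: vec_prod_def pair_map_def)
  show "quotient_map (top_of_set ?P) (prod_topology X Y) (pair_map p q)"
  proof (rule continuous_open_imp_quotient_map)
    show "continuous_map (top_of_set ?P) (prod_topology X Y) (pair_map p q)"
      unfolding continuous_map_pairwise
    proof (intro conjI)
      have "continuous_map (top_of_set ?P) (top_of_set S) vec_left"
        using continuous_on_vec_left by (auto simp: vec_prod_def)
      moreover have "continuous_map (top_of_set S) X p"
        using Q unfolding quot_mfd_def by (simp add: quotient_imp_continuous_map)
      ultimately have "continuous_map (top_of_set ?P) X (p \<circ> vec_left)" by (rule
          continuous_map_compose)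
      then show "continuous_map (top_of_set ?P) X (fst \<circ> pair_map p q)"
        by (rule continuous_map_eq) (simp add: pair_map_def)
      have "continuous_map (top_of_set ?P) (top_of_set T) vec_right"
        using continuous_on_vec_right by (auto simp: vec_prod_def)
      moreover have "continuous_map (top_of_set T) Y q"
        using Q' unfolding quot_mfd_def by (simp add: quotient_imp_continuous_map)
      ultimately have "continuous_map (top_of_set ?P) Y (q \<circ> vec_right)" by (rule
          continuous_map_compose)
      then show "continuous_map (top_of_set ?P) Y (snd \<circ> pair_map p q)"
        by (rule continuous_map_eq) (simp add: pair_map_def)
    qed
    show "open_map (top_of_set ?P) (prod_topology X Y) (pair_map p q)"
      unfolding open_map_def
    proof (intro allI impI)
      fix U assume "openin (top_of_set ?P) U"
      then obtain U' where U': "open U'" "U = ?P \<inter> U'" using openin_open by metis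
      show "openin (prod_topology X Y) (pair_map p q ` U)"
        unfolding openin_prod_topology_alt
      proof (intro allI impI)
        fix x y assume "(x, y) \<in> pair_map p q ` U"
        then obtain u where u: "u \<in> U" "x = p (vec_left u)"
            "y = q (vec_right u)" by (auto simp: pair_map_def)
        have "open ((\<lambda>(x, y). vec_join x y) -` U')"
          using continuous_on_vec_join[of UNIV] U'(1) by (intro open_vimage) auto
        moreover have "(vec_left u, vec_right u) \<in> (\<lambda>(x, y). vec_join x y) -` U'" using u U' by simp
        ultimately obtain M N where M: "open M" "open N" "(vec_left u, vec_right u) \<in> M \<times> N"
            "M \<times> N \<subseteq> (\<lambda>(x, y). vec_join x y) -` U'"
          by (elim open_prod_elim)
        have "openin X (p ` (S \<inter> M))" "openin Y (q ` (T \<inter> N))"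
          using M by (auto intro!: quot_mfd_open_image[OF Q] quot_mfd_open_image[OF Q'])
        moreover have "x \<in> p ` (S \<inter> M)" "y \<in> q ` (T \<inter> N)"
          using u M U' by (auto simp: vec_prod_def)
        moreover have "p ` (S \<inter> M) \<times> q ` (T \<inter> N) \<subseteq> pair_map p q ` U"
        proof
          fix z assume "z \<in> p ` (S \<inter> M) \<times> q ` (T \<inter> N)"
          then obtain u v where "u \<in> S \<inter> M" "v \<in> T \<inter> N" "z = (p u, q v)" by auto
          then show "z \<in> pair_map p q ` U"
            using M(4) U' by (intro image_eqI[of _ _ "vec_join u v"]) auto
        qed
        ultimately show "\<exists>M N. openin X M \<and> openin Y N \<and> x \<in> M \<and> y \<in> N \<and> M \<times> N \<subseteq> pair_map p q ` U"
          by blast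
      qed
    qed
    show "pair_map p q ` topspace (top_of_set ?P) = topspace (prod_topology X Y)"
      using im by (simp add: tops)
  qed
  show "case c of (V, \<phi>) \<Rightarrow> qchart ?P (pair_map p q) V \<phi>" if "c \<in> prod_atlas A B" for c
    using that quot_mfd_qchart[OF Q] quot_mfd_qchart[OF Q'] unfolding prod_atlas_def
    by (auto intro!: qchart_prod)
  have "\<Union>(fst ` prod_atlas A B) = \<Union>(fst ` A) \<times> \<Union>(fst ` B)"
    unfolding prod_atlas_def by force
  then show "\<Union>(fst ` prod_atlas A B) = topspace (prod_topology X Y)"
    using Q Q' by (simp add: quot_mfd_def)
qed

text \<open>Each \<open>F w\<close> parametrizes a slice to the fibres of \<open>p\<close> by the same open set \<open>D\<close>; the slices for
  different \<open>w\<close> induce the same chart of the quotient.\<close>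
lemma qchart_slice:
  fixes F :: "'w \<Rightarrow> complex^'d \<Rightarrow> complex^'m" and p :: "complex^'m \<Rightarrow> 'a"
  assumes D: "open D"
    and FS: "\<And>w d. w \<in> \<Gamma> \<Longrightarrow> d \<in> D \<Longrightarrow> F w d \<in> S"
    and Fh: "\<And>w. w \<in> \<Gamma> \<Longrightarrow> holo_on (F w) D"
    and inj: "\<And>w d w' d'. w \<in> \<Gamma> \<Longrightarrow> w' \<in> \<Gamma> \<Longrightarrow> d \<in> D \<Longrightarrow> d' \<in> D \<Longrightarrow> p (F w d) = p (F w' d') \<longleftrightarrow> d = d'"
    and sat: "\<And>u w d. u \<in> S \<Longrightarrow> w \<in> \<Gamma> \<Longrightarrow> d \<in> D \<Longrightarrow> p u = p (F w d) \<Longrightarrow> \<exists>w'\<in>\<Gamma>. u = F w' d"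
    and loc: "\<And>w d. w \<in> \<Gamma> \<Longrightarrow> d \<in> D \<Longrightarrow> \<exists>N \<delta>. open N \<and> F w d \<in> N \<and> (\<forall>y\<in>N. holo_at \<delta> y) \<and> \<delta> (F w d) \<in> D \<and>
       (\<forall>u\<in>N \<inter> S. \<delta> u \<in> D \<longrightarrow> p u = p (F w (\<delta> u)))"
  shows "\<exists>\<phi>. qchart S p {p (F w d) | w d. w \<in> \<Gamma> \<and> d \<in> D} (\<phi> :: 'a \<Rightarrow> complex^'d)"
proof -
  define V where "V = {p (F w d) | w d. w \<in> \<Gamma> \<and> d \<in> D}"
  \<comment> \<open>By \<open>inj\<close> the parameter \<open>d\<close> depends on the point of the
    quotient only, not on the slice \<open>w\<close> through which the point is reached.\<close>
  define \<phi> where "\<phi> x = (SOME d. d \<in> D \<and> (\<exists>w\<in>\<Gamma>. x = p (F w d)))" for x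
  have phi: "\<phi> (p (F w d)) = d" if "w \<in> \<Gamma>" "d \<in> D" for w d
    unfolding \<phi>_def by (rule some_equality) (use that inj in auto)
  have loc': "\<exists>N \<delta>. open N \<and> u \<in> N \<and> (\<forall>y\<in>N. holo_at \<delta> y) \<and> (\<forall>x\<in>N \<inter> S. p x \<in> V \<and> \<phi> (p x) = \<delta> x)"
    if u: "u \<in> S" "p u \<in> V" for u
  proof -
    obtain w d where w: "w \<in> \<Gamma>" "d \<in> D" "u = F w d" using u sat unfolding V_def by blast
    then obtain N \<delta> where N: "open N" "u \<in> N" "\<And>y. y \<in> N \<Longrightarrow> holo_at \<delta> y" "\<delta> u \<in> D"
       "\<And>x. x \<in> N \<inter> S \<Longrightarrow> \<delta> x \<in> D \<Longrightarrow> p x = p (F w (\<delta> x))"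
      using loc[OF w(1,2)] by metis
    \<comment> \<open>The neighbourhood is shrunk so that \<open>\<delta>\<close> takes its values
      in \<open>D\<close>; the hypothesis \<open>loc\<close> grants this at the base point
      only.\<close>
    show ?thesis
    proof (intro exI conjI ballI)
      show "open (N \<inter> \<delta> -` D)"
        using continuous_on_open_vimage[OF N(1)] holo_at_imp_continuous_on[of N \<delta>] N(3) D
        by (metis Int_commute)
      fix x assume x: "x \<in> N \<inter> \<delta> -` D \<inter> S"
      then have px: "p x = p (F w (\<delta> x))" "\<delta> x \<in> D" using N(5) by auto
      then show "p x \<in> V" using w unfolding V_def by blast
      show "\<phi> (p x) = \<delta> x" using px phi w by simp
    qed (use N in auto)
  qed
  have "qchart S p V \<phi>"
    unfolding qchart_def
  proof (intro conjI ballI impI)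
    show "V \<subseteq> p ` S" using FS unfolding V_def by blast
    show "openin (top_of_set S) {u \<in> S. p u \<in> V}"
    proof (subst openin_subopen, intro ballI)
      fix u assume "u \<in> {u \<in> S. p u \<in> V}"
      then obtain N where "open N" "u \<in> N" "\<forall>x\<in>N \<inter> S. p x \<in> V" "u \<in> S" using loc'[of u] by blast
      then show "\<exists>T. openin (top_of_set S) T \<and> u \<in> T \<and> T \<subseteq> {u \<in> S. p u \<in> V}"
        by (intro exI[of _ "S \<inter> N"]) auto
    qed
    show "holo_on (\<phi> \<circ> p) {u \<in> S. p u \<in> V}"
      unfolding holo_on_iff
    proof
      fix u assume "u \<in> {u \<in> S. p u \<in> V}"
      then obtain N \<delta> where "open N" "u \<in> N" "\<And>y. y \<in> N \<Longrightarrow> holo_at \<delta> y" "\<And>x. x \<in> N \<inter> S \<Longrightarrow>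
          \<phi> (p x) = \<delta> x"
        using loc'[of u] by (metis (no_types, lifting) mem_Collect_eq)
      then show "holo_near (\<phi> \<circ> p) {u \<in> S. p u \<in> V} u"
        by (intro holo_nearI[of N u _ \<delta>]) auto
    qed
    show "inj_on \<phi> V"
    proof (rule inj_onI)
      fix x y assume "x \<in> V" "y \<in> V" "\<phi> x = \<phi> y"
      then obtain w d w' d' where w: "w \<in> \<Gamma>" "d \<in> D" "x = p (F w d)" "w' \<in> \<Gamma>" "d' \<in> D"
          "y = p (F w' d')"
        unfolding V_def by blast
      then have "d = d'" using phi \<open>\<phi> x = \<phi> y\<close> by metis
      then show "x = y" using inj[of w w' d d'] w by simp
    qed
    fix u assume u: "u \<in> S" "p u \<in> V"
    then obtain w d where w: "w \<in> \<Gamma>" "d \<in> D" "u = F w d" using sat unfolding V_def by blast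
    show "\<exists>W s. open W \<and> \<phi> (p u) \<in> W \<and> holo_on s W \<and> s (\<phi> (p u)) = u \<and>
        (\<forall>w\<in>W. s w \<in> S \<and> p (s w) \<in> V \<and> \<phi> (p (s w)) = w)"
      using w D FS Fh phi unfolding V_def by (intro exI[of _ D] exI[of _ "F w"]) auto
  qed
  then show ?thesis unfolding V_def by blast
qed

section \<open>The combinatorics of a complete simplicial fan\<close>

lemma mem_convex_cone_hull_image:
  assumes "finite I"
  shows "x \<in> convex_cone hull (f ` I) \<longleftrightarrow> (\<exists>c. (\<forall>i\<in>I. 0 \<le> c i) \<and> x = (\<Sum>i\<in>I. c i *\<^sub>R f i))"
proof -
  let ?C = "{x. \<exists>c. (\<forall>i\<in>I. 0 \<le> c i) \<and> x = (\<Sum>i\<in>I. c i *\<^sub>R f i)}"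
  have "convex_cone ?C"
    unfolding convex_cone_iff
  proof (intro conjI ballI allI impI)
    show "0 \<in> ?C" by (auto intro!: exI[of _ "\<lambda>_. 0"])
    fix x y assume "x \<in> ?C" "y \<in> ?C"
    then obtain c d where "\<forall>i\<in>I. 0 \<le> c i" "x = (\<Sum>i\<in>I. c i *\<^sub>R f i)"
      "\<forall>i\<in>I. 0 \<le> d i" "y = (\<Sum>i\<in>I. d i *\<^sub>R f i)" by blast
    then show "x + y \<in> ?C"
      by (auto intro!: exI[of _ "\<lambda>i. c i + d i"] simp: scaleR_add_left sum.distrib)
  next
    fix x and r :: real assume "x \<in> ?C" "0 \<le> r"
    then obtain c where "\<forall>i\<in>I. 0 \<le> c i" "x = (\<Sum>i\<in>I. c i *\<^sub>R f i)" by blast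
    then show "r *\<^sub>R x \<in> ?C" using \<open>0 \<le> r\<close>
      by (auto intro!: exI[of _ "\<lambda>i. r * c i"] simp: scaleR_sum_right)
  qed
  moreover have "f ` I \<subseteq> ?C"
  proof
    fix x assume "x \<in> f ` I"
    then obtain i where "i \<in> I" "x = f i" by blast
    then show "x \<in> ?C" using assms
      by (auto intro!: exI[of _ "\<lambda>j. if j = i then 1 else 0"] simp: if_distrib[of "\<lambda>c. c *\<^sub>R _"]
          sum.delta cong: if_cong)
  qed
  ultimately have "convex_cone hull (f ` I) \<subseteq> ?C" by (rule hull_minimal[rotated])
  moreover have "?C \<subseteq> convex_cone hull (f ` I)"
  proof
    fix x assume "x \<in> ?C"
    then obtain c where c: "\<forall>i\<in>I. 0 \<le> c i" "x = (\<Sum>i\<in>I. c i *\<^sub>R f i)" by blast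
    have "(\<Sum>i\<in>J. c i *\<^sub>R f i) \<in> convex_cone hull (f ` I)" if "finite J" "J \<subseteq> I" for J
      using that
    proof (induction J rule: finite_induct)
      case empty show ?case by (simp add: convex_cone_hull_contains_0)
    next
      case (insert j J)
      then have "c j *\<^sub>R f j \<in> convex_cone hull (f ` I)"
          "(\<Sum>i\<in>J. c i *\<^sub>R f i) \<in> convex_cone hull (f ` I)"
        using c(1) by (simp_all add: convex_cone_hull_mul hull_inc)
      then show ?case using insert(1,2) by (simp add: convex_cone_hull_add)
    qed
    then show "x \<in> convex_cone hull (f ` I)" using c(2) assms by simp
  qed
  ultimately show ?thesis by blast
qed

text \<open>Independence of an indexed family, as simplices are sets of indices. Injectivity of the
  indexing is then a consequence and not an extra condition.\<close>

definition indep_family :: "('i \<Rightarrow> 'a::real_vector) \<Rightarrow> 'i set \<Rightarrow> bool" where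
  "indep_family f I \<longleftrightarrow> (\<forall>c. (\<Sum>i\<in>I. c i *\<^sub>R f i) = 0 \<longrightarrow> (\<forall>i\<in>I. c i = 0))"

lemma indep_familyD: "indep_family f I \<Longrightarrow> (\<Sum>i\<in>I. c i *\<^sub>R f i) = 0 \<Longrightarrow> i \<in> I \<Longrightarrow> c i = 0"
  unfolding indep_family_def by blast

lemma indep_familyD2:
  assumes "indep_family f I" "(\<Sum>i\<in>I. c i *\<^sub>R f i) = (\<Sum>i\<in>I. d i *\<^sub>R f i)" "i \<in> I"
  shows "c i = d i"
proof -
  have "(\<Sum>i\<in>I. (c i - d i) *\<^sub>R f i) = 0"
    using assms(2) by (simp add: scaleR_diff_left sum_subtractf)
  from indep_familyD[OF assms(1) this assms(3)] show ?thesis by simp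
qed

lemma indep_family_subset:
  assumes "indep_family f I" "J \<subseteq> I" "finite I"
  shows "indep_family f J"
  unfolding indep_family_def
proof (intro allI impI ballI)
  fix c i assume c: "(\<Sum>i\<in>J. c i *\<^sub>R f i) = 0" "i \<in> J"
  have "(\<Sum>i\<in>I. (if i \<in> J then c i else 0) *\<^sub>R f i) = (\<Sum>i\<in>J. c i *\<^sub>R f i)"
    using assms by (intro sum.mono_neutral_cong_right) auto
  then have "(\<Sum>i\<in>I. (if i \<in> J then c i else 0) *\<^sub>R f i) = 0" using c by simp
  from indep_familyD[OF assms(1) this, of i] show "c i = 0" using c assms by auto
qed

lemma independent_imp_indep_family: "independent S \<Longrightarrow> finite S \<Longrightarrow> indep_family (\<lambda>s. s) S"
  unfolding indep_family_def using independentD[of S S] by blast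

lemma indep_family_imp_independent:
  assumes "indep_family f I" "finite I"
  shows "inj_on f I" "independent (f ` I)"
proof -
  show inj: "inj_on f I"
  proof (rule inj_onI, rule ccontr)
    fix i j assume ij: "i \<in> I" "j \<in> I" "f i = f j" "i \<noteq> j"
    have "(\<Sum>k\<in>I. (if k = i then 1 else if k = j then -1 else 0) *\<^sub>R f k) =
        (\<Sum>k\<in>{i, j}. (if k = i then 1 else if k = j then -1 else 0) *\<^sub>R f k)"
      by (rule sum.mono_neutral_right) (use ij assms(2) in auto)
    also have "\<dots> = 0" using ij by simp
    finally show False using indep_familyD[OF assms(1) _ ij(1)] by fastforce
  qed
  show "independent (f ` I)"
  proof (rule independent_if_scalars_zero)
    fix c x assume "(\<Sum>x\<in>f ` I. c x *\<^sub>R x) = 0" "x \<in> f ` I"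
    then show "c x = 0" using indep_familyD[OF assms(1), of "c \<circ> f"] by (auto simp:
        sum.reindex[OF inj])
  qed (use assms(2) in simp)
qed

text \<open>Coordinates with respect to an independent family are unique. If an inner point of a
  segment has coordinate 0 outside \<open>J\<close>, then a positive combination of two nonnegative
  coordinates is 0, so both ends have coordinate 0 there as well.\<close>

lemma indep_family_cone_face:
  fixes f :: "'i \<Rightarrow> real^'n"
  assumes f: "indep_family f I" "finite I" and J: "J \<subseteq> I"
  shows "cone_face (convex_cone hull (f ` J)) (convex_cone hull (f ` I))"
  unfolding cone_face_def face_of_def
proof (intro conjI ballI impI)
  have fJ: "finite J" using J f finite_subset by blast
  show "convex_cone hull (f ` J) \<subseteq> convex_cone hull (f ` I)" using J by (intro hull_mono) auto
  show "convex (convex_cone hull (f ` J))" by (rule convex_convex_cone_hull)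
  show "convex_cone hull (f ` J) \<noteq> {}" by (rule convex_cone_hull_nonempty)
  fix x y z assume xyz: "x \<in> convex_cone hull (f ` I)" "y \<in> convex_cone hull (f ` I)"
    "z \<in> convex_cone hull (f ` J)" "z \<in> open_segment x y"
  obtain \<alpha> where \<alpha>: "\<forall>i\<in>I. 0 \<le> \<alpha> i" "x = (\<Sum>i\<in>I. \<alpha> i *\<^sub>R f i)"
    using xyz(1) mem_convex_cone_hull_image[OF f(2)] by blast
  obtain \<beta> where \<beta>: "\<forall>i\<in>I. 0 \<le> \<beta> i" "y = (\<Sum>i\<in>I. \<beta> i *\<^sub>R f i)"
    using xyz(2) mem_convex_cone_hull_image[OF f(2)] by blast
  obtain \<gamma> where \<gamma>: "\<forall>i\<in>J. 0 \<le> \<gamma> i" "z = (\<Sum>i\<in>J. \<gamma> i *\<^sub>R f i)"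
    using xyz(3) mem_convex_cone_hull_image[OF fJ] by blast
  obtain u where u: "0 < u" "u < 1" "z = (1 - u) *\<^sub>R x + u *\<^sub>R y"
    using xyz(4) by (auto simp: in_segment)
  have "z = (\<Sum>i\<in>I. (if i \<in> J then \<gamma> i else 0) *\<^sub>R f i)"
    unfolding \<gamma>(2) using J f(2) by (intro sum.mono_neutral_cong_left) auto
  moreover have "z = (\<Sum>i\<in>I. ((1 - u) * \<alpha> i + u * \<beta> i) *\<^sub>R f i)"
    unfolding u(3) \<alpha>(2) \<beta>(2) by (simp add: scaleR_sum_right scaleR_add_left sum.distrib)
  ultimately have "(\<Sum>i\<in>I. (if i \<in> J then \<gamma> i else 0) *\<^sub>R f i) = (\<Sum>i\<in>I. ((1 - u) * \<alpha> i + u * \<beta> i)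
      *\<^sub>R f i)"
    by (rule trans[OF sym])
  note eq = indep_familyD2[OF f(1) this]
  have zero: "\<alpha> i = 0" "\<beta> i = 0" if "i \<in> I - J" for i
  proof -
    have "(1 - u) * \<alpha> i + u * \<beta> i = 0" "(1 - u) * \<alpha> i \<ge> 0" "u * \<beta> i \<ge> 0"
      using eq[of i] that u \<alpha>(1) \<beta>(1) by auto
    then have "(1 - u) * \<alpha> i = 0" "u * \<beta> i = 0" by linarith+
    then show "\<alpha> i = 0" "\<beta> i = 0" using u by auto
  qed
  have "x = (\<Sum>i\<in>J. \<alpha> i *\<^sub>R f i)" "y = (\<Sum>i\<in>J. \<beta> i *\<^sub>R f i)"
    unfolding \<alpha>(2) \<beta>(2)
    by (rule sum.mono_neutral_right[OF f(2) J], simp add: zero)+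
  then show "x \<in> convex_cone hull (f ` J)" "y \<in> convex_cone hull (f ` J)"
    unfolding mem_convex_cone_hull_image[OF fJ] using \<alpha>(1) \<beta>(1) J by blast+
qed

text \<open>Faces are defined through open segments, so the sum is rewritten as a convex combination
  of \<open>v\<close> and another point \<open>b\<close> of the cone. The weight \<open>r\<close> of
  \<open>v\<close> must lie strictly between 0 and 1 and must not exceed \<open>t\<close>, as
  \<open>b\<close> contains the remainder \<open>t - r\<close> as a coefficient. If
  \<open>v = b\<close>, there is no segment, but then the sum is \<open>v\<close> itself.\<close>

lemma face_of_cone_mem:
  assumes \<sigma>: "convex_cone \<sigma>" and face: "\<tau> face_of \<sigma>" and "v \<in> \<sigma>" "y \<in> \<sigma>" "t > 0"
    and \<tau>: "t *\<^sub>R v + y \<in> \<tau>"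
  shows "v \<in> \<tau>"
proof -
  define r where "r = min t 1 / 2"
  have r: "0 < r" "r < 1" "r \<le> t" using assms(5) by (auto simp: r_def)
  define b where "b = (1 / (1 - r)) *\<^sub>R ((t - r) *\<^sub>R v + y)"
  have "b \<in> \<sigma>" unfolding b_def using r assms
    by (intro convex_cone_add convex_cone_scaleR) auto
  have eq: "t *\<^sub>R v + y = r *\<^sub>R v + (1 - r) *\<^sub>R b"
  proof -
    have "(1 - r) *\<^sub>R b = (t - r) *\<^sub>R v + y" using r by (simp add: b_def)
    then show ?thesis by (simp add: algebra_simps)
  qed
  show ?thesis
  proof (cases "v = b")
    case True
    then have "t *\<^sub>R v + y = v" using eq by (simp add: algebra_simps)
    then show ?thesis using \<tau> by simp
  next
    case False
    have "t *\<^sub>R v + y \<in> open_segment v b"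
      unfolding in_segment using False r eq by (intro conjI exI[of _ "1 - r"]) auto
    then show ?thesis using face \<open>b \<in> \<sigma>\<close> assms unfolding face_of_def by blast
  qed
qed

section \<open>Rays, cones and simplices of a complete simplicial fan\<close>

context
  fixes \<Sigma> :: "(real^'n) set set" and a :: "'m::finite \<Rightarrow> int^'n"
  assumes complete: "complete_fan \<Sigma>" and simplicial: "simplicial_fan \<Sigma>" and rays: "ray_generators
      \<Sigma> a"
begin

private abbreviation "A \<equiv> \<lambda>i. int_vec (a i)"

private lemma fan: "fan \<Sigma>" using complete unfolding complete_fan_def by blast

private lemma A_eq_0: "A i = 0 \<longleftrightarrow> a i = 0"
  by (simp add: int_vec_def vec_eq_iff)

private lemma ray_cone:
  assumes "a i \<noteq> 0"
  shows "convex_cone hull {A i} \<in> \<Sigma>"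
  using rays assms unfolding ray_generators_def bij_betw_def by blast

private lemma ray_inj:
  assumes "a i \<noteq> 0" "a j \<noteq> 0" "convex_cone hull {A i} = convex_cone hull {A j}"
  shows "i = j"
  using rays assms unfolding ray_generators_def bij_betw_def inj_on_def by blast

private lemma mem_cone_single: "x \<in> convex_cone hull {v} \<longleftrightarrow> (\<exists>t\<ge>0. x = t *\<^sub>R v)" for x v :: "real^'n"
  using mem_convex_cone_hull_image[of "{v}" x "\<lambda>v. v"] by auto

private lemma cone_single_scale:
  assumes "t > 0" shows "convex_cone hull {t *\<^sub>R v} = convex_cone hull {v :: real^'n}"
proof (intro equalityI subsetI)
  fix x assume "x \<in> convex_cone hull {t *\<^sub>R v}"
  then obtain s where "s \<ge> 0" "x = s *\<^sub>R t *\<^sub>R v" unfolding mem_cone_single by blast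
  then show "x \<in> convex_cone hull {v}" unfolding mem_cone_single using assms
    by (intro exI[of _ "s * t"]) auto
next
  fix x assume "x \<in> convex_cone hull {v}"
  then obtain s where "s \<ge> 0" "x = s *\<^sub>R v" unfolding mem_cone_single by blast
  then show "x \<in> convex_cone hull {t *\<^sub>R v}" unfolding mem_cone_single using assms
    by (intro exI[of _ "s / t"]) auto
qed

text \<open>The ray of \<open>i\<close> is contained in the cone and both belong to the fan, so the
  ray is a face. Some \<open>A j\<close> occurs in \<open>A i\<close> with positive coefficient;
  being a summand of a point of this face, it lies on the ray. Since the rays are enumerated without
  repetition, \<open>j = i\<close>.\<close>

private lemma ray_mem:
  assumes J: "convex_cone hull (A ` J) \<in> \<Sigma>" "\<forall>j\<in>J. a j \<noteq> 0" and i: "a i \<noteq> 0"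
      "A i \<in> convex_cone hull (A ` J)"
  shows "i \<in> J"
proof -
  let ?\<sigma> = "convex_cone hull (A ` J)" and ?\<tau> = "convex_cone hull {A i}"
  have "?\<tau> \<subseteq> ?\<sigma>" using i by (intro hull_minimal) (auto simp: convex_cone_convex_cone_hull)
  then have "cone_face ?\<tau> ?\<sigma>"
    using fan J(1) ray_cone[OF i(1)] unfolding fan_def by (metis Int_absorb1)
  then have face: "?\<tau> face_of ?\<sigma>" unfolding cone_face_def by blast
  obtain d where d: "\<forall>j\<in>J. 0 \<le> d j" "A i = (\<Sum>j\<in>J. d j *\<^sub>R A j)"
    using i(2) mem_convex_cone_hull_image[of J "A i" A] by auto
  have "\<exists>j\<in>J. d j \<noteq> 0" using d(2) A_eq_0[of i] i(1) by (metis (no_types, lifting)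
      scaleR_zero_left sum.neutral)
  then obtain j where j: "j \<in> J" "d j > 0" using d(1) by force
  have "(\<Sum>k\<in>J - {j}. d k *\<^sub>R A k) \<in> ?\<sigma>"
    unfolding mem_convex_cone_hull_image[OF finite, of _ A J]
    using d(1) j(1) by (intro exI[of _ "\<lambda>k. if k = j then 0 else d k"]) (auto simp: sum.remove
        intro!: sum.cong)
  moreover have "d j *\<^sub>R A j + (\<Sum>k\<in>J - {j}. d k *\<^sub>R A k) \<in> ?\<tau>"
  proof -
    have "d j *\<^sub>R A j + (\<Sum>k\<in>J - {j}. d k *\<^sub>R A k) = A i"
      unfolding d(2) using sum.remove[OF finite j(1), of "\<lambda>j. d j *\<^sub>R A j"] by simp
    then show ?thesis using hull_inc[of "A i" "{A i}"] by simp
  qed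
  ultimately have "A j \<in> ?\<tau>"
    using j by (intro face_of_cone_mem[OF convex_cone_convex_cone_hull face, of "A j"]) (auto
        intro: hull_inc)
  then obtain t where t: "t \<ge> 0" "A j = t *\<^sub>R A i" unfolding mem_cone_single by blast
  then have "t > 0" using A_eq_0[of j] J(2) j(1) by (cases "t = 0") auto
  then have "convex_cone hull {A j} = ?\<tau>" using t(2) cone_single_scale[of t "A i"] by simp
  then have "j = i" using ray_inj J(2) j(1) i(1) by blast
  then show ?thesis using j by simp
qed

text \<open>The basis vectors provided by \<open>simplicial_fan\<close> need not be primitive or
  even integral. Each of them spans a one-dimensional face of its cone, which is one of the
  enumerated rays, so that it agrees with a primitive generator up to a positive factor
  \<open>\<kappa>\<close>.\<close>

private lemma simplicial_rays:
  assumes S: "finite S" "independent S" "convex_cone hull S \<in> \<Sigma>"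
  obtains \<iota> \<kappa> where "inj_on \<iota> S" "\<And>s. s \<in> S \<Longrightarrow> \<kappa> s > 0" "\<And>s. s \<in> S \<Longrightarrow> A (\<iota> s) = \<kappa> s *\<^sub>R s"
    "\<And>s. s \<in> S \<Longrightarrow> a (\<iota> s) \<noteq> 0" "convex_cone hull S = convex_cone hull (A ` \<iota> ` S)"
        "indep_family A (\<iota> ` S)"
proof -
  have ind: "indep_family (\<lambda>s. s) S" using independent_imp_indep_family S by blast
  have "\<exists>i t. a i \<noteq> 0 \<and> t > 0 \<and> A i = t *\<^sub>R s" if s: "s \<in> S" for s
  proof -
    have "cone_face (convex_cone hull ((\<lambda>s. s) ` {s})) (convex_cone hull ((\<lambda>s. s) ` S))"
      by (rule indep_family_cone_face[OF ind S(1)]) (use s in auto)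
    then have "convex_cone hull {s} \<in> \<Sigma>" using fan S(3) unfolding fan_def by (metis image_ident)
    moreover have "dim (convex_cone hull {s}) = 1"
    proof -
      have "s \<noteq> 0" using s S(2) dependent_zero by blast
      have "convex_cone hull {s} \<subseteq> span {s}"
  by (auto simp: mem_cone_single span_mul span_base)
      then have "span (convex_cone hull {s}) = span {s}"
        by (metis hull_subset span_mono span_span subset_antisym)
      then show ?thesis using \<open>s \<noteq> 0\<close> by (metis dim_singleton dim_span)
    qed
    ultimately obtain i where i: "a i \<noteq> 0" "convex_cone hull {A i} = convex_cone hull {s}"
      using rays unfolding ray_generators_def bij_betw_def by (smt (verit) imageE mem_Collect_eq)
    then have "A i \<in> convex_cone hull {s}" by (metis hull_inc singletonI)
    then obtain t where t: "t \<ge> 0" "A i = t *\<^sub>R s" unfolding mem_cone_single by blast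
    then have "t > 0" using A_eq_0[of i] i(1) by (cases "t = 0") auto
    then show ?thesis using i t by blast
  qed
  then obtain \<iota> \<kappa> where ik: "\<And>s. s \<in> S \<Longrightarrow> a (\<iota> s) \<noteq> 0" "\<And>s. s \<in> S \<Longrightarrow> \<kappa> s > 0"
    "\<And>s. s \<in> S \<Longrightarrow> A (\<iota> s) = \<kappa> s *\<^sub>R s" by metis
  have inj: "inj_on \<iota> S"
  proof (rule inj_onI)
    fix s t assume st: "s \<in> S" "t \<in> S" "\<iota> s = \<iota> t"
    then have eq: "\<kappa> s *\<^sub>R s = \<kappa> t *\<^sub>R t" using ik by metis
    have "(\<Sum>r\<in>S. (if r = s then \<kappa> s else 0) *\<^sub>R r) = (\<Sum>r\<in>S. (if r = t then \<kappa> t else 0) *\<^sub>R r)"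
      using st S(1) eq by (simp add: if_distrib[of "\<lambda>c. c *\<^sub>R _"] sum.delta cong: if_cong)
    from indep_familyD2[OF ind this st(1)] show "s = t" using ik(2)[OF st(1)] by (auto split:
        if_splits)
  qed
  have "A ` \<iota> ` S \<subseteq> convex_cone hull S"
  proof
    fix x assume "x \<in> A ` \<iota> ` S"
    then obtain s where s: "s \<in> S" "x = \<kappa> s *\<^sub>R s" using ik(3) by auto
    have "\<kappa> s *\<^sub>R s \<in> convex_cone hull S"
      using ik(2)[OF s(1)] s(1) by (intro convex_cone_hull_mul hull_inc) auto
    then show "x \<in> convex_cone hull S" using s by simp
  qed
  moreover have "S \<subseteq> convex_cone hull (A ` \<iota> ` S)"
  proof
    fix s assume s: "s \<in> S"
    then have "s = (1 / \<kappa> s) *\<^sub>R A (\<iota> s)" using ik(2,3)[OF s] by simp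
    moreover have "(1 / \<kappa> s) *\<^sub>R A (\<iota> s) \<in> convex_cone hull (A ` \<iota> ` S)"
      using s ik(2)[OF s] by (intro convex_cone_hull_mul hull_inc) auto
    ultimately show "s \<in> convex_cone hull (A ` \<iota> ` S)" by simp
  qed
  ultimately have cone: "convex_cone hull S = convex_cone hull (A ` \<iota> ` S)"
    by (intro equalityI hull_minimal convex_cone_convex_cone_hull)
  have "indep_family A (\<iota> ` S)"
    unfolding indep_family_def
  proof (intro allI impI ballI)
    fix c i assume c: "(\<Sum>i\<in>\<iota> ` S. c i *\<^sub>R A i) = 0" "i \<in> \<iota> ` S"
    then obtain s where s: "s \<in> S" "i = \<iota> s" by blast
    have "(\<Sum>s\<in>S. (c (\<iota> s) * \<kappa> s) *\<^sub>R s) = (\<Sum>i\<in>\<iota> ` S. c i *\<^sub>R A i)"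
      unfolding sum.reindex[OF inj] by (rule sum.cong) (use ik(3) in auto)
    then have "c (\<iota> s) * \<kappa> s = 0" using indep_familyD[OF ind _ s(1), of "\<lambda>s. c (\<iota> s) * \<kappa> s"] c by
        simp
    then show "c i = 0" using ik(2)[OF s(1)] s by simp
  qed
  then show thesis using that ik inj cone by blast
qed

private lemma cone_simplex:
  assumes "\<sigma> \<in> \<Sigma>"
  obtains I where "I \<in> fan_complex \<Sigma> a" "\<sigma> = convex_cone hull (A ` I)" "indep_family A I"
proof -
  obtain B S where B: "independent B" "S \<subseteq> B" "\<sigma> = convex_cone hull S"
    using simplicial assms unfolding simplicial_fan_def by blast
  then have S: "independent S" "finite S"
    using independent_mono independent_imp_finite finite_subset by blast+
  have "convex_cone hull S \<in> \<Sigma>" using assms B(3) by simp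
  then obtain \<iota> \<kappa> where ik: "\<And>s. s \<in> S \<Longrightarrow> a (\<iota> s) \<noteq> 0"
      "convex_cone hull S = convex_cone hull (A ` \<iota> ` S)" "indep_family A (\<iota> ` S)"
    using simplicial_rays[OF S(2,1)] by metis
  show thesis
    by (rule that[of "\<iota> ` S"]) (use ik assms B(3) in \<open>auto simp: fan_complex_def\<close>)
qed

text \<open>Membership in \<open>fan_complex\<close> only says that the generators span a cone of
  the fan. The same cone is also spanned by an independent simplex \<open>J\<close>, and
  \<open>ray_mem\<close> puts \<open>I\<close> inside \<open>J\<close>.\<close>

lemma fan_complex_indep:
  assumes "I \<in> fan_complex \<Sigma> a"
  shows "indep_family A I"
proof -
  have I: "\<forall>i\<in>I. a i \<noteq> 0" "convex_cone hull (A ` I) \<in> \<Sigma>" using assms unfolding fan_complex_def by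
      auto
  obtain J where J: "J \<in> fan_complex \<Sigma> a" "convex_cone hull (A ` I) = convex_cone hull (A ` J)"
      "indep_family A J"
    using cone_simplex[OF I(2)] by metis
  have "I \<subseteq> J"
  proof
    fix i assume "i \<in> I"
    then have "a i \<noteq> 0" "A i \<in> convex_cone hull (A ` J)"
      using I(1) hull_inc[of "A i" "A ` I"] J(2) by auto
    then show "i \<in> J" using J(1) unfolding fan_complex_def by (intro ray_mem[of J i]) auto
  qed
  then show ?thesis using indep_family_subset[OF J(3)] by simp
qed

lemma fan_complex_down:
  assumes "I \<in> fan_complex \<Sigma> a" "J \<subseteq> I"
  shows "J \<in> fan_complex \<Sigma> a"
proof -
  have I: "\<forall>i\<in>I. a i \<noteq> 0" "convex_cone hull (A ` I) \<in> \<Sigma>" using assms(1) unfolding fan_complex_def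
      by auto
  have "cone_face (convex_cone hull (A ` J)) (convex_cone hull (A ` I))"
    by (rule indep_family_cone_face[OF fan_complex_indep[OF assms(1)] finite assms(2)])
  then have "convex_cone hull (A ` J) \<in> \<Sigma>" using fan I(2) unfolding fan_def by (meson)
  then show ?thesis using I(1) assms(2) unfolding fan_complex_def by auto
qed

lemma fan_complex_cover:
  obtains c where "\<And>i. 0 \<le> c i" "{i. c i \<noteq> 0} \<in> fan_complex \<Sigma> a" "x = (\<Sum>i\<in>UNIV. c i *\<^sub>R A i)"
proof -
  obtain \<sigma> where "\<sigma> \<in> \<Sigma>" "x \<in> \<sigma>" using complete unfolding complete_fan_def by blast
  then obtain I where I: "I \<in> fan_complex \<Sigma> a"
      "x \<in> convex_cone hull (A ` I)" using cone_simplex by metis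
  then obtain c where c: "\<forall>i\<in>I. 0 \<le> c i" "x = (\<Sum>i\<in>I. c i *\<^sub>R A i)"
    using mem_convex_cone_hull_image[of I x A] by auto
  show thesis
  proof (rule that[of "\<lambda>i. if i \<in> I then c i else 0"])
    show "{i. (if i \<in> I then c i else 0) \<noteq> 0} \<in> fan_complex \<Sigma> a"
      by (rule fan_complex_down[OF I(1)]) (auto split: if_splits)
    show "x = (\<Sum>i\<in>UNIV. (if i \<in> I then c i else 0) *\<^sub>R A i)"
      unfolding c(2) by (rule sum.mono_neutral_cong_left) auto
  qed (use c in auto)
qed

text \<open>The common vector lies in the cones of both supports, hence in their intersection, which
  is a face of the first. This face contains all summands, that is, all generators
  \<open>A i\<close> with \<open>c i \<noteq> 0\<close>, and \<open>ray_mem\<close> places these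
  \<open>i\<close> in the other support. By symmetry the supports agree, and independence gives
  equal coefficients.\<close>

lemma fan_complex_uniq:
  assumes c: "\<And>i. 0 \<le> c i" "{i. c i \<noteq> 0} \<in> fan_complex \<Sigma> a"
    and d: "\<And>i. 0 \<le> d i" "{i. d i \<noteq> 0} \<in> fan_complex \<Sigma> a"
    and eq: "(\<Sum>i\<in>UNIV. c i *\<^sub>R A i) = (\<Sum>i\<in>UNIV. d i *\<^sub>R A i)"
  shows "c = d"
proof -
  have sub: "{i. c i \<noteq> 0} \<subseteq> {i. d i \<noteq> 0}"
    if c: "\<And>i. 0 \<le> c i" "{i. c i \<noteq> 0} \<in> fan_complex \<Sigma> a"
    and d: "\<And>i. 0 \<le> d i" "{i. d i \<noteq> 0} \<in> fan_complex \<Sigma> a"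
    and eq: "(\<Sum>i\<in>UNIV. c i *\<^sub>R A i) = (\<Sum>i\<in>UNIV. d i *\<^sub>R A i)" for c d :: "'m \<Rightarrow> real"
  proof
    let ?I = "{i. c i \<noteq> 0}" and ?J = "{i. d i \<noteq> 0}"
    let ?\<sigma> = "convex_cone hull (A ` ?I)" and ?\<tau> = "convex_cone hull (A ` ?J)"
    fix i assume i: "i \<in> ?I"
    have "?\<sigma> \<in> \<Sigma>" "?\<tau> \<in> \<Sigma>" using c d unfolding fan_complex_def by auto
    then have face: "?\<sigma> \<inter> ?\<tau> face_of ?\<sigma>" using fan unfolding fan_def cone_face_def by blast
    have mem: "(\<Sum>i\<in>UNIV. e i *\<^sub>R A i) \<in> convex_cone hull (A ` {i. e' i \<noteq> 0})"
      if "\<And>i. 0 \<le> e i" "\<And>i. e' i = 0 \<Longrightarrow> e i = 0" for e e' :: "'m \<Rightarrow> real"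
      unfolding mem_convex_cone_hull_image[OF finite]
      using that by (intro exI[of _ e] conjI sum.mono_neutral_right) auto
    let ?c' = "\<lambda>j. if j = i then 0 else c j"
    have split: "(\<Sum>i\<in>UNIV. c i *\<^sub>R A i) = c i *\<^sub>R A i + (\<Sum>j\<in>UNIV. ?c' j *\<^sub>R A j)"
      by (subst (1 2) sum.remove[of UNIV i]) (auto intro!: sum.cong)
    have "A i \<in> ?\<sigma> \<inter> ?\<tau>"
    proof (rule face_of_cone_mem[OF convex_cone_convex_cone_hull face])
      show "(\<Sum>j\<in>UNIV. ?c' j *\<^sub>R A j) \<in> ?\<sigma>" using c by (intro mem) auto
      show "c i *\<^sub>R A i + (\<Sum>j\<in>UNIV. ?c' j *\<^sub>R A j) \<in> ?\<sigma> \<inter> ?\<tau>"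
        using mem[of c c] mem[of d d] c(1) d(1) eq split by auto
    qed (use i c(1)[of i] in \<open>auto intro: hull_inc\<close>)
    then show "i \<in> ?J" using d(2) c(2) i by (intro ray_mem) (auto simp: fan_complex_def)
  qed
  have supp: "{i. c i \<noteq> 0} = {i. d i \<noteq> 0}" using sub[OF c d eq] sub[OF d c eq[symmetric]] by
      (rule equalityI)
  let ?I = "{i. c i \<noteq> 0}"
  have "(\<Sum>i\<in>?I. c i *\<^sub>R A i) = (\<Sum>i\<in>UNIV. c i *\<^sub>R A i)" by (rule sum.mono_neutral_left) auto
  moreover have "(\<Sum>i\<in>?I. d i *\<^sub>R A i) = (\<Sum>i\<in>UNIV. d i *\<^sub>R A i)" unfolding supp by (rule
      sum.mono_neutral_left) auto
  ultimately have "c i = d i" if "i \<in> ?I" for i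
    using indep_familyD2[OF fan_complex_indep[OF c(2)] _ that] eq by simp
  moreover have "c i = d i" if "i \<notin> ?I" for i using that supp by auto
  ultimately show ?thesis by blast
qed

text \<open>The generators of a simplex with n elements form a basis of the integral vectors, and
  \<open>b\<close> collects the coordinate functionals of this basis. The size n is what makes the
  simplex exhaust the basis \<open>B\<close> given by regularity.\<close>

lemma regular_fan_dual_basis:
  assumes reg: "regular_fan \<Sigma>" and I: "I \<in> fan_complex \<Sigma> a" "card I = CARD('n)"
  obtains b :: "'m \<Rightarrow> int^'n" where "\<And>y j. y $ j = (\<Sum>i\<in>I. (\<Sum>k\<in>UNIV. b i $ k * y $ k) * a i $ j)"
proof -
  have I': "\<forall>i\<in>I. a i \<noteq> 0" "convex_cone hull (A ` I) \<in> \<Sigma>" using I unfolding fan_complex_def by auto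
  obtain B S where B: "independent B" "int_span B = range int_vec" "S \<subseteq> B"
      "convex_cone hull (A ` I) = convex_cone hull S"
    using reg I'(2) unfolding regular_fan_def by meson
  have fB: "finite B" using B(1) independent_imp_finite by blast
  have S: "finite S" "independent S" "convex_cone hull S \<in> \<Sigma>"
    using B fB I' independent_mono finite_subset by metis+
  obtain \<iota> \<kappa> where ik: "inj_on \<iota> S" "\<And>s. s \<in> S \<Longrightarrow> \<kappa> s > 0" "\<And>s. s \<in> S \<Longrightarrow> A (\<iota> s) = \<kappa> s *\<^sub>R s"
    "\<And>s. s \<in> S \<Longrightarrow> a (\<iota> s) \<noteq> 0" "convex_cone hull S = convex_cone hull (A ` \<iota> ` S)"
        "indep_family A (\<iota> ` S)"
    using simplicial_rays[OF S] by metis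
  have IS: "I = \<iota> ` S"
  proof (intro equalityI subsetI)
    fix i assume i: "i \<in> I"
    have "A i \<in> convex_cone hull (A ` I)" using i by (intro hull_inc) auto
    then show "i \<in> \<iota> ` S" using ik(4,5) S(3) I'(1) i B(4) by (intro ray_mem) auto
  next
    fix i assume i: "i \<in> \<iota> ` S"
    have "A i \<in> convex_cone hull (A ` \<iota> ` S)" using i by (intro hull_inc) auto
    then show "i \<in> I" using ik(4,5) I' i B(4) by (intro ray_mem) auto
  qed
  have "card S = CARD('n)" using I(2) IS ik(1) by (simp add: card_image)
  moreover have "card B \<le> CARD('n)" using independent_bound[OF B(1)] by simp
  ultimately have SB: "S = B" using B(3) fB by (metis card_seteq)
  have ind: "indep_family (\<lambda>s. s) B" using B(1) fB independent_imp_indep_family by blast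
  \<comment> \<open>Expanding \<open>A (\<iota> s)\<close> in \<open>B\<close> shows that
    \<open>\<kappa> s\<close> is an integer, and \<open>s\<close> itself is integral. So
    \<open>\<kappa> s\<close> divides all coordinates of a primitive vector, and being positive it
    is 1.\<close>
  have k1: "\<kappa> s = 1" if s: "s \<in> B" for s
  proof -
    have "A (\<iota> s) \<in> int_span B" using B(2) by auto
    then obtain k where k: "A (\<iota> s) = (\<Sum>b\<in>B. of_int (k b) *\<^sub>R b)" unfolding int_span_def by blast
    have "(\<Sum>b\<in>B. (if b = s then \<kappa> s else 0) *\<^sub>R b) = (\<Sum>b\<in>B. of_int (k b) *\<^sub>R b)"
      using s fB ik(3)[of s] SB k by (simp add: if_distrib[of "\<lambda>c. c *\<^sub>R _"] sum.delta cong: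
          if_cong)
    from indep_familyD2[OF ind this s] have ks: "\<kappa> s = of_int (k s)" by simp
    have "s = (\<Sum>b\<in>B. of_int (if b = s then 1 else 0) *\<^sub>R b)"
      using s fB by (simp add: if_distrib[of "\<lambda>c. of_int c *\<^sub>R _"] sum.delta cong: if_cong)
    then have "s \<in> int_span B" unfolding int_span_def
      by (intro CollectI exI[of _ "\<lambda>b. if b = s then 1 else 0"] conjI TrueI)
    then obtain y where y: "s = int_vec y" using B(2) by blast
    have "real_of_int (a (\<iota> s) $ j) = real_of_int (k s * y $ j)" for j
    proof -
      have "A (\<iota> s) = of_int (k s) *\<^sub>R int_vec y" using ik(3)[of s] s SB ks y by simp
      then have "A (\<iota> s) $ j = (of_int (k s) *\<^sub>R int_vec y) $ j" by simp
      then show ?thesis unfolding int_vec_def by simp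
    qed
    then have "k s dvd a (\<iota> s) $ j" for j by (metis dvd_triv_left of_int_eq_iff)
    then have "k s dvd Gcd (range (($) (a (\<iota> s))))" by (auto intro: Gcd_greatest)
    then have "k s dvd 1" using rays ik(4)[of s] s SB unfolding ray_generators_def by metis
    moreover have "k s > 0" using ks ik(2)[of s] s SB by simp
    ultimately show ?thesis using ks by (simp add: zdvd1_eq)
  qed
  have "\<exists>k. int_vec (axis j 1) = (\<Sum>b\<in>B. of_int (k b) *\<^sub>R b)" for j :: 'n
  proof -
    have "int_vec (axis j 1 :: int^'n) \<in> int_span B" using B(2) by auto
    then show ?thesis unfolding int_span_def by blast
  qed
  then obtain k where k: "\<And>j::'n. int_vec (axis j 1) = (\<Sum>b\<in>B. of_int (k j b) *\<^sub>R b)" by metis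
  have inj: "inj_on \<iota> B" using ik(1) SB by simp
  have k': "(if l = j then 1 else 0) = (\<Sum>i\<in>I. k j (A i) * a i $ l)" for j l :: 'n
  proof -
    have "int_vec (axis j 1 :: int^'n) = (\<Sum>i\<in>I. of_int (k j (A i)) *\<^sub>R A i)"
      unfolding k IS SB sum.reindex[OF inj] by (rule sum.cong) (use ik(3) k1 SB in auto)
    then have "int_vec (axis j 1 :: int^'n) $ l = (\<Sum>i\<in>I. of_int (k j (A i)) *\<^sub>R A i) $ l" by simp
    then have "real_of_int (axis j 1 $ l) = real_of_int (\<Sum>i\<in>I. k j (A i) * a i $ l)"
      by (simp add: int_vec_def)
    then have "axis j 1 $ l = (\<Sum>i\<in>I. k j (A i) * a i $ l)" by (simp only: of_int_eq_iff)
    then show ?thesis by (simp add: axis_def eq_commute cong: if_cong)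
  qed
  show thesis
  \<comment> \<open>The entry of \<open>b i\<close> at \<open>j\<close> is the \<open>i\<close>-th
    coordinate of the \<open>j\<close>-th standard basis vector; linearity extends the expansion to
    all \<open>y\<close>.\<close>
  proof (rule that[of "\<lambda>i. \<chi> j. k j (A i)"])
    fix y :: "int^'n" and l
    have "y $ l = (\<Sum>j\<in>UNIV. y $ j * (if l = j then 1 else 0))"
      by (simp add: if_distrib[of "(*) _"] sum.delta' cong: if_cong)
    also have "\<dots> = (\<Sum>j\<in>UNIV. \<Sum>i\<in>I. y $ j * (k j (A i) * a i $ l))"
      unfolding k' by (simp add: sum_distrib_left)
    also have "\<dots> = (\<Sum>i\<in>I. (\<Sum>j\<in>UNIV. (\<chi> j. k j (A i)) $ j * y $ j) * a i $ l)"
      by (subst sum.swap) (simp add: sum_distrib_right sum_distrib_left algebra_simps)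
    finally show "y $ l = (\<Sum>i\<in>I. (\<Sum>h\<in>UNIV. (\<chi> j. k j (A i)) $ h * y $ h) * a i $ l)"
      by simp
  qed
qed

end

section \<open>Linear algebra and properness\<close>

definition expv :: "complex^'m \<Rightarrow> complex^'m" where "expv x = (\<chi> i. exp (x $ i))"
definition cnjv :: "complex^'m \<Rightarrow> complex^'m" where "cnjv x = (\<chi> i. cnj (x $ i))"

lemma expv_nth [simp]: "expv x $ i = exp (x $ i)" by (simp add: expv_def)
lemma cnjv_nth [simp]: "cnjv x $ i = cnj (x $ i)" by (simp add: cnjv_def)
lemma Re_vec_nth [simp]: "Re_vec x $ i = Re (x $ i)" by (simp add: Re_vec_def)

lemma expv_add: "expv (x + y) = expv x * expv y" by (simp add: vec_eq_iff exp_add)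
lemma expv_0 [simp]: "expv 0 = 1" by (simp add: vec_eq_iff)
lemma cnjv_cnjv [simp]: "cnjv (cnjv x) = x" by (simp add: vec_eq_iff)
lemma cnjv_add: "cnjv (x + y) = cnjv x + cnjv y" by (simp add: vec_eq_iff)
lemma cnjv_cmult: "cnjv (c *s y) = cnj c *s cnjv y" by (simp add: vec_eq_iff)
lemma norm_cnjv [simp]: "norm (cnjv x) = norm x" by (simp add: norm_vec_def)

lemma scaleR_vec_conv_mult: "r *\<^sub>R x = complex_of_real r *s x"
  unfolding vec_eq_iff vector_smult_component vector_scaleR_component by (simp add:
      scaleR_conv_of_real)

lemma linear_vec_imp_linear:
  fixes f :: "complex^'a \<Rightarrow> complex^'b"
  assumes "Vector_Spaces.linear (*s) (*s) f"
  shows "linear f"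
proof (rule linearI)
  show "f (x + y) = f x + f y" for x y using assms by (rule vec.linear_add)
  show "f (r *\<^sub>R x) = r *\<^sub>R f x" for r x
    unfolding scaleR_vec_conv_mult using assms by (rule vec.linear_scale)
qed

lemma linear_imp_holo_at: "Vector_Spaces.linear (*s) (*s) f \<Longrightarrow> holo_at f y"
  unfolding holo_at_def
  by (intro exI[of _ f] conjI bounded_linear_imp_has_derivative)
    (auto simp: linear_conv_bounded_linear[symmetric] linear_vec_imp_linear)

lemma polyhedral_product_iff:
  fixes K :: "'m::finite set set" and x :: "'a^'m"
  assumes "\<And>I J. I \<in> K \<Longrightarrow> J \<subseteq> I \<Longrightarrow> J \<in> K"
  shows "x \<in> polyhedral_product X W K \<longleftrightarrow> (\<forall>j. x $ j \<in> X) \<and> {j. x $ j \<notin> W} \<in> K"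
proof
  assume "x \<in> polyhedral_product X W K"
  then obtain I where "I \<in> K" "\<forall>j. x $ j \<in> X" "\<forall>j. j \<notin> I \<longrightarrow> x $ j \<in> W"
    unfolding polyhedral_product_def by blast
  then show "(\<forall>j. x $ j \<in> X) \<and> {j. x $ j \<notin> W} \<in> K" using assms[of I "{j. x $ j \<notin> W}"] by blast
qed (auto simp: polyhedral_product_def)

lemma linear_Lambda_R: "linear (Lambda_R a)"
  unfolding Lambda_R_def
  by (rule linearI) (simp_all add: scaleR_add_left sum.distrib scaleR_sum_right)

lemma Lambda_R_nth: "Lambda_R a x $ j = (\<Sum>i\<in>UNIV. x $ i * of_int (a i $ j))"
  by (simp add: Lambda_R_def int_vec_def)

text \<open>Cones are abandoned here. All that is kept of the fan is that each vector has exactly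
  one nonnegative representation supported on a simplex; independence of simplices, purity and
  properness are derived from this again.\<close>

locale toric_data =
  fixes a :: "'m::finite \<Rightarrow> int^'n" and K :: "'m set set" and \<Psi> :: "complex^'l \<Rightarrow> complex^'m"
  assumes down: "I \<in> K \<Longrightarrow> J \<subseteq> I \<Longrightarrow> J \<in> K"
    and cover: "\<exists>c. (\<forall>i. 0 \<le> c $ i) \<and> {i. c $ i \<noteq> 0} \<in> K \<and> Lambda_R a c = x"
    and uniq: "(\<And>i. 0 \<le> c $ i) \<Longrightarrow> {i. c $ i \<noteq> 0} \<in> K \<Longrightarrow> (\<And>i. 0 \<le> d $ i) \<Longrightarrow> {i. d $ i \<noteq> 0} \<in> K
      \<Longrightarrow> Lambda_R a c = Lambda_R a d \<Longrightarrow> c = d"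
    and card_m: "CARD('m) = CARD('n) + 2 * CARD('l)"
    and lin: "Vector_Spaces.linear (*s) (*s) \<Psi>"
    and inj_Re: "inj (Re_vec \<circ> \<Psi>)"
    and Lambda_Psi: "Lambda_R a (Re_vec (\<Psi> w)) = 0"
begin

abbreviation "\<Lambda> \<equiv> Lambda_R a"

lemmas Lambda_add = linear_add[OF linear_Lambda_R, of a]
  and Lambda_diff = linear_diff[OF linear_Lambda_R, of a]
  and Lambda_scale = linear_scale[OF linear_Lambda_R, of a]
  and Lambda_neg = linear_neg[OF linear_Lambda_R, of a]
  and Lambda_0 = linear_0[OF linear_Lambda_R, of a]

lemma finite_K: "finite K" by simp

lemma empty_in_K: "{} \<in> K" using cover[of 0] down by blast

text \<open>On \<open>I\<close> the coefficients may have any sign. Adding \<open>M\<close>, a bound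
  for all their absolute values, to the coordinates in \<open>I\<close> makes them nonnegative,
  keeps the supports inside the given simplices and changes both images by the same vector.\<close>

lemma star_uniq:
  assumes c: "\<And>i. i \<notin> I \<Longrightarrow> 0 \<le> c $ i" "{i. c $ i \<noteq> 0} \<union> I \<in> K"
    and d: "\<And>i. i \<notin> I \<Longrightarrow> 0 \<le> d $ i" "{i. d $ i \<noteq> 0} \<union> I \<in> K"
    and eq: "\<Lambda> c = \<Lambda> d"
  shows "c = d"
proof -
  define M where "M = (\<Sum>i\<in>UNIV. \<bar>c $ i\<bar>) + (\<Sum>i\<in>UNIV. \<bar>d $ i\<bar>)"
  have "\<bar>c $ i\<bar> \<le> (\<Sum>i\<in>UNIV. \<bar>c $ i\<bar>)" "\<bar>d $ i\<bar> \<le> (\<Sum>i\<in>UNIV. \<bar>d $ i\<bar>)" for i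
    by (auto intro: member_le_sum)
  moreover have "0 \<le> (\<Sum>i\<in>UNIV. \<bar>c $ i\<bar>)" "0 \<le> (\<Sum>i\<in>UNIV. \<bar>d $ i\<bar>)" by (auto intro: sum_nonneg)
  ultimately have M: "\<bar>c $ i\<bar> \<le> M" "\<bar>d $ i\<bar> \<le> M" for i
    unfolding M_def by (metis add_increasing add_increasing2)+
  define e :: "real^'m" where "e = (\<chi> i. if i \<in> I then M else 0)"
  have "c + e = d + e"
  proof (rule uniq)
    show "0 \<le> (c + e) $ i" "0 \<le> (d + e) $ i" for i
      using c(1)[of i] d(1)[of i] M[of i] by (auto simp: e_def)
    show "{i. (c + e) $ i \<noteq> 0} \<in> K" by (rule down[OF c(2)]) (auto simp: e_def)
    show "{i. (d + e) $ i \<noteq> 0} \<in> K" by (rule down[OF d(2)]) (auto simp: e_def)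
    show "\<Lambda> (c + e) = \<Lambda> (d + e)" using eq by (simp add: Lambda_add)
  qed
  then show ?thesis by simp
qed

text \<open>The part of \<open>y\<close> on \<open>I\<close> and the negative of its part off
  \<open>I\<close> have the same image under \<Lambda>. Their supports lie in \<open>I\<close> and
  \<open>J\<close>, and off \<open>I \<inter> J\<close> both are nonnegative, so
  \<open>star_uniq\<close> identifies them. Having disjoint supports, they vanish.\<close>

lemma kernel_sign:
  assumes IJ: "I \<in> K" "J \<in> K" and y: "\<Lambda> y = 0" "\<And>i. i \<notin> I \<Longrightarrow> y $ i \<le> 0" "\<And>i. i \<notin> J \<Longrightarrow> 0 \<le> y $ i"
  shows "y = 0"
proof -
  define c where "c = (\<chi> i. if i \<in> I then y $ i else 0)"
  define d where "d = (\<chi> i. if i \<in> I then 0 else - y $ i)"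
  have "y = c - d" by (simp add: c_def d_def vec_eq_iff)
  have "c = d"
  proof (rule star_uniq[of "I \<inter> J"])
    show "{i. c $ i \<noteq> 0} \<union> I \<inter> J \<in> K" by (rule down[OF IJ(1)]) (auto simp: c_def)
    show "{i. d $ i \<noteq> 0} \<union> I \<inter> J \<in> K"
    proof (rule down[OF IJ(2)])
      have "y $ i = 0" if "i \<notin> I" "i \<notin> J" for i using y(2,3) that by (intro antisym) auto
      then show "{i. d $ i \<noteq> 0} \<union> I \<inter> J \<subseteq> J" by (auto simp: d_def split: if_splits)
    qed
    show "\<Lambda> c = \<Lambda> d" using y(1) \<open>y = c - d\<close> Lambda_diff[of c d] by simp
  qed (use y(2,3) in \<open>auto simp: c_def d_def\<close>)
  then show ?thesis using \<open>y = c - d\<close> by simp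
qed

text \<open>For \<open>I = J\<close> the sign conditions say that \<open>y\<close> is supported on
  \<open>I\<close>. This is the linear independence of the generators of a simplex.\<close>

lemma kernel_supp: "I \<in> K \<Longrightarrow> \<Lambda> y = 0 \<Longrightarrow> (\<And>i. i \<notin> I \<Longrightarrow> y $ i = 0) \<Longrightarrow> y = 0"
  by (rule kernel_sign[of I I]) auto

text \<open>With \<open>s\<close> the sum of the generators of the cone \<open>I\<close>, infinitely many of the points
  \<open>x + N s\<close> lie in the same cone, and comparing their coordinates shows that this cone has \<open>I\<close> as a
  face.\<close>
lemma star_cover:
  assumes I: "I \<in> K"
  obtains c where "\<And>i. i \<notin> I \<Longrightarrow> 0 \<le> c $ i" "{i. c $ i \<noteq> 0} \<union> I \<in> K" "\<Lambda> c = x"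
proof -
  define s :: "real^'m" where "s = (\<chi> i. if i \<in> I then 1 else 0)"
  have "\<forall>N::nat. \<exists>c. (\<forall>i. 0 \<le> c $ i) \<and> {i. c $ i \<noteq> 0} \<in> K \<and> \<Lambda> c = x + of_nat N *\<^sub>R \<Lambda> s"
    using cover by blast
  then obtain c where c: "\<And>N i. 0 \<le> c N $ i" "\<And>N. {i. c N $ i \<noteq> 0} \<in> K"
    "\<And>N::nat. \<Lambda> (c N) = x + of_nat N *\<^sub>R \<Lambda> s" by metis
  let ?S = "\<lambda>N. {i. c N $ i \<noteq> 0}"
  obtain N0 where inf: "infinite {N \<in> UNIV. ?S N = ?S N0}"
    using pigeonhole_infinite[of "UNIV :: nat set" ?S] by auto
  have big: "\<exists>N > m. ?S N = ?S N0" for m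
    using inf unfolding infinite_nat_iff_unbounded by auto
  obtain N1 where N1: "N1 > N0" "?S N1 = ?S N0" using big by blast
  \<comment> \<open>While the support stays the same, the coefficients depend affinely on
    \<open>N\<close>, and \<open>\<sigma>\<close> is their slope. A negative slope would make a
    coefficient negative for large \<open>N\<close>; hence \<open>\<sigma>\<close> is the
    nonnegative representation of \<open>\<Lambda> s\<close>, that is, \<open>s\<close>.\<close>
  define \<sigma> where "\<sigma> = (1 / (real N1 - real N0)) *\<^sub>R (c N1 - c N0)"
  have L\<sigma>: "\<Lambda> \<sigma> = \<Lambda> s"
  proof -
    have "\<Lambda> (c N1 - c N0) = (real N1 - real N0) *\<^sub>R \<Lambda> s"
      by (simp add: Lambda_diff c(3) scaleR_diff_left)
    then show ?thesis using N1(1) by (simp add: \<sigma>_def Lambda_scale)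
  qed
  have supp\<sigma>: "\<sigma> $ i = 0" if "i \<notin> ?S N0" for i using that N1(2) by (auto simp: \<sigma>_def)
  have cN: "c N = c N0 + (real N - real N0) *\<^sub>R \<sigma>" if "?S N = ?S N0" for N
  proof -
    have "c N - c N0 - (real N - real N0) *\<^sub>R \<sigma> = 0"
    proof (rule kernel_supp[OF c(2)[of N0]])
      show "\<Lambda> (c N - c N0 - (real N - real N0) *\<^sub>R \<sigma>) = 0"
        unfolding Lambda_scale Lambda_diff c(3) L\<sigma> by (simp add: scaleR_diff_left)
      fix i assume "i \<notin> ?S N0"
      then show "(c N - c N0 - (real N - real N0) *\<^sub>R \<sigma>) $ i = 0"
        using supp\<sigma>[of i] that by auto
    qed
    then show ?thesis by (simp add: algebra_simps)
  qed
  have \<sigma>pos: "0 \<le> \<sigma> $ i" for i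
  proof (rule ccontr)
    assume "\<not> 0 \<le> \<sigma> $ i"
    obtain m :: nat where m: "real m > c N0 $ i / (- \<sigma> $ i) + real N0" using reals_Archimedean2
        by blast
    obtain N where N: "N > m" "?S N = ?S N0" using big by blast
    have "c N0 $ i / (- \<sigma> $ i) < real N - real N0" using m N(1) by linarith
    then have "c N0 $ i + (real N - real N0) * \<sigma> $ i < 0"
      using \<open>\<not> 0 \<le> \<sigma> $ i\<close> by (simp add: field_simps)
    then show False using c(1)[of N i] cN[OF N(2)] by simp
  qed
  have "\<sigma> = s"
  proof (rule uniq)
    show "{i. \<sigma> $ i \<noteq> 0} \<in> K" by (rule down[OF c(2)[of N0]]) (use supp\<sigma> in auto)
    show "{i. s $ i \<noteq> 0} \<in> K" by (rule down[OF I]) (auto simp: s_def)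
  qed (use \<sigma>pos L\<sigma> in \<open>auto simp: s_def\<close>)
  then have IS: "I \<subseteq> ?S N0" using supp\<sigma> by (force simp: s_def)
  show thesis
  proof (rule that[of "c N0 - real N0 *\<^sub>R s"])
    show "{i. (c N0 - real N0 *\<^sub>R s) $ i \<noteq> 0} \<union> I \<in> K"
      by (rule down[OF c(2)[of N0]]) (use IS in \<open>auto simp: s_def split: if_splits\<close>)
    show "\<Lambda> (c N0 - real N0 *\<^sub>R s) = x" by (simp add: Lambda_diff Lambda_scale c(3))
  qed (use c(1) in \<open>auto simp: s_def\<close>)
qed

lemma simplex_card_le:
  assumes I: "I \<in> K"
  shows "card I \<le> CARD('n)"
proof -
  let ?A = "\<lambda>i. int_vec (a i)"
  have ind: "indep_family ?A I"
    unfolding indep_family_def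
  proof (intro allI impI)
    fix c assume c: "(\<Sum>i\<in>I. c i *\<^sub>R ?A i) = 0"
    have "\<Lambda> (\<chi> i. if i \<in> I then c i else 0) = (\<Sum>i\<in>I. c i *\<^sub>R ?A i)"
      unfolding Lambda_R_def by (rule sum.mono_neutral_cong_right) auto
    then have "(\<chi> i. if i \<in> I then c i else 0) = 0"
      using c by (intro kernel_supp[OF I]) auto
    then show "\<forall>i\<in>I. c i = 0" by (auto simp: vec_eq_iff split: if_splits)
  qed
  show ?thesis
    using independent_bound[OF indep_family_imp_independent(2)[OF ind]]
      card_image[OF indep_family_imp_independent(1)[OF ind]] by simp
qed

text \<open>The simplex containing \<open>I\<close> is found from a point outside all the proper subspaces spanned
  by cones of lower dimension.\<close>
lemma pure:
  assumes I: "I \<in> K"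
  obtains J where "J \<in> K" "I \<subseteq> J" "card J = CARD('n)"
proof -
  let ?A = "\<lambda>i. int_vec (a i)"
  let ?L = "(\<lambda>J. span (?A ` J)) ` {J \<in> K. card J < CARD('n)}"
  have "negligible (\<Union>?L)"
  proof (rule negligible_Union)
    fix S assume "S \<in> ?L"
    then obtain J where J: "card J < CARD('n)" "S = span (?A ` J)" by blast
    have "dim S \<le> card (?A ` J)" unfolding J(2) dim_span by (rule dim_le_card') simp
    also have "\<dots> \<le> card J" by (rule card_image_le) simp
    finally show "negligible S" using J by (intro negligible_lowdim) simp
  qed simp
  then have "\<Union>?L \<noteq> UNIV" using non_negligible_UNIV by metis
  then obtain x where x: "x \<notin> \<Union>?L" by blast
  obtain c where c: "{i. c $ i \<noteq> 0} \<union> I \<in> K" "\<Lambda> c = x" using star_cover[OF I] by metis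
  let ?J = "{i. c $ i \<noteq> 0} \<union> I"
  have "x = (\<Sum>i\<in>?J. c $ i *\<^sub>R ?A i)"
    unfolding c(2)[symmetric] Lambda_R_def by (rule sum.mono_neutral_right) auto
  also have "\<dots> \<in> span (?A ` ?J)" by (intro span_sum span_mul span_base imageI)
  finally have "x \<in> span (?A ` ?J)" .
  then have "\<not> card ?J < CARD('n)" using x c(1) by auto
  then show thesis using that[of ?J] simplex_card_le[OF c(1)] c(1) by auto
qed

section \<open>The map \<Psi>, its conjugate and the kernel of \<Lambda>\<close>

lemma Psi_add: "\<Psi> (v + w) = \<Psi> v + \<Psi> w" using lin by (rule vec.linear_add)
lemma Psi_diff: "\<Psi> (v - w) = \<Psi> v - \<Psi> w" using lin by (rule vec.linear_diff)
lemma Psi_scale: "\<Psi> (c *s w) = c *s \<Psi> w" using lin by (rule vec.linear_scale)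
lemma Psi_0: "\<Psi> 0 = 0" using lin by (rule vec.linear_0)
lemma linear_Psi: "linear \<Psi>" using lin by (rule linear_vec_imp_linear)

text \<open>The vector \<open>Re_vec (\<Psi> w)\<close> is in the kernel of \<Lambda>, where nothing
  but 0 is supported on a simplex. Infinitesimally this is the freeness of the action at points
  whose zeros form the simplex \<open>I\<close>.\<close>

lemma Psi_Re_zero:
  assumes "I \<in> K" "\<And>i. i \<notin> I \<Longrightarrow> Re (\<Psi> w $ i) = 0"
  shows "w = 0"
proof -
  have "Re_vec (\<Psi> w) = 0" by (rule kernel_supp[OF assms(1) Lambda_Psi]) (simp add: assms(2))
  then have "(Re_vec \<circ> \<Psi>) w = (Re_vec \<circ> \<Psi>) 0" by (simp add: Psi_0 vec_eq_iff)
  then show ?thesis using inj_Re by (rule injD[rotated])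
qed

text \<open>Conjugation is applied to the argument as well, so that the map is complex linear and
  not antilinear; its image is still the conjugate of the image of \<Psi>.\<close>

definition Psibar :: "complex^'l \<Rightarrow> complex^'m" where "Psibar v = cnjv (\<Psi> (cnjv v))"

lemma Psibar_add: "Psibar (v + w) = Psibar v + Psibar w" by (simp add: Psibar_def cnjv_add Psi_add)
lemma Psibar_scale: "Psibar (c *s v) = c *s Psibar v" by (simp add: Psibar_def cnjv_cmult Psi_scale)
lemma linear_Psibar: "Vector_Spaces.linear (*s) (*s) Psibar"
  by unfold_locales (auto simp: Psibar_add Psibar_scale)
lemma Psibar_diff: "Psibar (v - w) = Psibar v - Psibar w" using linear_Psibar by (rule
    vec.linear_diff)
lemma Psibar_0: "Psibar 0 = 0" using linear_Psibar by (rule vec.linear_0)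

lemma Im_Psi: "Im (\<Psi> w $ i) = - Re (\<Psi> (\<i> *s w) $ i)" by (simp add: Psi_scale)

text \<open>The assumption on \<Psi> concerns real parts. Applied to \<open>\<i> *s w\<close>, it
  yields the imaginary parts too.\<close>

lemma Lambda_C_Psi: "(\<Sum>i\<in>UNIV. \<Psi> w $ i * of_int (a i $ j)) = 0"
proof -
  have "(\<Sum>i\<in>UNIV. Re (\<Psi> w $ i) * of_int (a i $ j)) = 0" for w
    using Lambda_R_nth[of a "Re_vec (\<Psi> w)" j] by (simp add: Lambda_Psi)
  note this[of w] this[of "\<i> *s w"]
  then show ?thesis by (simp add: complex_eq_iff Im_Psi sum_negf)
qed

lemma Lambda_C_Psibar: "(\<Sum>i\<in>UNIV. Psibar w $ i * of_int (a i $ j)) = 0"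
proof -
  have "(\<Sum>i\<in>UNIV. Psibar w $ i * of_int (a i $ j)) = cnj (\<Sum>i\<in>UNIV. \<Psi> (cnjv w) $ i * of_int (a i $
      j))"
    by (simp add: Psibar_def)
  then show ?thesis by (simp only: Lambda_C_Psi complex_cnj_zero)
qed

text \<open>For \<open>I = {}\<close> this says that the period lattice of \<open>G_fan a / C_sub \<Psi>\<close> is discrete.\<close>
lemma Psi_Psibar_discrete:
  obtains \<epsilon> where "\<epsilon> > 0"
    "\<And>I w v. I \<in> K \<Longrightarrow> norm v < \<epsilon> \<Longrightarrow> (\<And>i. i \<notin> I \<Longrightarrow> exp ((\<Psi> w + Psibar v) $ i) = 1) \<Longrightarrow> w = 0 \<and> v = 0"
proof -
  have "bounded_linear \<Psi>" using linear_Psi by (simp add: linear_conv_bounded_linear)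
  then obtain B where B: "B > 0" "\<And>x. norm (\<Psi> x) \<le> norm x * B" using bounded_linear.pos_bounded
      by blast
  show thesis
  \<comment> \<open>\<open>B\<close> bounds \<Psi>, so the imaginary parts \<open>?t\<close> below
    are smaller than pi in absolute value. They are integral multiples of pi, hence 0.\<close>
  proof (rule that[of "pi / B"])
    show "pi / B > 0" using B by simp
    fix I w v assume I: "I \<in> K" and v: "norm v < pi / B" and e: "\<And>i. i \<notin> I \<Longrightarrow>
        exp ((\<Psi> w + Psibar v) $ i) = 1"
    \<comment> \<open>Only the moduli are used at first: off \<open>I\<close> the real part of the
      exponent, which is that of \<open>\<Psi> (w + cnjv v)\<close>, must vanish. The phases are
      left for the second half.\<close>
    have "w + cnjv v = 0"
    proof (rule Psi_Re_zero[OF I])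
      fix i assume "i \<notin> I"
      then have "norm (exp ((\<Psi> w + Psibar v) $ i)) = 1" using e by simp
      then show "Re (\<Psi> (w + cnjv v) $ i) = 0" by (simp add: Psi_add Psibar_def)
    qed
    then have w: "w = - cnjv v" by (simp add: eq_neg_iff_add_eq_0)
    have "\<i> *s cnjv v = 0"
    proof (rule Psi_Re_zero[OF I])
      fix i assume i: "i \<notin> I"
      let ?t = "Im (\<Psi> (cnjv v) $ i)"
      have "\<Psi> w = - \<Psi> (cnjv v)" unfolding w using vec.linear_neg[OF lin] by blast
      then have eq: "(\<Psi> w + Psibar v) $ i = - 2 * \<i> * ?t"
        by (simp add: Psibar_def complex_eq_iff)
      then have "exp (- 2 * \<i> * ?t) = 1" using e[OF i] by simp
      then have "\<exists>n::int. Im (- 2 * \<i> * ?t) = of_int (2 * n) * pi" unfolding exp_eq_1 by (rule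
          conjunct2)
      then obtain n :: int where "Im (- 2 * \<i> * ?t) = of_int (2 * n) * pi" ..
      moreover have "Im (- 2 * \<i> * ?t) = - 2 * ?t" by simp
      ultimately have n: "- 2 * ?t = of_int (2 * n) * pi" by (rule trans[OF sym, rotated])
      have "\<bar>?t\<bar> \<le> norm (\<Psi> (cnjv v))"
        using abs_Im_le_cmod[of "\<Psi> (cnjv v) $ i"] Finite_Cartesian_Product.norm_nth_le[of "\<Psi>
            (cnjv v)" i] by linarith
      also have "\<dots> \<le> norm v * B" using B(2)[of "cnjv v"] by simp
      also have "\<dots> < pi" using v B(1) by (simp add: field_simps)
      finally have "\<bar>?t\<bar> < pi" .
      moreover have "?t = - of_int n * pi" using n by (simp only: of_int_mult of_int_numeral)
      ultimately have "\<bar>of_int n\<bar> * pi < 1 * pi" by (simp add: abs_mult)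
      then have "\<bar>real_of_int n\<bar> < 1" by simp
      then have "n = 0" by linarith
      then show "Re (\<Psi> (\<i> *s cnjv v) $ i) = 0" using n unfolding Im_Psi by simp
    qed
    then have "v = 0" by (simp add: vec_eq_iff)
    then show "w = 0 \<and> v = 0" using w by (simp add: vec_eq_iff)
  qed
qed

text \<open>Off a simplex with n elements there remain m - n = 2\<ell> real coordinates, the real
  dimension of \<open>complex^'l\<close>. Taking these coordinates of the real part of \<Psi> is
  injective by \<open>Psi_Re_zero\<close>, hence bijective, and \<open>T\<close> is the inverse
  preceded by forgetting the coordinates in \<open>J\<close>.\<close>

lemma kernel_lift:
  assumes J: "J \<in> K" "card J = CARD('n)"
  obtains T :: "real^'m \<Rightarrow> complex^'l" where "linear T" "\<And>x i. i \<notin> J \<Longrightarrow> Re (\<Psi> (T x) $ i) = x $ i"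
proof -
  define M :: "complex^'l \<Rightarrow> real^'m" where "M w = (\<chi> i. if i \<in> J then 0 else Re (\<Psi> w $ i))" for w
  have linM: "linear M"
    by (rule linearI) (auto simp: M_def vec_eq_iff linear_add[OF linear_Psi] linear_scale[OF
        linear_Psi])
  have injM: "inj M"
    unfolding linear_injective_0[OF linM]
  proof (intro allI impI)
    fix w assume "M w = 0"
    then show "w = 0" by (intro Psi_Re_zero[OF J(1)]) (auto simp: M_def vec_eq_iff split: if_splits)
  qed
  obtain g where g: "linear g" "g \<circ> M = id" using linear_injective_left_inverse[OF linM injM] by
      blast
  let ?X = "{x :: real^'m. \<forall>i\<in>J. x $ i = 0}"
  have "range M = ?X"
  proof (rule subspace_dim_equal)
    show "subspace (range M)" using linM linear_subspace_image subspace_UNIV by blast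
    show "subspace ?X" by (auto simp: subspace_def)
    show "range M \<subseteq> ?X" by (auto simp: M_def)
    have "dim (range M) = DIM(complex^'l)"
      using dim_image_eq[OF linM, of UNIV] injM by (simp add: dim_UNIV)
    then have dM: "dim (range M) = 2 * CARD('l)" by simp
    have "?X \<subseteq> span ((\<lambda>i. axis i 1) ` (- J))"
    proof
      fix x :: "real^'m" assume "x \<in> ?X"
      then have "x = (\<Sum>i\<in>-J. x $ i *\<^sub>R axis i 1)"
        by (auto simp: vec_eq_iff axis_def if_distrib cong: if_cong)
      then show "x \<in> span ((\<lambda>i. axis i 1) ` (- J))"
        by (metis (no_types, lifting) image_eqI span_base span_mul span_sum)
    qed
    then have "dim ?X \<le> card ((\<lambda>i. axis i (1::real)) ` (- J))" by (intro dim_le_card) auto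
    also have "\<dots> \<le> card (- J)" by (rule card_image_le) simp
    also have "\<dots> = 2 * CARD('l)" using card_m J(2) by (simp add: Compl_eq_Diff_UNIV
        card_Diff_subset)
    finally show "dim ?X \<le> dim (range M)" using dM by simp
  qed
  define T where "T x = g (\<chi> i. if i \<in> J then 0 else x $ i)" for x
  show thesis
  proof (rule that[of T])
    show "linear T"
    proof (rule linearI)
      show "T (x + y) = T x + T y" for x y
        unfolding T_def linear_add[OF g(1), symmetric] by (rule arg_cong[of _ _ g]) (simp add:
            vec_eq_iff)
      show "T (r *\<^sub>R x) = r *\<^sub>R T x" for r x
        unfolding T_def linear_scale[OF g(1), symmetric] by (rule arg_cong[of _ _ g]) (simp add:
            vec_eq_iff)
    qed
    show "Re (\<Psi> (T x) $ i) = x $ i" if "i \<notin> J" for x i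
    proof -
      have "(\<chi> i. if i \<in> J then 0 else x $ i) \<in> range M" using \<open>range M = ?X\<close> by simp
      then obtain w where w: "(\<chi> i. if i \<in> J then 0 else x $ i) = M w" by blast
      then have "T x = w" using g(2) by (simp add: T_def pointfree_idE)
      then show ?thesis using arg_cong[OF w, of "\<lambda>v. v $ i"] that by (simp add: M_def)
    qed
  qed
qed

lemma kernel_lift_kernel:
  assumes "J \<in> K" "\<And>x i. i \<notin> J \<Longrightarrow> Re (\<Psi> (T x) $ i) = x $ i" "\<Lambda> y = 0"
  shows "Re_vec (\<Psi> (T y)) = y"
proof -
  have "Re_vec (\<Psi> (T y)) - y = 0"
    by (rule kernel_supp[OF assms(1)]) (auto simp: Lambda_diff Lambda_Psi assms)
  then show ?thesis by simp
qed

lemma kernel_surj: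
  assumes "\<Lambda> y = 0"
  obtains w where "Re_vec (\<Psi> w) = y"
proof -
  obtain J where "J \<in> K" "card J = CARD('n)" using pure[OF empty_in_K] by metis
  then show thesis using kernel_lift[of J] kernel_lift_kernel[of J _ y] assms that by metis
qed

text \<open>By \<open>kernel_sign\<close> the right-hand side vanishes nowhere on the unit sphere of
  the kernel. It is continuous and positively homogeneous, so its minimum on that compact sphere
  serves as \<open>c\<close>. This is the quantitative form on which properness rests.\<close>

lemma kernel_norm_bound:
  assumes I: "I \<in> K" and J: "J \<in> K"
  obtains c where "c > 0" "\<And>y. \<Lambda> y = 0 \<Longrightarrow> c * norm y \<le> (\<Sum>i\<in>-I. max 0 (y $ i)) + (\<Sum>i\<in>-J. max 0 (-
      (y $ i)))"
proof -
  let ?f = "\<lambda>y :: real^'m. (\<Sum>i\<in>-I. max 0 (y $ i)) + (\<Sum>i\<in>-J. max 0 (- (y $ i)))"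
  let ?S = "sphere 0 1 \<inter> {y. \<Lambda> y = 0}"
  have scale: "?f (r *\<^sub>R y) = r * ?f y" if "r \<ge> 0" for r y
  proof -
    have *: "max 0 (r * t) = r * max 0 t" for t using that by (simp add: max_mult_distrib_left)
    have "max 0 (- (r * t)) = r * max 0 (- t)" for t using *[of "-t"] by simp
    then show ?thesis using * by (simp add: sum_distrib_left distrib_left)
  qed
  have normalize: "(1 / norm y) *\<^sub>R y \<in> ?S" if "\<Lambda> y = 0" "y \<noteq> 0" for y
    using that by (simp add: Lambda_scale)
  show thesis
  proof (cases "?S = {}")
    case True
    then have "y = 0" if "\<Lambda> y = 0" for y using normalize[OF that] by blast
    then show thesis using that[of 1] by force
  next
    case False
    have "closed {y. \<Lambda> y = 0}"
      by (intro closed_Collect_eq linear_continuous_on continuous_on_const)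
        (simp add: linear_conv_bounded_linear[symmetric] linear_Lambda_R)
    then have "compact ?S" by (intro compact_Int_closed) auto
    moreover have "continuous_on ?S ?f" by (intro continuous_intros)
    ultimately obtain y0 where y0: "y0 \<in> ?S" "\<And>y. y \<in> ?S \<Longrightarrow> ?f y0 \<le> ?f y"
      using continuous_attains_inf[of ?S ?f] False by blast
    have "?f y0 \<ge> 0" by (intro add_nonneg_nonneg sum_nonneg) auto
    moreover have "?f y0 \<noteq> 0"
    proof
      assume 0: "?f y0 = 0"
      have nn: "0 \<le> (\<Sum>i\<in>-I. max 0 (y0 $ i))" "0 \<le> (\<Sum>i\<in>-J. max 0 (- (y0 $ i)))"
        by (intro sum_nonneg; simp)+
      then have "(\<Sum>i\<in>-I. max 0 (y0 $ i)) = 0" "(\<Sum>i\<in>-J. max 0 (- (y0 $ i))) = 0" using 0 by linarith+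
      then have "\<forall>i\<in>-I. max 0 (y0 $ i) = 0" "\<forall>i\<in>-J. max 0 (- (y0 $ i)) = 0"
        by (simp_all add: sum_nonneg_eq_0_iff)
      then have "y0 $ i \<le> 0" if "i \<notin> I" for i using that by (metis ComplI max.cobounded2)
      moreover have "0 \<le> y0 $ i" if "i \<notin> J" for i
        using that \<open>\<forall>i\<in>-J. max 0 (- (y0 $ i)) = 0\<close> by (metis ComplI max.cobounded2 neg_le_0_iff_le)
      ultimately have "y0 = 0" using y0(1) by (intro kernel_sign[OF I J]) auto
      then show False using y0(1) by simp
    qed
    ultimately have pos: "?f y0 > 0" by linarith
    show thesis
    proof (rule that[OF pos])
      fix y assume y: "\<Lambda> y = 0"
      show "?f y0 * norm y \<le> ?f y"
      proof (cases "y = 0")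
        case False
        have "?f y0 \<le> ?f ((1 / norm y) *\<^sub>R y)" using normalize[OF y False] y0(2) by blast
        also have "\<dots> = ?f y / norm y" using scale[of "1 / norm y" y] by simp
        finally show ?thesis using False by (simp add: field_simps)
      qed (auto intro!: add_nonneg_nonneg sum_nonneg)
    qed
  qed
qed

section \<open>Properness and the retraction onto the moment-angle manifold\<close>

abbreviation "U \<equiv> arrangement_complement K"
abbreviation "Z \<equiv> moment_angle K"
abbreviation "G \<equiv> G_fan a"
abbreviation "C \<equiv> C_sub \<Psi>"

lemma U_iff: "z \<in> U \<longleftrightarrow> {i. z $ i = 0} \<in> K"
  unfolding arrangement_complement_def by (subst polyhedral_product_iff[OF down]) auto

lemma Z_iff: "z \<in> Z \<longleftrightarrow> (\<forall>i. norm (z $ i) \<le> 1) \<and> {i. norm (z $ i) \<noteq> 1} \<in> K"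
  unfolding moment_angle_def by (subst polyhedral_product_iff[OF down]) auto

lemma Z_subset_U: "Z \<subseteq> U"
proof
  fix z assume "z \<in> Z"
  then have "{i. norm (z $ i) \<noteq> 1} \<in> K" unfolding Z_iff by simp
  then show "z \<in> U" unfolding U_iff by (rule down) auto
qed

text \<open>The logarithmic multipliers are bounded above at the coordinates where \<open>z\<close>
  does not vanish, and below at those where \<open>u\<close> does not vanish. At the other
  coordinates the limits give no control; there \<open>kernel_norm_bound\<close> steps in, which
  needs exactly these one-sided bounds.\<close>

lemma bounded_multipliers:
  fixes ys :: "nat \<Rightarrow> real^'m"
  assumes zs: "zs \<longlonglongrightarrow> z" "z \<in> U" and us: "us \<longlonglongrightarrow> u" "u \<in> U" and ys: "\<And>n. \<Lambda> (ys n) = 0"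
    and eq: "\<And>n i. norm (us n $ i) = exp (ys n $ i) * norm (zs n $ i)"
  shows "Bseq ys"
proof -
  have bnd: "\<exists>B. eventually (\<lambda>n. max 0 (ys n $ i) \<le> B) sequentially"
    if zs: "zs \<longlonglongrightarrow> z" and us: "us \<longlonglongrightarrow> u" and i: "z $ i \<noteq> 0"
      and eq: "\<And>n i. norm (us n $ i) = exp (ys n $ i) * norm (zs n $ i)"
    for zs us :: "nat \<Rightarrow> complex^'m" and z u i and ys :: "nat \<Rightarrow> real^'m"
  proof -
    have lim: "(\<lambda>n. norm (zs n $ i)) \<longlonglongrightarrow> norm (z $ i)" "(\<lambda>n. norm (us n $ i)) \<longlonglongrightarrow> norm (u $ i)"
      using zs us by (auto intro!: tendsto_intros)
    have pos: "norm (z $ i) / 2 < norm (z $ i)" "norm (z $ i) > 0"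
        "norm (u $ i) < norm (u $ i) + 1" using i by auto
    let ?B = "max 0 (ln ((norm (u $ i) + 1) / (norm (z $ i) / 2)))"
    have "eventually (\<lambda>n. max 0 (ys n $ i) \<le> ?B) sequentially"
      using order_tendstoD(1)[OF lim(1) pos(1)] order_tendstoD(2)[OF lim(2) pos(3)]
    proof eventually_elim
      case (elim n)
      have "exp (ys n $ i) * (norm (z $ i) / 2) \<le> exp (ys n $ i) * norm (zs n $ i)"
        using elim by (intro mult_left_mono) auto
      also have "\<dots> \<le> norm (u $ i) + 1" using elim eq[of n i] by simp
      finally have "exp (ys n $ i) \<le> (norm (u $ i) + 1) / (norm (z $ i) / 2)"
        using pos(2) by (subst pos_le_divide_eq) auto
      then have "ys n $ i \<le> ln ((norm (u $ i) + 1) / (norm (z $ i) / 2))"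
        by (subst ln_ge_iff) (use pos(2) in \<open>auto intro!: divide_pos_pos add_nonneg_pos\<close>)
      then show ?case by linarith
    qed
    then show ?thesis by blast
  qed
  let ?I = "{i. z $ i = 0}" and ?J = "{i. u $ i = 0}"
  have "\<forall>i\<in>-?I. \<exists>B. eventually (\<lambda>n. max 0 (ys n $ i) \<le> B) sequentially"
    using bnd[OF zs(1) us(1) _ eq] by blast
  then obtain B1 where B1: "\<And>i. i \<in> -?I \<Longrightarrow> eventually (\<lambda>n. max 0 (ys n $ i) \<le> B1 i) sequentially"
      by metis
  \<comment> \<open>Exchanging the two sequences replaces \<open>ys\<close> by its negative, so the
    lower bounds are upper bounds for the exchanged roles.\<close>
  have eq': "norm (zs n $ i) = exp ((- ys n) $ i) * norm (us n $ i)" for n i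
    unfolding eq[of n i] by (simp add: exp_minus)
  have "\<forall>i\<in>-?J. \<exists>B. eventually (\<lambda>n. max 0 ((- ys n) $ i) \<le> B) sequentially"
    using bnd[OF us(1) zs(1), where ys = "\<lambda>n. - ys n", OF _ eq'] by blast
  then obtain B2 where B2: "\<And>i. i \<in> -?J \<Longrightarrow> eventually (\<lambda>n. max 0 ((- ys n) $ i) \<le> B2 i)
      sequentially" by metis
  obtain c where c: "c > 0" "\<And>y. \<Lambda> y = 0 \<Longrightarrow> c * norm y \<le> (\<Sum>i\<in>-?I. max 0 (y $ i)) + (\<Sum>i\<in>-?J. max 0
      (- (y $ i)))"
    using kernel_norm_bound[of ?I ?J] zs(2) us(2) unfolding U_iff by metis
  have e1: "eventually (\<lambda>n. \<forall>i\<in>-?I. max 0 (ys n $ i) \<le> B1 i) sequentially"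
    by (rule eventually_ball_finite) (use B1 in auto)
  have e2: "eventually (\<lambda>n. \<forall>i\<in>-?J. max 0 ((- ys n) $ i) \<le> B2 i) sequentially"
    by (rule eventually_ball_finite) (use B2 in auto)
  have "eventually (\<lambda>n. norm (ys n) \<le> ((\<Sum>i\<in>-?I. B1 i) + (\<Sum>i\<in>-?J. B2 i)) / c) sequentially"
    using e1 e2
  proof eventually_elim
    case (elim n)
    have "c * norm (ys n) \<le> (\<Sum>i\<in>-?I. max 0 (ys n $ i)) + (\<Sum>i\<in>-?J. max 0 (- (ys n $ i)))" using
        c(2) ys by blast
    also have "\<dots> \<le> (\<Sum>i\<in>-?I. B1 i) + (\<Sum>i\<in>-?J. B2 i)" using elim by (intro add_mono sum_mono) auto
    finally show ?case using c(1) by (simp add: field_simps)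
  qed
  then show ?thesis by (rule BfunI)
qed

lemma ln_power_int_real: "x > 0 \<Longrightarrow> ln (x powi k) = ln x * of_int k" for x :: real
  by (metis exp_ln exp_power_int ln_exp mult.commute)

lemma G_log_kernel:
  assumes "g \<in> G"
  shows "\<Lambda> (\<chi> i. ln (norm (g $ i))) = 0"
proof -
  have nz: "\<And>i. g $ i \<noteq> 0" and 1: "\<And>j. (\<Prod>i\<in>UNIV. (g $ i) powi (a i $ j)) = 1"
    using assms unfolding G_fan_def by auto
  have "(\<Sum>i\<in>UNIV. ln (norm (g $ i)) * of_int (a i $ j)) = 0" for j
  proof -
    have "(\<Sum>i\<in>UNIV. ln (norm (g $ i)) * of_int (a i $ j)) = (\<Sum>i\<in>UNIV. ln (norm (g $ i) powi (a i
        $ j)))"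
      using nz by (intro sum.cong) (auto simp: ln_power_int_real)
    also have "\<dots> = ln (\<Prod>i\<in>UNIV. norm (g $ i) powi (a i $ j))"
      using nz by (subst ln_prod) auto
    also have "(\<Prod>i\<in>UNIV. norm (g $ i) powi (a i $ j)) = norm (\<Prod>i\<in>UNIV. (g $ i) powi (a i $ j))"
      by (simp add: prod_norm[symmetric] norm_power_int)
    finally show ?thesis using 1 by simp
  qed
  then show ?thesis by (simp add: vec_eq_iff Lambda_R_nth)
qed

lemma tendsto_vec_mult:
  fixes f g :: "'z \<Rightarrow> complex^'k"
  assumes "(f \<longlongrightarrow> x) F" "(g \<longlongrightarrow> y) F"
  shows "((\<lambda>n. f n * g n) \<longlongrightarrow> x * y) F"
  by (rule vec_tendstoI) (use assms in \<open>auto intro!: tendsto_mult tendsto_vec_nth\<close>)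

text \<open>The multipliers are bounded and bounded away from 0, so a subsequence converges to a
  point with nonzero coordinates, which belongs to \<Gamma> by closedness. The group is a parameter,
  because the argument is applied to \<open>C\<close> and to \<open>G\<close>.\<close>

lemma orbit_relation_closed:
  assumes \<Gamma>: "\<Gamma> \<subseteq> G" "\<And>gs g. (\<And>n. gs n \<in> \<Gamma>) \<Longrightarrow> gs \<longlonglongrightarrow> g \<Longrightarrow> (\<And>i. g $ i \<noteq> 0) \<Longrightarrow> g \<in> \<Gamma>"
    and zs: "zs \<longlonglongrightarrow> z" "z \<in> U" and us: "us \<longlonglongrightarrow> u" "u \<in> U"
    and eq: "\<And>n::nat. \<exists>g\<in>\<Gamma>. us n = g * zs n"
  shows "\<exists>g\<in>\<Gamma>. u = g * z"
proof -
  obtain gs where gs: "\<And>n. gs n \<in> \<Gamma>" "\<And>n. us n = gs n * zs n" using eq by metis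
  have nz: "gs n $ i \<noteq> 0" for n i using gs(1)[of n] \<Gamma>(1) unfolding G_fan_def by auto
  define ys where "ys n = (\<chi> i. ln (norm (gs n $ i)))" for n
  have ey: "exp (ys n $ i) = norm (gs n $ i)" for n i using nz by (simp add: ys_def)
  have "Bseq ys"
    using zs us
  proof (rule bounded_multipliers)
    show "\<Lambda> (ys n) = 0" for n unfolding ys_def using G_log_kernel gs(1) \<Gamma>(1) by blast
    show "norm (us n $ i) = exp (ys n $ i) * norm (zs n $ i)" for n i
      by (simp add: gs(2) ey norm_mult)
  qed
  then obtain B where B: "\<And>n. norm (ys n) \<le> B" unfolding Bseq_def by blast
  have ge: "exp (- B) \<le> norm (gs n $ i)" and le: "norm (gs n $ i) \<le> exp B" for n i
  proof -
    have "\<bar>ys n $ i\<bar> \<le> B" using component_le_norm_cart[of "ys n" i] B[of n] by linarith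
    then have "- B \<le> ys n $ i" "ys n $ i \<le> B" by linarith+
    then show "exp (- B) \<le> norm (gs n $ i)" "norm (gs n $ i) \<le> exp B"
      unfolding ey[symmetric] by simp_all
  qed
  have "norm (gs n) \<le> (\<Sum>i\<in>(UNIV::'m set). exp B)" for n
  proof -
    have "norm (gs n) \<le> (\<Sum>i\<in>UNIV. norm (gs n $ i))" by (simp add: norm_vec_def L2_set_le_sum)
    also have "\<dots> \<le> (\<Sum>i\<in>(UNIV::'m set). exp B)" by (intro sum_mono le)
    finally show ?thesis .
  qed
  then have "bounded (range gs)" by (auto simp: bounded_iff)
  then obtain g r where r: "strict_mono (r :: nat \<Rightarrow> nat)" "(gs \<circ> r) \<longlonglongrightarrow> g"
    using bounded_imp_convergent_subsequence by blast
  have "g $ i \<noteq> 0" for i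
  proof -
    have "(\<lambda>n. norm ((gs \<circ> r) n $ i)) \<longlonglongrightarrow> norm (g $ i)" using r(2) by (intro tendsto_intros)
    moreover have "exp (- B) \<le> norm ((gs \<circ> r) n $ i)" for n using ge by simp
    ultimately have "exp (- B) \<le> norm (g $ i)" using LIMSEQ_le_const by blast
    then show ?thesis using exp_gt_zero[of "-B"] by (metis norm_zero not_less)
  qed
  then have "g \<in> \<Gamma>" using \<Gamma>(2)[OF _ r(2)] gs(1) by simp
  moreover have "(us \<circ> r) \<longlonglongrightarrow> g * z"
  proof -
    have "(\<lambda>n. (gs \<circ> r) n * (zs \<circ> r) n) \<longlonglongrightarrow> g * z"
      using r(2) LIMSEQ_subseq_LIMSEQ[OF zs(1) r(1)] by (rule tendsto_vec_mult)
    then show ?thesis by (simp add: gs(2) o_def)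
  qed
  ultimately show ?thesis using LIMSEQ_unique LIMSEQ_subseq_LIMSEQ[OF us(1) r(1)] by blast
qed

lemma G_closed:
  assumes gs: "\<And>n. gs n \<in> G" "gs \<longlonglongrightarrow> g" "\<And>i. g $ i \<noteq> 0"
  shows "g \<in> G"
proof -
  have "(\<Prod>i\<in>UNIV. (g $ i) powi (a i $ j)) = 1" for j
  proof -
    have "(\<lambda>n. \<Prod>i\<in>UNIV. (gs n $ i) powi (a i $ j)) \<longlonglongrightarrow> (\<Prod>i\<in>UNIV. (g $ i) powi (a i $ j))"
      using gs(2,3) by (intro tendsto_prod tendsto_power_int tendsto_vec_nth) auto
    moreover have "(\<lambda>n. \<Prod>i\<in>UNIV. (gs n $ i) powi (a i $ j)) = (\<lambda>n. 1)" using gs(1) unfolding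
        G_fan_def by auto
    ultimately show ?thesis by (metis LIMSEQ_unique tendsto_const)
  qed
  then show ?thesis using gs(3) unfolding G_fan_def by auto
qed

lemma C_iff: "g \<in> C \<longleftrightarrow> (\<exists>w. g = expv (\<Psi> w))"
  unfolding C_sub_def expv_def by auto

lemma expv_in_G:
  assumes "\<And>j. (\<Sum>i\<in>UNIV. x $ i * of_int (a i $ j)) = 0"
  shows "expv x \<in> G"
proof -
  have "(\<Prod>i\<in>UNIV. exp (x $ i) powi (a i $ j)) = exp (\<Sum>i\<in>UNIV. x $ i * of_int (a i $ j))" for j
    by (simp add: exp_sum exp_power_int mult.commute)
  then show ?thesis unfolding G_fan_def by (simp add: assms)
qed

lemma C_subset_G: "C \<subseteq> G"
proof
  fix g assume "g \<in> C"
  then obtain w where "g = expv (\<Psi> w)" unfolding C_iff ..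
  then show "g \<in> G" using expv_in_G[OF Lambda_C_Psi] by simp
qed

text \<open>The exponential image of a linear space may fail to be closed. Here \<open>T\<close>
  recovers \<open>w\<close> from the logarithms of the moduli of \<open>expv (\<Psi> w)\<close>, so
  convergence of the group elements forces convergence of the parameters.\<close>

lemma C_closed:
  assumes gs: "\<And>n. gs n \<in> C" "gs \<longlonglongrightarrow> g" "\<And>i. g $ i \<noteq> 0"
  shows "g \<in> C"
proof -
  have "\<forall>n. \<exists>w. gs n = expv (\<Psi> w)" using gs(1) unfolding C_iff ..
  then obtain ws where ws: "\<And>n. gs n = expv (\<Psi> (ws n))" by metis
  obtain J where J: "J \<in> K" "card J = CARD('n)" using pure[OF empty_in_K] by metis
  obtain T where T: "linear T" "\<And>x i. i \<notin> J \<Longrightarrow>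
      Re (\<Psi> (T x) $ i) = x $ i" using kernel_lift[OF J] by metis
  have T': "T (Re_vec (\<Psi> w)) = w" for w
  proof -
    have "(Re_vec \<circ> \<Psi>) (T (Re_vec (\<Psi> w))) = (Re_vec \<circ> \<Psi>) w"
      using kernel_lift_kernel[OF J(1) T(2) Lambda_Psi] by simp
    then show ?thesis using inj_Re by (rule injD[rotated])
  qed
  have "(\<lambda>n. Re_vec (\<Psi> (ws n))) \<longlonglongrightarrow> (\<chi> i. ln (norm (g $ i)))"
  proof (rule vec_tendstoI)
    fix i
    have "(\<lambda>n. ln (norm (gs n $ i))) \<longlonglongrightarrow> ln (norm (g $ i))"
      using gs(2,3) by (intro tendsto_ln tendsto_norm tendsto_vec_nth) auto
    then show "(\<lambda>n. Re_vec (\<Psi> (ws n)) $ i) \<longlonglongrightarrow> (\<chi> i. ln (norm (g $ i))) $ i"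
      by (simp add: ws)
  qed
  from bounded_linear.tendsto[OF T(1)[unfolded linear_conv_bounded_linear] this]
  have w: "ws \<longlonglongrightarrow> T (\<chi> i. ln (norm (g $ i)))" by (simp add: T')
  let ?w = "T (\<chi> i. ln (norm (g $ i)))"
  have "gs \<longlonglongrightarrow> expv (\<Psi> ?w)"
  proof (rule vec_tendstoI)
    fix i
    have "(\<lambda>n. \<Psi> (ws n)) \<longlonglongrightarrow> \<Psi> ?w"
      using bounded_linear.tendsto[OF linear_Psi[unfolded linear_conv_bounded_linear] w] .
    then show "(\<lambda>n. gs n $ i) \<longlonglongrightarrow> expv (\<Psi> ?w) $ i"
      unfolding ws expv_nth by (intro tendsto_exp tendsto_vec_nth)
  qed
  then have "g = expv (\<Psi> ?w)" using gs(2) LIMSEQ_unique by blast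
  then show ?thesis using C_iff by blast
qed

lemma C_orbit_eq: "C_orbit \<Psi> z = {expv (\<Psi> w) * z | w. True}"
  unfolding C_orbit_def orbit_def mult_group_def using C_iff by auto

lemma C_orbit_eq_iff: "C_orbit \<Psi> z = C_orbit \<Psi> u \<longleftrightarrow> (\<exists>w. z = expv (\<Psi> w) * u)"
proof
  assume "C_orbit \<Psi> z = C_orbit \<Psi> u"
  moreover have "z \<in> C_orbit \<Psi> z" unfolding C_orbit_eq using Psi_0 expv_0
    by (metis (mono_tags, lifting) mem_Collect_eq mult_1)
  ultimately show "\<exists>w. z = expv (\<Psi> w) * u" unfolding C_orbit_eq by blast
next
  assume "\<exists>w. z = expv (\<Psi> w) * u"
  then obtain w where z: "z = expv (\<Psi> w) * u" by blast
  have "expv (\<Psi> v) * z = expv (\<Psi> (v + w)) * u" for v by (simp add: z Psi_add expv_add mult.assoc)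
  moreover have "expv (\<Psi> v) * u = expv (\<Psi> (v - w)) * z" for v
    unfolding z mult.assoc[symmetric] expv_add[symmetric] Psi_add[symmetric] by simp
  ultimately show "C_orbit \<Psi> z = C_orbit \<Psi> u" unfolding C_orbit_eq by blast
qed

text \<open>The coordinates of the sought point should have moduli \<open>exp (- c $ i)\<close>,
  with \<open>c\<close> nonnegative and supported on a simplex, or be 0. With \<open>t\<close> the
  logarithms of the moduli of \<open>z\<close>, this requires \<open>- c - t\<close> to be the real
  part of some \<open>\<Psi> w\<close>, that is, to lie in the kernel of \<Lambda>. At zeros of
  \<open>z\<close> the value of \<open>t\<close> is arbitrary, since \<open>star_cover\<close>
  leaves the sign of \<open>c\<close> free there.\<close>

lemma ex_moment_angle_rep:
  assumes z: "z \<in> U"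
  obtains w where "expv (\<Psi> w) * z \<in> Z"
proof -
  let ?I = "{i. z $ i = 0}"
  have I: "?I \<in> K" using z U_iff by simp
  define t where "t = (\<chi> i. if z $ i = 0 then 0 else ln (norm (z $ i)))"
  obtain c where c: "\<And>i. i \<notin> ?I \<Longrightarrow> 0 \<le> c $ i" "{i. c $ i \<noteq> 0} \<union> ?I \<in> K" "\<Lambda> c = - \<Lambda> t"
    using star_cover[OF I] by metis
  have "\<Lambda> (- c - t) = 0" by (simp add: Lambda_diff Lambda_neg c(3))
  then obtain w where w: "Re_vec (\<Psi> w) = - c - t" using kernel_surj by blast
  have n: "norm ((expv (\<Psi> w) * z) $ i) = (if z $ i = 0 then 0 else exp (- c $ i))" for i
  proof -
    have "Re (\<Psi> w $ i) = - c $ i - t $ i" using arg_cong[OF w, of "\<lambda>v. v $ i"] by simp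
    then show ?thesis by (auto simp: norm_mult t_def exp_diff)
  qed
  have "expv (\<Psi> w) * z \<in> Z"
    unfolding Z_iff n
  proof
    show "\<forall>i. (if z $ i = 0 then 0 else exp (- c $ i)) \<le> 1" using c(1) by auto
    show "{i. (if z $ i = 0 then 0 else exp (- c $ i)) \<noteq> 1} \<in> K" by (rule down[OF c(2)]) auto
  qed
  then show thesis using that by blast
qed

text \<open>The negative logarithms of the moduli of the two points are nonnegative off the common
  zero set, have supports in simplices containing it and differ by an element of the kernel of
  \<Lambda>. By \<open>star_uniq\<close> they coincide, so the real part of \<open>\<Psi> w\<close>
  is 0.\<close>

lemma moment_angle_rep_unique:
  assumes z: "z \<in> Z" "expv (\<Psi> w) * z \<in> Z"
  shows "w = 0"
proof -
  let ?I = "{i. z $ i = 0}" and ?u = "expv (\<Psi> w) * z"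
  have I: "?I \<in> K" using z(1) Z_subset_U U_iff by auto
  define c where "c = (\<chi> i. if z $ i = 0 then 0 else - ln (norm (z $ i)))"
  have nu: "norm (?u $ i) = exp (Re (\<Psi> w $ i)) * norm (z $ i)" for i by (simp add: norm_mult)
  have "c = c - Re_vec (\<Psi> w)"
  proof (rule star_uniq[of ?I])
    fix i assume "i \<notin> ?I"
    then have i: "norm (z $ i) > 0" "norm (?u $ i) > 0" "norm (z $ i) \<le> 1" "norm (?u $ i) \<le> 1"
      using z unfolding Z_iff by auto
    then show "0 \<le> c $ i" using i by (simp add: c_def)
    have "(c - Re_vec (\<Psi> w)) $ i = - ln (norm (?u $ i))"
      unfolding nu using i by (simp add: c_def ln_mult)
    then show "0 \<le> (c - Re_vec (\<Psi> w)) $ i" using i by simp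
  next
    have "{i. c $ i \<noteq> 0} \<union> ?I \<subseteq> {i. norm (z $ i) \<noteq> 1}" by (auto simp: c_def split: if_splits)
    then show "{i. c $ i \<noteq> 0} \<union> ?I \<in> K" using z(1) down unfolding Z_iff by blast
    have "norm (?u $ i) \<noteq> 1" if "(c - Re_vec (\<Psi> w)) $ i \<noteq> 0" "z $ i \<noteq> 0" for i
    proof
      assume "norm (?u $ i) = 1"
      then have "ln (exp (Re (\<Psi> w $ i)) * norm (z $ i)) = 0" unfolding nu by simp
      then show False using that by (simp add: c_def ln_mult)
    qed
    moreover have "norm (?u $ i) \<noteq> 1" if "z $ i = 0" for i using that by simp
    ultimately have "{i. (c - Re_vec (\<Psi> w)) $ i \<noteq> 0} \<union> ?I \<subseteq> {i. norm (?u $ i) \<noteq> 1}" by blast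
    then show "{i. (c - Re_vec (\<Psi> w)) $ i \<noteq> 0} \<union> ?I \<in> K" using z(2) down unfolding Z_iff by blast
    show "\<Lambda> c = \<Lambda> (c - Re_vec (\<Psi> w))" by (simp add: Lambda_diff Lambda_Psi)
  qed
  then have "Re_vec (\<Psi> w) = 0" by simp
  then show ?thesis by (intro Psi_Re_zero[OF empty_in_K]) (simp add: vec_eq_iff)
qed

lemma inj_C_orbit: "inj_on (C_orbit \<Psi>) Z"
proof (rule inj_onI)
  fix z u assume zu: "z \<in> Z" "u \<in> Z" "C_orbit \<Psi> z = C_orbit \<Psi> u"
  then obtain w where "z = expv (\<Psi> w) * u" unfolding C_orbit_eq_iff by blast
  then show "z = u" using moment_angle_rep_unique[of u w] zu by (simp add: Psi_0)
qed

definition retr :: "complex^'m \<Rightarrow> complex^'m" where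
  "retr z = inv_into Z (C_orbit \<Psi>) (C_orbit \<Psi> z)"

lemma
  assumes "z \<in> U"
  shows retr_in_Z: "retr z \<in> Z" and C_orbit_retr: "C_orbit \<Psi> (retr z) = C_orbit \<Psi> z"
proof -
  obtain w where "expv (\<Psi> w) * z \<in> Z" using ex_moment_angle_rep[OF assms] by blast
  moreover have "C_orbit \<Psi> (expv (\<Psi> w) * z) = C_orbit \<Psi> z" unfolding C_orbit_eq_iff by blast
  ultimately have "C_orbit \<Psi> z \<in> C_orbit \<Psi> ` Z" by (metis imageI)
  then show "retr z \<in> Z" "C_orbit \<Psi> (retr z) = C_orbit \<Psi> z"
    unfolding retr_def by (simp_all only: inv_into_into f_inv_into_f)
qed

lemma retr_id: "z \<in> Z \<Longrightarrow> retr z = z"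
  unfolding retr_def by (rule inv_into_f_f[OF inj_C_orbit])

lemma retr_eq_iff: "z \<in> U \<Longrightarrow> u \<in> U \<Longrightarrow> retr z = retr u \<longleftrightarrow> C_orbit \<Psi> z = C_orbit \<Psi> u"
  by (metis C_orbit_retr retr_def)

lemma compact_Z: "compact Z"
proof -
  have "closed (\<Union>I\<in>K. {x :: complex^'m. (\<forall>j. x $ j \<in> cball 0 1) \<and>
      (\<forall>j. j \<notin> I \<longrightarrow> x $ j \<in> sphere 0 1)})"
  proof (intro closed_UN ballI finite_K)
    fix I
    show "closed {x :: complex^'m. (\<forall>j. x $ j \<in> cball 0 1) \<and> (\<forall>j. j \<notin> I \<longrightarrow> x $ j \<in> sphere 0 1)}"
      by (simp add: dist_norm) (intro closed_Collect_conj closed_Collect_all closed_Collect_imp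
          closed_Collect_le closed_Collect_eq open_Collect_const continuous_intros)
  qed
  then have "closed Z" unfolding moment_angle_def polyhedral_product_def .
  moreover have "norm z \<le> real CARD('m)" if "z \<in> Z" for z
  proof -
    have "norm z \<le> (\<Sum>i\<in>UNIV. norm (z $ i))" by (simp add: norm_vec_def L2_set_le_sum)
    also have "\<dots> \<le> (\<Sum>i\<in>(UNIV::'m set). 1)" using that unfolding Z_iff by (intro sum_mono) auto
    finally show ?thesis by simp
  qed
  then have "bounded Z" unfolding bounded_iff by blast
  ultimately show ?thesis by (simp add: compact_eq_bounded_closed)
qed

lemma C_orbit_closed:
  assumes zs: "zs \<longlonglongrightarrow> z" "z \<in> U" and us: "us \<longlonglongrightarrow> u" "u \<in> U"
    and eq: "\<And>n::nat. C_orbit \<Psi> (us n) = C_orbit \<Psi> (zs n)"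
  shows "C_orbit \<Psi> u = C_orbit \<Psi> z"
proof -
  have "\<exists>g\<in>C. u = g * z"
    using C_subset_G C_closed zs us
  proof (rule orbit_relation_closed)
    show "\<exists>g\<in>C. us n = g * zs n" for n using eq[of n] unfolding C_orbit_eq_iff using C_iff by blast
  qed
  then obtain g where "g \<in> C" "u = g * z" by blast
  then show ?thesis unfolding C_orbit_eq_iff C_iff by auto
qed

text \<open>A map into a compact space is continuous if its graph is closed, and the graph is closed
  because the relation of lying on the same \<open>C\<close>-orbit is.\<close>

lemma continuous_on_retr: "continuous_on U retr"
proof -
  let ?Gr = "(\<lambda>z. (z, retr z)) ` U"
  have eq: "?Gr = (U \<times> Z) \<inter> closure ?Gr"
  proof (intro equalityI subsetI)
    fix x assume x: "x \<in> (U \<times> Z) \<inter> closure ?Gr"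
    have "x \<in> closure ?Gr" using x by (rule IntD2)
    then obtain xs where xs: "\<forall>n. xs n \<in> ?Gr"
        "xs \<longlonglongrightarrow> x" unfolding closure_sequential by (elim exE conjE)
    from xs(1) have "\<forall>n. \<exists>z. z \<in> U \<and> xs n = (z, retr z)" by (simp add: image_iff Bex_def)
    then obtain zs where zs: "\<And>n. zs n \<in> U" "\<And>n. xs n = (zs n, retr (zs n))" by metis
    obtain z u where zu: "x = (z, u)" "z \<in> U" "u \<in> Z" using x by auto
    have "zs \<longlonglongrightarrow> z" "(\<lambda>n. retr (zs n)) \<longlonglongrightarrow> u"
      using tendsto_fst[OF xs(2)] tendsto_snd[OF xs(2)] by (simp_all add: zs zu)
    then have "C_orbit \<Psi> u = C_orbit \<Psi> z"
      using zu Z_subset_U zs(1) by (intro C_orbit_closed[of zs z "\<lambda>n. retr (zs n)" u]) (auto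
          simp: C_orbit_retr)
    then have "retr z = retr u" using zu Z_subset_U by (simp add: retr_eq_iff subset_iff)
    then have "u = retr z" using zu retr_id by simp
    then show "x \<in> ?Gr" using zu by simp
  qed (use closure_subset retr_in_Z in force)
  have "closedin (top_of_set (U \<times> Z)) ((U \<times> Z) \<inter> closure ?Gr)"
    by (rule closedin_closed_Int) simp
  then have "closedin (top_of_set (U \<times> Z)) ?Gr" by (simp only: eq[symmetric])
  then show ?thesis
    by (rule continuous_closed_graph_eq[OF compact_Z, THEN iffD2, rotated]) (rule funcsetI, erule
        retr_in_Z)
qed

end

section \<open>Charts of the quotients by the holomorphic subgroup\<close>

lemma holo_at_const: "holo_at (\<lambda>z. c) y"
  unfolding holo_at_iff by (simp add: cdiff_at_const)

lemma holo_at_add: "holo_at f y \<Longrightarrow> holo_at g y \<Longrightarrow> holo_at (\<lambda>z. f z + g z) y"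
  unfolding holo_at_iff by (simp add: cdiff_at_add)

lemma holo_at_mult: "holo_at f y \<Longrightarrow> holo_at g y \<Longrightarrow> holo_at (\<lambda>z. f z * g z) y"
  unfolding holo_at_iff by (simp add: cdiff_at_mult)

lemma holo_at_expv: "holo_at f y \<Longrightarrow> holo_at (\<lambda>z. expv (f z)) y"
  unfolding holo_at_iff by (simp add: cdiff_at_exp)

lemma holo_at_linear:
  assumes "Vector_Spaces.linear (*s) (*s) f" "holo_at g y"
  shows "holo_at (\<lambda>z. f (g z)) y"
  using holo_at_compose[OF assms(2) linear_imp_holo_at[OF assms(1)]] by (simp add: o_def)

lemma holo_at_nth: "holo_at f y \<Longrightarrow> cdiff_at (\<lambda>z. f z $ i) y"
  unfolding holo_at_iff by blast

lemma holo_at_ident: "holo_at (\<lambda>z. z) y"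
  unfolding holo_at_iff by (simp add: cdiff_at_nth)

lemma cdiff_at_imp_isCont: "cdiff_at f y \<Longrightarrow> isCont f y"
  unfolding cdiff_at_def using has_derivative_continuous by blast

lemma open_not_nonpos_quotient: "open {z :: complex^'m. \<forall>i\<in>I. z $ i / c i \<notin> \<real>\<^sub>\<le>\<^sub>0}"
proof -
  have "open ((\<lambda>z :: complex^'m. z $ i / c i) -` (- \<real>\<^sub>\<le>\<^sub>0))" for i
    unfolding divide_inverse by (intro open_vimage open_Compl closed_nonpos_Reals_complex
        continuous_intros)
  then have "open (\<Inter>i\<in>I. (\<lambda>z :: complex^'m. z $ i / c i) -` (- \<real>\<^sub>\<le>\<^sub>0))" by (intro open_INT) auto
  moreover have "(\<Inter>i\<in>I. (\<lambda>z :: complex^'m. z $ i / c i) -` (- \<real>\<^sub>\<le>\<^sub>0)) = {z. \<forall>i\<in>I. z $ i / c i \<notin>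
      \<real>\<^sub>\<le>\<^sub>0}" by auto
  ultimately show ?thesis by simp
qed

context toric_data
begin

lemma G_mult: "g \<in> G \<Longrightarrow> h \<in> G \<Longrightarrow> g * h \<in> G"
  unfolding G_fan_def by (simp add: power_int_mult_distrib prod.distrib)

definition vinv :: "complex^'m \<Rightarrow> complex^'m" where "vinv g = (\<chi> i. inverse (g $ i))"

lemma vinv_nth [simp]: "vinv g $ i = inverse (g $ i)" by (simp add: vinv_def)

lemma G_inv: "g \<in> G \<Longrightarrow> vinv g \<in> G"
  unfolding G_fan_def by (simp add: power_int_inverse prod_inversef[unfolded o_def])

lemma G_nonzero: "g \<in> G \<Longrightarrow> g $ i \<noteq> 0"
  unfolding G_fan_def by blast

end

text \<open>A simplex of full size n, with the linear map of \<open>kernel_lift\<close>, is the data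
  for explicit coordinates near all points whose zeros lie in \<open>J\<close>.\<close>

locale toric_chart = toric_data a K \<Psi>
  for a :: "'m::finite \<Rightarrow> int^'n" and K :: "'m set set" and \<Psi> :: "complex^'l \<Rightarrow> complex^'m" +
  fixes J :: "'m set" and T :: "real^'m \<Rightarrow> complex^'l"
  assumes JK: "J \<in> K" and cardJ: "card J = CARD('n)" and linT: "linear T"
    and T_off: "i \<notin> J \<Longrightarrow> Re (\<Psi> (T x) $ i) = x $ i"
begin

definition Im_vec :: "complex^'m \<Rightarrow> real^'m" where "Im_vec x = (\<chi> i. Im (x $ i))"

text \<open>\<open>Pw\<close> and \<open>Pv\<close> are the coordinates of the decomposition of the kernel of the
  complexified \<open>Lambda_R\<close> into the images of \<open>\<Psi>\<close> and \<open>Psibar\<close>.\<close>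
definition Pw :: "complex^'m \<Rightarrow> complex^'l" where
  "Pw x = (1/2) *s (T (Re_vec x) + \<i> *s T (Im_vec x))"

definition Pv :: "complex^'m \<Rightarrow> complex^'l" where
  "Pv x = (1/2) *s cnjv (T (Re_vec x) - \<i> *s T (Im_vec x))"

lemma Re_vec_add: "Re_vec (x + y) = Re_vec x + Re_vec y" by (simp add: vec_eq_iff)
lemma Im_vec_add: "Im_vec (x + y) = Im_vec x + Im_vec y" by (simp add: vec_eq_iff Im_vec_def)
lemma Re_vec_cmult: "Re_vec (c *s x) = Re c *\<^sub>R Re_vec x - Im c *\<^sub>R Im_vec x" by (simp add:
    vec_eq_iff Im_vec_def)
lemma Im_vec_cmult: "Im_vec (c *s x) = Re c *\<^sub>R Im_vec x + Im c *\<^sub>R Re_vec x" by (simp add: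
    vec_eq_iff Im_vec_def)

lemmas linT_simps = linear_add[OF linT] linear_diff[OF linT] linear_scale[OF linT]

lemma linear_Pw: "Vector_Spaces.linear (*s) (*s) Pw"
proof unfold_locales
  show "Pw (x + y) = Pw x + Pw y" for x y
    by (simp add: Pw_def Re_vec_add Im_vec_add linT_simps vec_eq_iff algebra_simps)
  show "Pw (c *s x) = c *s Pw x" for c x
  proof -
    have "T (Re_vec (c *s x)) + \<i> *s T (Im_vec (c *s x)) = c *s (T (Re_vec x) + \<i> *s T (Im_vec x))"
      by (simp add: Re_vec_cmult Im_vec_cmult linT_simps vec_eq_iff complex_eq_iff algebra_simps)
    then show ?thesis by (simp only: Pw_def) (simp add: vec_eq_iff)
  qed
qed

lemma linear_Pv: "Vector_Spaces.linear (*s) (*s) Pv"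
proof unfold_locales
  show "Pv (x + y) = Pv x + Pv y" for x y
    by (simp add: Pv_def Re_vec_add Im_vec_add linT_simps vec_eq_iff algebra_simps)
  show "Pv (c *s x) = c *s Pv x" for c x
  proof -
    have "cnjv (T (Re_vec (c *s x)) - \<i> *s T (Im_vec (c *s x))) = c *s cnjv (T (Re_vec x) - \<i> *s
        T (Im_vec x))"
      by (simp add: Re_vec_cmult Im_vec_cmult linT_simps vec_eq_iff complex_eq_iff algebra_simps)
    then show ?thesis by (simp only: Pv_def) (simp add: vec_eq_iff)
  qed
qed

lemma Pw_0 [simp]: "Pw 0 = 0" and Pv_0 [simp]: "Pv 0 = 0"
  using vec.linear_0[OF linear_Pw] vec.linear_0[OF linear_Pv] by auto

lemma P_off:
  assumes "i \<notin> J"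
  shows "(\<Psi> (Pw x) + Psibar (Pv x)) $ i = x $ i"
proof -
  have "cnjv (Pv x) = (1/2) *s (T (Re_vec x) - \<i> *s T (Im_vec x))"
    by (simp add: Pv_def cnjv_cmult)
  then show ?thesis
    using T_off[OF assms, of "Re_vec x"] T_off[OF assms, of "Im_vec x"]
    by (simp add: Psibar_def Pw_def Psi_add Psi_diff Psi_scale complex_eq_iff Im_vec_def)
qed

text \<open>By \<open>P_off\<close> the two sides agree outside \<open>J\<close> for every
  \<open>x\<close>. On the complexified kernel the difference has real and imaginary parts in the
  kernel of \<Lambda>, supported on the simplex \<open>J\<close>, hence 0.\<close>

lemma P_kernel:
  assumes "\<And>j. (\<Sum>i\<in>UNIV. x $ i * of_int (a i $ j)) = 0"
  shows "\<Psi> (Pw x) + Psibar (Pv x) = x"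
proof -
  define d where "d = \<Psi> (Pw x) + Psibar (Pv x) - x"
  have d: "(\<Sum>i\<in>UNIV. d $ i * of_int (a i $ j)) = 0" for j
    unfolding d_def
    by (simp add: left_diff_distrib distrib_right sum.distrib sum_subtractf assms Lambda_C_Psi
        Lambda_C_Psibar)
  have d_off: "d $ i = 0" if "i \<notin> J" for i
    using P_off[OF that, of x] by (simp add: d_def)
  have "Re_vec d = 0"
  proof (rule kernel_supp[OF JK])
    have "(\<Sum>i\<in>UNIV. Re (d $ i) * of_int (a i $ j)) = 0" for j
      using arg_cong[OF d[of j], of Re] by simp
    then show "\<Lambda> (Re_vec d) = 0" by (simp add: vec_eq_iff Lambda_R_nth)
  qed (use d_off in simp)
  moreover have "Im_vec d = 0"
  proof (rule kernel_supp[OF JK])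
    have "(\<Sum>i\<in>UNIV. Im (d $ i) * of_int (a i $ j)) = 0" for j
      using arg_cong[OF d[of j], of Im] by simp
    then show "\<Lambda> (Im_vec d) = 0" by (simp add: vec_eq_iff Lambda_R_nth Im_vec_def)
  qed (use d_off in \<open>simp add: Im_vec_def\<close>)
  ultimately have "d = 0" by (simp add: vec_eq_iff complex_eq_iff Im_vec_def)
  then show ?thesis by (simp add: d_def)
qed

definition enum :: "'n \<Rightarrow> 'm" where "enum = (SOME e. bij_betw e UNIV J)"

lemma bij_enum: "bij_betw enum UNIV J"
proof -
  have "\<exists>e. bij_betw e (UNIV :: 'n set) J" using cardJ by (intro finite_same_card_bij) auto
  then show ?thesis unfolding enum_def by (rule someI_ex)
qed

lemma enum_in [simp]: "enum k \<in> J" using bij_enum bij_betwE by blast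

lemma J_enum: "i \<in> J \<Longrightarrow> \<exists>k. i = enum k"
  using bij_enum unfolding bij_betw_def by blast

text \<open>An affine n-space in \<open>U\<close> with the coordinates outside \<open>J\<close>
  fixed to 1, which serves as the affine part of the slices for both group actions.\<close>

definition iota :: "complex^'n \<Rightarrow> complex^'m" where
  "iota \<zeta> = (\<chi> i. if i \<in> J then \<zeta> $ inv_into UNIV enum i else 1)"

lemma iota_enum [simp]: "iota \<zeta> $ enum k = \<zeta> $ k"
  using bij_enum by (simp add: iota_def bij_betw_def inv_into_f_f)

lemma iota_off [simp]: "i \<notin> J \<Longrightarrow> iota \<zeta> $ i = 1" by (simp add: iota_def)

lemma vec_eq_J:
  assumes "\<And>k. x $ enum k = y $ enum k" "\<And>i. i \<notin> J \<Longrightarrow> x $ i = y $ i"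
  shows "x = y"
  unfolding vec_eq_iff using assms J_enum by metis

lemma iota_inj: "iota \<zeta> = iota \<xi> \<longleftrightarrow> \<zeta> = \<xi>"
  by (metis iota_enum vec_eq_iff)

lemma holo_at_iota: "holo_at f y \<Longrightarrow> holo_at (\<lambda>z. iota (f z)) y"
  unfolding holo_at_iff
proof
  assume f: "\<forall>i. cdiff_at (\<lambda>z. f z $ i) y"
  fix i show "cdiff_at (\<lambda>z. iota (f z) $ i) y"
    using f by (cases "i \<in> J") (simp_all add: iota_def cdiff_at_const)
qed

definition UJ :: "(complex^'m) set" where "UJ = {z. \<forall>i. i \<notin> J \<longrightarrow> z $ i \<noteq> 0}"

lemma UJ_subset_U: "UJ \<subseteq> U"
proof
  fix z assume "z \<in> UJ"
  then show "z \<in> U" unfolding U_iff UJ_def using down[OF JK, of "{i. z $ i = 0}"] by blast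
qed

text \<open>Every point of \<open>UJ\<close> has the form \<open>F w d\<close>, where
  \<open>w\<close> moves along the orbit, the right half of \<open>d\<close> is the direction
  transverse to it inside \<open>G\<close>, and the left half contains n affine coordinates, which
  may vanish. Only the transverse direction has periods, so only it is confined to a ball.\<close>

lemma chart_U:
  assumes u: "u \<in> UJ"
  shows "\<exists>V \<phi>. qchart U (C_orbit \<Psi>) V (\<phi> :: _ \<Rightarrow> complex^('n + 'l)) \<and> C_orbit \<Psi> u \<in> V"
proof -
  obtain \<epsilon> where \<epsilon>: "\<epsilon> > 0"
    "\<And>I w v. I \<in> K \<Longrightarrow> norm v < \<epsilon> \<Longrightarrow> (\<And>i. i \<notin> I \<Longrightarrow> exp ((\<Psi> w + Psibar v) $ i) = 1) \<Longrightarrow> w = 0 \<and> v = 0"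
    using Psi_Psibar_discrete by metis
  define F :: "complex^'l \<Rightarrow> complex^('n + 'l) \<Rightarrow> complex^'m" where
    "F w d = expv (\<Psi> w + Psibar (vec_right d)) * iota (vec_left d)" for w d
  have F_UJ: "F w d \<in> UJ" for w d by (simp add: F_def UJ_def)
  have F_add: "F (w + w') d = expv (\<Psi> w) * F w' d" for w w' d
    by (simp add: F_def Psi_add expv_add add.assoc mult.assoc)
  have pF: "C_orbit \<Psi> (F w d) = C_orbit \<Psi> (F w' d)" for w w' d
    unfolding C_orbit_eq_iff using F_add[of "w - w'" w' d] by auto
  \<comment> \<open>The affine coordinates left over once the exponential factor has been divided
    out.\<close>
  define coef where "coef y z = (\<chi> k. z $ enum k / exp (y $ enum k))" for y z :: "complex^'m"
  have rep: "z = F w (vec_join (coef (\<Psi> w + Psibar v) z) v)"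
    if "\<And>i. i \<notin> J \<Longrightarrow> z $ i = exp ((\<Psi> w + Psibar v) $ i)" for z w v
    by (rule vec_eq_J) (use that in \<open>auto simp: F_def coef_def\<close>)
  \<comment> \<open>Logarithms exist only off \<open>J\<close>; the value 0 on \<open>J\<close> is a
    filler, since \<open>P_off\<close> speaks of the other coordinates only.\<close>
  define x where "x = (\<chi> i. if i \<in> J then 0 else Ln (u $ i))"
  define d0 where "d0 = vec_join (coef (\<Psi> (Pw x) + Psibar (Pv x)) u) (Pv x)"
  have u_eq: "u = F (Pw x) d0"
    unfolding d0_def
  proof (rule rep)
    fix i assume "i \<notin> J"
    then show "u $ i = exp ((\<Psi> (Pw x) + Psibar (Pv x)) $ i)"
      unfolding P_off[OF \<open>i \<notin> J\<close>] using u by (simp add: x_def UJ_def)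
  qed
  define D :: "(complex^('n + 'l)) set" where "D = vec_right -` ball (Pv x) (\<epsilon> / 2)"
  have D: "open D" unfolding D_def by (intro open_vimage continuous_on_vec_right) auto
  have inj: "d = d'" if d: "d \<in> D" "d' \<in> D" "C_orbit \<Psi> (F w d) = C_orbit \<Psi> (F w' d')" for w w' d d'
  proof -
    obtain w'' where w'': "F w d = F (w'' + w') d'"
      using d(3) unfolding C_orbit_eq_iff F_add by blast
    let ?v = "vec_right d - vec_right d'"
    have "norm ?v < \<epsilon>"
    proof -
      have "dist (Pv x) (vec_right d) < \<epsilon> / 2" "dist (Pv x) (vec_right d') < \<epsilon> / 2"
        using d(1,2) by (auto simp: D_def)
      then have "dist (vec_right d) (vec_right d') < \<epsilon>"
        using dist_triangle_half_r by blast
      then show ?thesis by (simp add: dist_norm)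
    qed
    moreover have "exp ((\<Psi> (w - (w'' + w')) + Psibar ?v) $ i) = 1" if "i \<notin> J" for i
    proof -
      have "exp (\<Psi> w $ i + Psibar (vec_right d) $ i) = exp (\<Psi> (w'' + w') $ i + Psibar (vec_right
          d') $ i)"
        using arg_cong[OF w'', of "\<lambda>z. z $ i"] that by (simp add: F_def)
      then show ?thesis by (simp add: Psi_diff Psibar_diff algebra_simps exp_diff exp_add)
    qed
    ultimately have "w - (w'' + w') = 0" "?v = 0" using \<epsilon>(2)[OF JK] by blast+
    then have eq: "w = w'' + w'" "vec_right d = vec_right d'" by auto
    have "iota (vec_left d) $ i = iota (vec_left d') $ i" for i
      using arg_cong[OF w'', of "\<lambda>z. z $ i"] by (simp add: F_def eq)
    then have "iota (vec_left d) = iota (vec_left d')" unfolding vec_eq_iff by blast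
    then have "vec_left d = vec_left d'" unfolding iota_inj .
    then show "d = d'" using eq(2) by (metis vec_join_left_right)
  qed
  have hF: "holo_on (F w) D" for w
    unfolding F_def
    by (intro holo_on_openI[OF D] holo_at_mult holo_at_expv holo_at_add holo_at_const
        holo_at_linear[OF linear_Psibar] holo_at_iota; simp add: holo_at_iff cdiff_at_nth)
  have "\<exists>\<phi>. qchart U (C_orbit \<Psi>) {C_orbit \<Psi> (F w d) | w d. w \<in> UNIV \<and>
      d \<in> D} (\<phi> :: _ \<Rightarrow> complex^('n + 'l))"
  proof (rule qchart_slice[OF D _ hF])
    show "F w d \<in> U" for w d using F_UJ UJ_subset_U by blast
    show "C_orbit \<Psi> (F w d) = C_orbit \<Psi> (F w' d') \<longleftrightarrow> d = d'" if "d \<in> D" "d' \<in> D" for w w' d d'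
      using that inj pF by blast
    show "\<exists>w'\<in>UNIV. z = F w' d" if "C_orbit \<Psi> z = C_orbit \<Psi> (F w d)" for z w d
      using that unfolding C_orbit_eq_iff by (auto simp: F_add[symmetric])
    show "\<exists>N \<delta>. open N \<and> F w d \<in> N \<and> (\<forall>y\<in>N. holo_at \<delta> y) \<and> \<delta> (F w d) \<in> D \<and>
        (\<forall>u\<in>N \<inter> U. \<delta> u \<in> D \<longrightarrow> C_orbit \<Psi> u = C_orbit \<Psi> (F w (\<delta> u)))" if d: "d \<in> D" for w d
    proof -
      let ?z = "F w d"
      \<comment> \<open>On \<open>N\<close> the ratios to the base point avoid the cut of the
        principal logarithm. Hence \<open>L\<close> is holomorphic there, and it vanishes at the
        base point, where \<open>\<delta>\<close> therefore returns \<open>d\<close>.\<close>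
      define N where "N = {z :: complex^'m. \<forall>i\<in>-J. z $ i / ?z $ i \<notin> \<real>\<^sub>\<le>\<^sub>0}"
      define L :: "complex^'m \<Rightarrow> complex^'m" where "L z = (\<chi> i. if i \<in> J then 0 else Ln (z $ i /
          ?z $ i))" for z
      define E where "E z = \<Psi> (w + Pw (L z)) + Psibar (vec_right d + Pv (L z))" for z
      define \<delta> where "\<delta> z = vec_join (coef (E z) z) (vec_right d + Pv (L z))" for z
      have nz: "?z $ i \<noteq> 0" if "i \<notin> J" for i using F_UJ[of w d] that by (simp add: UJ_def)
      have hL: "holo_at L y" if "y \<in> N" for y
        unfolding holo_at_iff L_def
      proof
        fix i show "cdiff_at (\<lambda>z. (\<chi> i. if i \<in> J then 0 else Ln (z $ i / ?z $ i)) $ i) y"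
          using that nz[of i] by (cases "i \<in> J")
            (auto simp: N_def intro!: cdiff_at_const cdiff_at_Ln cdiff_at_divide cdiff_at_nth)
      qed
      have hE: "holo_at E y" if "y \<in> N" for y
        unfolding E_def using hL[OF that]
        by (intro holo_at_add holo_at_linear[OF lin] holo_at_linear[OF linear_Psibar] holo_at_const
            holo_at_linear[OF linear_Pw] holo_at_linear[OF linear_Pv])
      have h\<delta>: "holo_at \<delta> y" if "y \<in> N" for y
        unfolding \<delta>_def
      proof (intro holo_at_vec_join holo_at_add holo_at_const holo_at_linear[OF linear_Pv] hL[OF
          that])
        show "holo_at (\<lambda>z. coef (E z) z) y"
          unfolding holo_at_iff coef_def using holo_at_nth[OF hE[OF that]]
          by (auto intro!: cdiff_at_divide cdiff_at_nth cdiff_at_exp)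
      qed
      have rep_N: "z = F (w + Pw (L z)) (\<delta> z)" if "z \<in> N" for z
        unfolding \<delta>_def E_def
      proof (rule rep)
        fix i assume i: "i \<notin> J"
        then have "z $ i / ?z $ i \<notin> \<real>\<^sub>\<le>\<^sub>0" using that unfolding N_def by blast
        then have "z $ i / ?z $ i \<noteq> 0" by (metis nonpos_Reals_zero_I)
        then have "exp (L z $ i) = z $ i / ?z $ i" using i by (simp add: L_def)
        moreover have "exp ((\<Psi> (w + Pw (L z)) + Psibar (vec_right d + Pv (L z))) $ i) =
            exp ((\<Psi> w + Psibar (vec_right d)) $ i) * exp ((\<Psi> (Pw (L z)) + Psibar (Pv (L z))) $ i)"
          by (simp add: Psi_add Psibar_add exp_add)
        moreover have "exp ((\<Psi> w + Psibar (vec_right d)) $ i) = ?z $ i" using i by (simp add: F_def)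
        ultimately show "z $ i = exp ((\<Psi> (w + Pw (L z)) + Psibar (vec_right d + Pv (L z))) $ i)"
          unfolding P_off[OF i] using nz[OF i] by simp
      qed
      have "L ?z = 0" using nz by (simp add: L_def vec_eq_iff)
      then have "\<delta> ?z = d"
      proof -
        have "coef (\<Psi> w + Psibar (vec_right d)) ?z = vec_left d"
          by (simp add: coef_def F_def vec_eq_iff)
        then show ?thesis using \<open>L ?z = 0\<close> by (simp add: \<delta>_def E_def)
      qed
      show ?thesis
      proof (intro exI conjI ballI impI)
        show "open N" unfolding N_def by (rule open_not_nonpos_quotient)
        show "?z \<in> N" using nz by (simp add: N_def)
        show "holo_at \<delta> y" if "y \<in> N" for y using h\<delta>[OF that] .
        show "\<delta> ?z \<in> D" using \<open>\<delta> ?z = d\<close> d by simp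
        fix z assume "z \<in> N \<inter> U"
        then show "C_orbit \<Psi> z = C_orbit \<Psi> (F w (\<delta> z))" using rep_N[of z] pF by (metis IntD1)
      qed
    qed
  qed
  then obtain \<phi> :: "(complex^'m) set \<Rightarrow> complex^('n + 'l)" where
    "qchart U (C_orbit \<Psi>) {C_orbit \<Psi> (F w d) | w d. w \<in> UNIV \<and> d \<in> D} \<phi>" by blast
  moreover have "d0 \<in> D" using \<epsilon>(1) by (simp add: D_def d0_def)
  then have "C_orbit \<Psi> u \<in> {C_orbit \<Psi> (F w d) | w d. w \<in> UNIV \<and> d \<in> D}" using u_eq by blast
  ultimately show ?thesis by blast
qed

text \<open>Near \<open>g0\<close> the principal logarithm of the ratio \<open>g / g0\<close> lies
  in the complexified kernel of \<Lambda>, so \<open>P_kernel\<close> splits it. The part along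
  \<open>C\<close> need not be recorded; \<open>\<delta>\<close> is the other part.\<close>

lemma G_local_log:
  assumes g0: "g0 \<in> G"
  obtains N \<delta> where "open N" "g0 \<in> N" "\<And>y. y \<in> N \<Longrightarrow> holo_at \<delta> y" "\<delta> g0 = 0"
    "\<And>g. g \<in> N \<Longrightarrow> g \<in> G \<Longrightarrow> \<exists>w. g = expv (\<Psi> w + Psibar (\<delta> g)) * g0"
proof -
  note nz = G_nonzero[OF g0]
  define L :: "complex^'m \<Rightarrow> complex^'m" where "L z = (\<chi> i. Ln (z $ i / g0 $ i))" for z
  define O1 where "O1 = {z :: complex^'m. \<forall>i\<in>UNIV. z $ i / g0 $ i \<notin> \<real>\<^sub>\<le>\<^sub>0}"
  have oO1: "open O1" unfolding O1_def by (rule open_not_nonpos_quotient)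
  have hL: "holo_at L y" if "y \<in> O1" for y
    unfolding holo_at_iff L_def using that nz
    by (auto simp: O1_def intro!: cdiff_at_Ln cdiff_at_divide cdiff_at_nth cdiff_at_const)
  define h :: "'n \<Rightarrow> complex^'m \<Rightarrow> complex" where "h j z = (\<Sum>i\<in>UNIV. L z $ i * of_int (a i $ j))"
      for j z
  \<comment> \<open>On \<open>G\<close> the sums \<open>h j\<close> are integral multiples of 2 pi
    i, because their exponentials are 1. Absolute value below 2 pi leaves only 0.\<close>
  define N where "N = O1 \<inter> (\<Inter>j. h j -` ball 0 (2 * pi) \<inter> O1)"
  have "continuous_on O1 (h j)" for j
  proof (rule continuous_at_imp_continuous_on, intro ballI cdiff_at_imp_isCont)
    fix y assume "y \<in> O1"
    then show "cdiff_at (h j) y" unfolding h_def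
      by (intro cdiff_at_sum cdiff_at_mult cdiff_at_const holo_at_nth hL)
  qed
  then have "open (h j -` ball 0 (2 * pi) \<inter> O1)" for j
    using continuous_on_open_vimage[OF oO1] by blast
  then have "open N" unfolding N_def by (intro open_Int oO1 open_INT) auto
  have L0: "L g0 = 0" using nz by (simp add: L_def vec_eq_iff)
  show thesis
  proof (rule that[of N "\<lambda>z. Pv (L z)"])
    show "open N" by fact
    show "g0 \<in> N" using nz L0 by (simp add: N_def O1_def h_def)
    show "holo_at (\<lambda>z. Pv (L z)) y" if "y \<in> N" for y
      using that by (intro holo_at_linear[OF linear_Pv] hL) (simp add: N_def)
    show "Pv (L g0) = 0" using L0 by simp
    fix g assume g: "g \<in> N" "g \<in> G"
    have eL: "exp (L g $ i) = g $ i / g0 $ i" for i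
      using g nz G_nonzero[OF g(2)] by (simp add: L_def)
    have "(\<Sum>i\<in>UNIV. L g $ i * of_int (a i $ j)) = 0" for j
    proof -
      have "exp (h j g) = (\<Prod>i\<in>UNIV. exp (L g $ i) powi (a i $ j))"
        unfolding h_def by (simp add: exp_sum exp_power_int mult.commute)
      also have "\<dots> = (\<Prod>i\<in>UNIV. (g * vinv g0) $ i powi (a i $ j))"
        by (simp add: eL divide_inverse)
      also have "\<dots> = 1" using G_mult[OF g(2) G_inv[OF g0]] unfolding G_fan_def by simp
      finally have "Re (h j g) = 0 \<and> (\<exists>n::int. Im (h j g) = of_int (2 * n) * pi)" unfolding
          exp_eq_1 .
      then obtain n :: int where n: "Re (h j g) = 0" "Im (h j g) = of_int (2 * n) * pi" by blast
      have "norm (h j g) < 2 * pi" using g(1) by (simp add: N_def)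
      then have "\<bar>Im (h j g)\<bar> < 2 * pi" using abs_Im_le_cmod[of "h j g"] by linarith
      then have "\<bar>real_of_int n\<bar> * (2 * pi) < 1 * (2 * pi)" unfolding n(2) by (simp add: abs_mult)
      then have "\<bar>real_of_int n\<bar> < 1" by simp
      then have "n = 0" by linarith
      then have "h j g = 0" using n by (simp add: complex_eq_iff)
      then show ?thesis by (simp add: h_def)
    qed
    then have "\<Psi> (Pw (L g)) + Psibar (Pv (L g)) = L g" by (rule P_kernel)
    then have "g = expv (\<Psi> (Pw (L g)) + Psibar (Pv (L g))) * g0"
      using nz eL by (simp add: vec_eq_iff)
    then show "\<exists>w. g = expv (\<Psi> w + Psibar (Pv (L g))) * g0" by blast
  qed
qed

text \<open>As in \<open>chart_U\<close>, but without affine coordinates: the slice consists of the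
  translates of \<open>g0\<close> in the direction of \<open>Psibar\<close>, and
  \<open>G_local_log\<close> supplies the coordinate function.\<close>

lemma chart_G:
  assumes g0: "g0 \<in> G"
  shows "\<exists>V \<phi>. qchart G (C_orbit \<Psi>) V (\<phi> :: _ \<Rightarrow> complex^'l) \<and> C_orbit \<Psi> g0 \<in> V"
proof -
  obtain \<epsilon> where \<epsilon>: "\<epsilon> > 0"
    "\<And>I w v. I \<in> K \<Longrightarrow> norm v < \<epsilon> \<Longrightarrow> (\<And>i. i \<notin> I \<Longrightarrow> exp ((\<Psi> w + Psibar v) $ i) = 1) \<Longrightarrow> w = 0 \<and> v = 0"
    using Psi_Psibar_discrete by metis
  define F where "F w v = expv (\<Psi> w + Psibar v) * g0" for w v
  have F_add: "F (w + w') v = expv (\<Psi> w) * F w' v" for w w' v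
    by (simp add: F_def Psi_add expv_add add.assoc mult.assoc)
  have pF: "C_orbit \<Psi> (F w d) = C_orbit \<Psi> (F w' d)" for w w' d
    unfolding C_orbit_eq_iff using F_add[of "w - w'" w' d] by auto
  have FG: "F w v \<in> G" for w v
    unfolding F_def
    by (intro G_mult g0 expv_in_G) (simp add: distrib_right sum.distrib Lambda_C_Psi
        Lambda_C_Psibar)
  define D :: "(complex^'l) set" where "D = ball 0 (\<epsilon> / 2)"
  have D: "open D" by (simp add: D_def)
  have inj: "d = d'" if d: "d \<in> D" "d' \<in> D" "C_orbit \<Psi> (F w d) = C_orbit \<Psi> (F w' d')" for w w' d d'
  proof -
    obtain w'' where w'': "F w d = F (w'' + w') d'"
      using d(3) unfolding C_orbit_eq_iff F_add by blast
    have "norm (d - d') < \<epsilon>"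
      using dist_triangle_half_r[of 0 d \<epsilon> d'] d(1,2) by (simp add: D_def dist_norm)
    moreover have "exp ((\<Psi> (w - (w'' + w')) + Psibar (d - d')) $ i) = 1" for i
    proof -
      have "exp (\<Psi> w $ i + Psibar d $ i) = exp (\<Psi> (w'' + w') $ i + Psibar d' $ i)"
        using arg_cong[OF w'', of "\<lambda>z. z $ i"] G_nonzero[OF g0] by (simp add: F_def)
      then show ?thesis by (simp add: Psi_diff Psibar_diff algebra_simps exp_diff exp_add)
    qed
    ultimately have "d - d' = 0" using \<epsilon>(2)[OF JK] by blast
    then show "d = d'" by simp
  qed
  have hF: "holo_on (F w) D" for w
    unfolding F_def
    by (intro holo_on_openI[OF D] holo_at_mult holo_at_expv holo_at_add holo_at_const
        holo_at_linear[OF linear_Psibar] holo_at_ident)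
  have "\<exists>\<phi>. qchart G (C_orbit \<Psi>) {C_orbit \<Psi> (F w d) | w d. w \<in> UNIV \<and> d \<in> D} (\<phi> :: _ \<Rightarrow> complex^'l)"
  proof (rule qchart_slice[OF D _ hF])
    show "F w d \<in> G" for w d by (rule FG)
    show "C_orbit \<Psi> (F w d) = C_orbit \<Psi> (F w' d') \<longleftrightarrow> d = d'" if "d \<in> D" "d' \<in> D" for w w' d d'
      using that inj pF by blast
    show "\<exists>w'\<in>UNIV. z = F w' d" if "C_orbit \<Psi> z = C_orbit \<Psi> (F w d)" for z w d
      using that unfolding C_orbit_eq_iff by (auto simp: F_add[symmetric])
    show "\<exists>N \<delta>. open N \<and> F w d \<in> N \<and> (\<forall>y\<in>N. holo_at \<delta> y) \<and> \<delta> (F w d) \<in> D \<and>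
        (\<forall>u\<in>N \<inter> G. \<delta> u \<in> D \<longrightarrow> C_orbit \<Psi> u = C_orbit \<Psi> (F w (\<delta> u)))" if d: "d \<in> D" for w d
    proof -
      obtain N \<delta> where N: "open N" "F w d \<in> N" "\<And>y. y \<in> N \<Longrightarrow> holo_at \<delta> y" "\<delta> (F w d) = 0"
        "\<And>g. g \<in> N \<Longrightarrow> g \<in> G \<Longrightarrow> \<exists>w'. g = expv (\<Psi> w' + Psibar (\<delta> g)) * F w d"
        using G_local_log[OF FG] by metis
      show ?thesis
      proof (intro exI conjI ballI impI)
        show "holo_at (\<lambda>z. d + \<delta> z) y" if "y \<in> N" for y
          using N(3)[OF that] by (intro holo_at_add holo_at_const)
        fix g assume "g \<in> N \<inter> G"
        then obtain w' where g: "g = expv (\<Psi> w' + Psibar (\<delta> g)) * F w d" using N(5) by blast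
        also have "\<dots> = F (w' + w) (d + \<delta> g)"
          by (simp add: F_def Psi_add Psibar_add expv_add mult_ac)
        finally show "C_orbit \<Psi> g = C_orbit \<Psi> (F w (d + \<delta> g))" using pF by metis
      qed (use N d in auto)
    qed
  qed
  then obtain \<phi> :: "(complex^'m) set \<Rightarrow> complex^'l" where
    "qchart G (C_orbit \<Psi>) {C_orbit \<Psi> (F w d) | w d. w \<in> UNIV \<and> d \<in> D} \<phi>" by blast
  moreover have "0 \<in> D" "g0 = F 0 0" using \<epsilon>(1) by (auto simp: D_def F_def Psi_0 Psibar_0)
  then have "C_orbit \<Psi> g0 \<in> {C_orbit \<Psi> (F w d) | w d. w \<in> UNIV \<and> d \<in> D}" by blast
  ultimately show ?thesis by blast
qed

end

section \<open>The quotient group and its action on the moment-angle manifold\<close>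

lemma quotient_maps_homeomorphic:
  assumes f: "quotient_map X Y f" and g: "quotient_map X Z g"
    and eq: "\<And>x y. x \<in> topspace X \<Longrightarrow> y \<in> topspace X \<Longrightarrow> f x = f y \<longleftrightarrow> g x = g y"
  shows "\<exists>h. homeomorphic_map Y Z h \<and> (\<forall>x\<in>topspace X. h (f x) = g x)"
proof -
  obtain h where h: "continuous_map Y Z h" "\<And>x. x \<in> topspace X \<Longrightarrow> h (f x) = g x"
    using quotient_map_lift_exists[OF f quotient_imp_continuous_map[OF g]] eq by metis
  obtain k where k: "continuous_map Z Y k" "\<And>x. x \<in> topspace X \<Longrightarrow> k (g x) = f x"
    using quotient_map_lift_exists[OF g quotient_imp_continuous_map[OF f]] eq by metis
  have "\<forall>y\<in>topspace Y. k (h y) = y"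
  proof
    fix y assume "y \<in> topspace Y"
    then obtain x where "x \<in> topspace X" "y = f x" using quotient_imp_surjective_map[OF f] by blast
    then show "k (h y) = y" using h(2) k(2) by simp
  qed
  moreover have "\<forall>z\<in>topspace Z. h (k z) = z"
  proof
    fix z assume "z \<in> topspace Z"
    then obtain x where "x \<in> topspace X" "z = g x" using quotient_imp_surjective_map[OF g] by blast
    then show "h (k z) = z" using h(2) k(2) by simp
  qed
  ultimately have "homeomorphic_maps Y Z h k" unfolding homeomorphic_maps_def using h(1) k(1) by
      blast
  then show ?thesis using h(2) homeomorphic_map_maps by blast
qed

text \<open>Meant for passing from the orbit space to the moment-angle manifold: \<open>p\<close> is
  the orbit map, \<open>p'\<close> the retraction, and \<open>j\<close> the map from points to
  orbits. Sections of \<open>p\<close> are sections of \<open>p'\<close> as they stand.\<close>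

lemma qchart_transfer:
  assumes q: "qchart S p V \<phi>" and VW: "\<And>u. u \<in> S \<Longrightarrow> p' u \<in> V' \<longleftrightarrow> p u \<in> V"
    and j: "\<And>u. u \<in> S \<Longrightarrow> j (p' u) = p u" and V': "V' \<subseteq> p' ` S" and inj: "inj_on j V'"
  shows "qchart S p' V' (\<phi> \<circ> j)"
  unfolding qchart_def
proof (intro conjI V' ballI impI)
  have eq: "{u \<in> S. p' u \<in> V'} = {u \<in> S. p u \<in> V}" using VW by auto
  show "openin (top_of_set S) {u \<in> S. p' u \<in> V'}" unfolding eq by (rule qchartD(2)[OF q])
  show "holo_on (\<phi> \<circ> j \<circ> p') {u \<in> S. p' u \<in> V'}"
    unfolding eq by (rule holo_on_cong[OF qchartD(3)[OF q]]) (simp add: j)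
  have "j ` V' \<subseteq> V" using V' VW j by fastforce
  then show "inj_on (\<phi> \<circ> j) V'" using inj qchartD(4)[OF q] by (metis comp_inj_on inj_on_subset)
  fix u assume u: "u \<in> S" "p' u \<in> V'"
  then have u': "p u \<in> V" using VW by blast
  obtain W s where W: "open W" "\<phi> (p u) \<in> W" "holo_on s W" "s (\<phi> (p u)) = u"
    "\<And>w. w \<in> W \<Longrightarrow> s w \<in> S" "\<And>w. w \<in> W \<Longrightarrow> p (s w) \<in> V" "\<And>w. w \<in> W \<Longrightarrow> \<phi> (p (s w)) = w"
    using qchart_section[OF q u(1) u'] by metis
  show "\<exists>W s. open W \<and> (\<phi> \<circ> j) (p' u) \<in> W \<and> holo_on s W \<and> s ((\<phi> \<circ> j) (p' u)) = u \<and>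
        (\<forall>w\<in>W. s w \<in> S \<and> p' (s w) \<in> V' \<and> (\<phi> \<circ> j) (p' (s w)) = w)"
    using W u j VW by (intro exI[of _ W] exI[of _ s]) simp
qed

context toric_data
begin

lemma ex_toric_chart:
  assumes "I \<in> K"
  obtains J T where "toric_chart a K \<Psi> J T" "I \<subseteq> J"
proof -
  obtain J where J: "J \<in> K" "I \<subseteq> J" "card J = CARD('n)" using pure[OF assms] by metis
  obtain T where T: "linear T" "\<And>x i. i \<notin> J \<Longrightarrow> Re (\<Psi> (T x) $ i) = x $ i"
    using kernel_lift[OF J(1,3)] by metis
  have "toric_chart a K \<Psi> J T"
    by (intro toric_chart.intro toric_data_axioms toric_chart_axioms.intro J T)
  then show thesis using J(2) that by blast
qed

lemma ex_toric_chart_UJ: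
  assumes "u \<in> U"
  obtains J T where "toric_chart a K \<Psi> J T" "u \<in> toric_chart.UJ J"
proof -
  obtain J T where JT: "toric_chart a K \<Psi> J T" "{i. u $ i = 0} \<subseteq> J"
    using ex_toric_chart assms U_iff by metis
  then have "u \<in> toric_chart.UJ J" unfolding toric_chart.UJ_def[OF JT(1)] by blast
  then show thesis using JT that by blast
qed

section \<open>The quotient group as a complex Lie group\<close>

lemma G_1: "1 \<in> G" by (simp add: G_fan_def)

lemma G_subset_U: "G \<subseteq> U"
proof
  fix g assume "g \<in> G"
  then have "{i. g $ i = 0} = {}" using G_nonzero by blast
  then show "g \<in> U" unfolding U_iff using empty_in_K by simp
qed

lemma G_act_U: "g \<in> G \<Longrightarrow> z \<in> U \<Longrightarrow> g * z \<in> U"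
  unfolding U_iff using G_nonzero by simp

lemma expv_Psi_in_G: "expv (\<Psi> w) \<in> G"
  by (rule expv_in_G[OF Lambda_C_Psi])

lemma mult_group_simps [simp]: "carrier (mult_group S) = S" "mult (mult_group S) = (*)"
    "one (mult_group S) = 1"
  by (simp_all add: mult_group_def)

lemma vinv_mult: "g \<in> G \<Longrightarrow> vinv g * g = 1" "g \<in> G \<Longrightarrow> g * vinv g = 1"
  using G_nonzero by (auto simp: vec_eq_iff)

lemma comm_group_G: "comm_group (mult_group G)"
proof (rule comm_groupI)
  show "\<exists>y\<in>carrier (mult_group G). y \<otimes>\<^bsub>mult_group G\<^esub> x = \<one>\<^bsub>mult_group G\<^esub>" if "x \<in> carrier
      (mult_group G)" for x
    using that G_inv vinv_mult by auto
qed (auto simp: G_mult G_1 mult.assoc mult.commute)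

lemma inv_G: "g \<in> G \<Longrightarrow> inv\<^bsub>mult_group G\<^esub> g = vinv g"
  using group.inv_equality[OF comm_group.axioms(2)[OF comm_group_G], of "vinv g" g] G_inv
      vinv_mult by simp

lemma subgroup_C: "subgroup C (mult_group G)"
proof
  show "C \<subseteq> carrier (mult_group G)" using C_subset_G by simp
  fix x y assume "x \<in> C" "y \<in> C"
  then obtain v w where vw: "x = expv (\<Psi> v)" "y = expv (\<Psi> w)" unfolding C_iff by blast
  have "x * y = expv (\<Psi> (v + w))" by (simp add: vw Psi_add expv_add)
  then show "x \<otimes>\<^bsub>mult_group G\<^esub> y \<in> C" unfolding C_iff by auto
next
  have "1 = expv (\<Psi> 0)" by (simp add: Psi_0)
  then show "\<one>\<^bsub>mult_group G\<^esub> \<in> C" unfolding C_iff by auto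
next
  fix x assume x: "x \<in> C"
  then obtain v where v: "x = expv (\<Psi> v)" unfolding C_iff by blast
  have "vinv x = expv (\<Psi> (- v))"
    using vec.linear_neg[OF lin] by (simp add: v vec_eq_iff exp_minus)
  moreover have "inv\<^bsub>mult_group G\<^esub> x = vinv x" using inv_G x C_subset_G by blast
  ultimately show "inv\<^bsub>mult_group G\<^esub> x \<in> C" unfolding C_iff by metis
qed

lemma normal_C: "C \<lhd> mult_group G"
  by (rule comm_group.subgroup_imp_normal[OF comm_group_G subgroup_C])

text \<open>Cosets in the group and orbits in \<open>U\<close> are formed by the same
  multiplication, so the one projection \<open>C_orbit \<Psi>\<close> serves for both
  quotients.\<close>

lemma r_coset_C: "r_coset (mult_group S) C = C_orbit \<Psi>"
  by (rule ext) (auto simp: r_coset_def C_orbit_def orbit_def)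

abbreviation "H \<equiv> GC_group a \<Psi>"

lemma group_H: "group H"
  unfolding GC_group_def by (rule normal.factorgroup_is_group[OF normal_C])

lemma carrier_H: "carrier H = C_orbit \<Psi> ` G"
  unfolding GC_group_def by (simp add: carrier_FactGroup r_coset_C)

lemma mult_H: "g \<in> G \<Longrightarrow> h \<in> G \<Longrightarrow> C_orbit \<Psi> g \<otimes>\<^bsub>H\<^esub> C_orbit \<Psi> h = C_orbit \<Psi> (g * h)"
  using normal.rcos_sum[OF normal_C, of g h] unfolding GC_group_def by (simp add: r_coset_C)

lemma one_H: "\<one>\<^bsub>H\<^esub> = C_orbit \<Psi> 1"
  unfolding GC_group_def by (auto simp: C_orbit_def orbit_def)

lemma inv_H: "g \<in> G \<Longrightarrow> inv\<^bsub>H\<^esub> (C_orbit \<Psi> g) = C_orbit \<Psi> (vinv g)"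
  by (rule group.inv_equality[OF group_H]) (auto simp: mult_H G_inv vinv_mult one_H carrier_H)

abbreviation "TH \<equiv> GC_topology a \<Psi>"
abbreviation "AH \<equiv> GC_atlas a \<Psi> :: (_, 'l) chart set"

lemma quot_mfd_GC: "quot_mfd TH AH G (C_orbit \<Psi>)"
  unfolding GC_topology_def GC_atlas_def r_coset_C
proof (rule quot_mfd_quotient_atlas)
  fix g assume g: "g \<in> G"
  obtain J T where "toric_chart a K \<Psi> J T" using ex_toric_chart[OF empty_in_K] by metis
  then show "\<exists>V \<phi>. qchart G (C_orbit \<Psi>) V (\<phi> :: _ \<Rightarrow> complex^'l) \<and> C_orbit \<Psi> g \<in> V"
    by (rule toric_chart.chart_G[OF _ g])
qed

lemma Hausdorff_GC: "Hausdorff_space TH"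
proof (rule quot_mfd_Hausdorff[OF quot_mfd_GC])
  fix xs ys x y
  assume "xs \<longlonglongrightarrow> x" "ys \<longlonglongrightarrow> y" "x \<in> G" "y \<in> G" "\<And>n::nat. C_orbit \<Psi> (xs n) = C_orbit \<Psi> (ys n)"
  then show "C_orbit \<Psi> x = C_orbit \<Psi> y" using G_subset_U by (intro C_orbit_closed[of ys y xs x])
      auto
qed

text \<open>Coordinatewise multiplication is the lift both of the multiplication of the quotient
  group and of its action on the moment-angle manifold.\<close>

lemma holo_on_vec_prod_mult: "holo_on (\<lambda>u. vec_left u * vec_right u) S"
proof (rule holo_on_subset[OF holo_on_openI[OF open_UNIV] subset_UNIV])
  show "holo_at (\<lambda>u. vec_left u * vec_right u) y" for y
    by (intro holo_at_mult) (simp_all add: holo_at_iff cdiff_at_nth)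
qed

lemma complex_lie_group_GC: "complex_lie_group H TH AH"
  unfolding complex_lie_group_def
proof (intro conjI)
  show "group H" by (rule group_H)
  show "topspace TH = carrier H" using quot_mfd_topspace[OF quot_mfd_GC] carrier_H by simp
  show "complex_manifold TH AH"
    by (rule complex_manifold_quot_mfd[OF quot_mfd_GC Hausdorff_GC])
  show "holomorphic_map (prod_topology TH TH)
     (prod_atlas AH AH) TH AH
     (\<lambda>(x, y). x \<otimes>\<^bsub>H\<^esub> y)"
    by (rule holomorphic_map_lift[OF quot_mfd_prod_atlas[OF quot_mfd_GC quot_mfd_GC] quot_mfd_GC
        holo_on_vec_prod_mult])
      (simp add: vec_prod_def pair_map_def mult_H G_mult)
  show "holomorphic_map TH AH TH AH (m_inv H)"
  proof (rule holomorphic_map_lift[OF quot_mfd_GC quot_mfd_GC])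
    show "holo_on vinv G"
      unfolding holo_on_iff
    proof
      fix g assume g: "g \<in> G"
      have "open (\<Inter>i. (\<lambda>z :: complex^'m. z $ i) -` (- {0}))"
        by (intro open_INT ballI open_vimage continuous_intros) auto
      then show "holo_near vinv G g"
        by (rule holo_nearI[of _ g _ vinv])
          (use g G_nonzero in \<open>auto simp: holo_at_iff intro!: cdiff_at_inverse cdiff_at_nth\<close>)
    qed
    show "vinv g \<in> G \<and> C_orbit \<Psi> (vinv g) = inv\<^bsub>H\<^esub> C_orbit \<Psi> g" if "g \<in> G" for g
      using that by (simp add: inv_H G_inv)
  qed
qed

section \<open>The moment-angle manifold and the action on it\<close>

abbreviation "AZ \<equiv> pullback_atlas Z (C_orbit \<Psi>) (quotient_atlas U (C_orbit \<Psi>)) :: (_, 'n + 'l)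
    chart set"

text \<open>The moment-angle manifold is regarded as the quotient of \<open>U\<close> by the retraction onto it
  along the orbits.\<close>
lemma quot_mfd_Z: "quot_mfd (top_of_set Z) AZ U retr"
  unfolding quot_mfd_def
proof (intro conjI ballI)
  have "retraction_maps (top_of_set U) (top_of_set Z) retr (\<lambda>z. z)"
    unfolding retraction_maps_def using continuous_on_retr retr_in_Z Z_subset_U retr_id by auto
  then show "quotient_map (top_of_set U) (top_of_set Z) retr"
    using retraction_imp_quotient_map unfolding retraction_map_def by blast
next
  fix c assume "c \<in> AZ"
  then obtain V \<phi> where c: "qchart U (C_orbit \<Psi>) V \<phi>"
      "c = ({z \<in> Z. C_orbit \<Psi> z \<in> V}, \<phi> \<circ> C_orbit \<Psi>)"
    unfolding pullback_atlas_def by (auto simp: mem_quotient_atlas_iff)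
  have "qchart U retr {z \<in> Z. C_orbit \<Psi> z \<in> V} (\<phi> \<circ> C_orbit \<Psi>)"
  proof (rule qchart_transfer[OF c(1)])
    show "{z \<in> Z. C_orbit \<Psi> z \<in> V} \<subseteq> retr ` U"
    proof
      fix z assume "z \<in> {z \<in> Z. C_orbit \<Psi> z \<in> V}"
      then show "z \<in> retr ` U" using retr_id[of z] Z_subset_U by (intro image_eqI[of _ _ z]) auto
    qed
    show "inj_on (C_orbit \<Psi>) {z \<in> Z. C_orbit \<Psi> z \<in> V}"
      using inj_C_orbit by (rule inj_on_subset) auto
  qed (auto simp: C_orbit_retr retr_in_Z)
  then show "case c of (V, \<phi>) \<Rightarrow> qchart U retr V \<phi>" using c(2) by simp
next
  show "\<Union>(fst ` AZ) = topspace (top_of_set Z)"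
  proof (intro equalityI subsetI)
    fix z assume "z \<in> topspace (top_of_set Z)"
    then have z: "z \<in> Z" by simp
    then obtain J T where JT: "toric_chart a K \<Psi> J T" "z \<in> toric_chart.UJ J"
      using ex_toric_chart_UJ Z_subset_U by blast
    obtain V and \<phi> :: "_ \<Rightarrow> complex^('n + 'l)" where V: "(V, \<phi>) \<in> quotient_atlas U (C_orbit \<Psi>)"
        "C_orbit \<Psi> z \<in> V"
      using toric_chart.chart_U[OF JT] by (auto simp: mem_quotient_atlas_iff)
    have "({z \<in> Z. C_orbit \<Psi> z \<in> V}, \<phi> \<circ> C_orbit \<Psi>) \<in> AZ"
      unfolding pullback_atlas_def using V(1) by force
    then show "z \<in> \<Union>(fst ` AZ)" using z V(2) by force
  qed (auto simp: pullback_atlas_def)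
qed

text \<open>This is \<open>GC_action\<close> with an arbitrary complex \<open>K\<close> in place of
  the complex of a fan.\<close>

definition act :: "(complex^'m) set \<Rightarrow> complex^'m \<Rightarrow> complex^'m" where
  "act \<gamma> = (\<lambda>z\<in>Z. inv_into Z (C_orbit \<Psi>) {g * u | g u. g \<in> \<gamma> \<and> u \<in> C_orbit \<Psi> z})"

text \<open>As \<open>C\<close> is a group and multiplication is commutative, the product of the
  orbits of \<open>g\<close> and \<open>z\<close> is the orbit of \<open>g * z\<close>. The action
  is thus multiplication followed by the retraction, which is the form in which it can be
  lifted.\<close>

lemma act_eq:
  assumes "z \<in> Z"
  shows "act (C_orbit \<Psi> g) z = retr (g * z)"
proof -
  have "{h * u | h u. h \<in> C_orbit \<Psi> g \<and> u \<in> C_orbit \<Psi> z} = C_orbit \<Psi> (g * z)"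
  proof (intro equalityI subsetI)
    fix x assume "x \<in> {h * u | h u. h \<in> C_orbit \<Psi> g \<and> u \<in> C_orbit \<Psi> z}"
    then obtain v w where "x = (expv (\<Psi> v) * g) * (expv (\<Psi> w) * z)" unfolding C_orbit_eq by blast
    then have "x = expv (\<Psi> (v + w)) * (g * z)" by (simp add: Psi_add expv_add mult_ac)
    then show "x \<in> C_orbit \<Psi> (g * z)" unfolding C_orbit_eq by blast
  next
    fix x assume "x \<in> C_orbit \<Psi> (g * z)"
    then obtain v where "x = (expv (\<Psi> v) * g) * (expv (\<Psi> 0) * z)"
      unfolding C_orbit_eq by (auto simp: Psi_0 mult.assoc)
    then show "x \<in> {h * u | h u. h \<in> C_orbit \<Psi> g \<and> u \<in> C_orbit \<Psi> z}" unfolding C_orbit_eq by blast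
  qed
  then show ?thesis using assms by (simp add: act_def retr_def)
qed

lemma retr_eqI: "z = expv (\<Psi> w) * u \<Longrightarrow> retr z = retr u"
  unfolding retr_def using C_orbit_eq_iff by metis

lemma retr_rep:
  assumes "z \<in> U"
  obtains w where "retr z = expv (\<Psi> w) * z"
  using C_orbit_retr[OF assms] unfolding C_orbit_eq_iff by blast

lemma retr_mult_retr: "z \<in> U \<Longrightarrow> retr (g * retr z) = retr (g * z)"
  by (metis retr_rep retr_eqI mult.left_commute)

lemma act_retr: "z \<in> U \<Longrightarrow> act (C_orbit \<Psi> g) (retr z) = retr (g * z)"
  by (simp add: act_eq retr_in_Z retr_mult_retr)

lemma act_in_Z: "g \<in> G \<Longrightarrow> z \<in> Z \<Longrightarrow> act (C_orbit \<Psi> g) z \<in> Z"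
  using act_eq retr_in_Z G_act_U Z_subset_U by auto

lemma act_mult:
  assumes "g \<in> G" "h \<in> G" "z \<in> Z"
  shows "act (C_orbit \<Psi> g \<otimes>\<^bsub>H\<^esub> C_orbit \<Psi> h) z = act (C_orbit \<Psi> g) (act (C_orbit \<Psi> h) z)"
proof -
  have "act (C_orbit \<Psi> g) (act (C_orbit \<Psi> h) z) = retr (g * (h * z))"
    using assms Z_subset_U by (simp add: act_eq[of z] act_retr G_act_U subset_iff)
  then show ?thesis using assms by (simp add: mult_H act_eq mult.assoc)
qed

lemma act_one: "z \<in> Z \<Longrightarrow> act (C_orbit \<Psi> 1) z = z"
  by (simp add: act_eq retr_id)

lemma act_Bij:
  assumes g: "g \<in> G"
  shows "act (C_orbit \<Psi> g) \<in> Bij Z"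
proof -
  have "bij_betw (act (C_orbit \<Psi> g)) Z Z"
  proof (rule bij_betw_byWitness[where f' = "act (C_orbit \<Psi> (vinv g))"])
    show "\<forall>z\<in>Z. act (C_orbit \<Psi> (vinv g)) (act (C_orbit \<Psi> g) z) = z"
      using g act_one by (simp add: act_mult[symmetric] mult_H G_inv vinv_mult)
    show "\<forall>z\<in>Z. act (C_orbit \<Psi> g) (act (C_orbit \<Psi> (vinv g)) z) = z"
      using g act_one by (simp add: act_mult[symmetric] mult_H G_inv vinv_mult)
  qed (use g act_in_Z G_inv in auto)
  then show ?thesis unfolding Bij_def act_def by simp
qed

lemma group_action_H: "group_action H Z act"
proof (intro group_action.intro group_hom.intro group_hom_axioms.intro group_H group_BijGroup)
  show "act \<in> hom H (BijGroup Z)"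
    unfolding hom_def
  proof (intro CollectI conjI ballI)
    show "act \<in> carrier H \<rightarrow> carrier (BijGroup Z)"
      by (auto simp: carrier_H BijGroup_def act_Bij)
    fix x y assume "x \<in> carrier H" "y \<in> carrier H"
    then obtain g h where gh: "g \<in> G" "h \<in> G" "x = C_orbit \<Psi> g" "y = C_orbit \<Psi> h"
      unfolding carrier_H by blast
    have "act (x \<otimes>\<^bsub>H\<^esub> y) = compose Z (act x) (act y)"
    proof
      fix z show "act (x \<otimes>\<^bsub>H\<^esub> y) z = compose Z (act x) (act y) z"
        by (cases "z \<in> Z") (simp_all add: gh act_mult compose_def, simp add: act_def)
    qed
    then show "act (x \<otimes>\<^bsub>H\<^esub> y) = act x \<otimes>\<^bsub>BijGroup Z\<^esub> act y"
      by (simp add: BijGroup_def gh act_Bij)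
  qed
qed

lemma complex_manifold_Z: "complex_manifold (top_of_set Z) AZ"
  by (rule complex_manifold_quot_mfd[OF quot_mfd_Z]) (simp add: Hausdorff_space_subtopology)

lemma holomorphic_action_Z:
  "holomorphic_action H TH AH (top_of_set Z) AZ act"
  unfolding holomorphic_action_def
proof (intro conjI complex_lie_group_GC complex_manifold_Z)
  show "group_action H (topspace (top_of_set Z)) act" using group_action_H by simp
  show "holomorphic_map (prod_topology TH (top_of_set Z))
     (prod_atlas AH AZ) (top_of_set Z) AZ (\<lambda>(h, x). act h x)"
    by (rule holomorphic_map_lift[OF quot_mfd_prod_atlas[OF quot_mfd_GC quot_mfd_Z] quot_mfd_Z
        holo_on_vec_prod_mult])
      (simp add: vec_prod_def pair_map_def act_retr G_act_U)
qed

section \<open>The toric variety as a quotient of the moment-angle manifold\<close>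

abbreviation "p \<equiv> toric_proj a"

lemma p_eq_iff: "p z = p u \<longleftrightarrow> (\<exists>g\<in>G. z = g * u)"
proof
  assume "p z = p u"
  moreover have "z \<in> p z" using G_1 by (force simp: toric_proj_def orbit_def)
  ultimately show "\<exists>g\<in>G. z = g * u" by (auto simp: toric_proj_def orbit_def)
next
  assume "\<exists>g\<in>G. z = g * u"
  then obtain g where g: "g \<in> G" "z = g * u" by blast
  have "u = vinv g * z" using g vinv_mult(1)[OF g(1)] by (simp add: mult.assoc[symmetric])
  then have "h * u = (h * vinv g) * z" "h * z = (h * g) * u" for h using g by (simp_all add:
      mult.assoc)
  then show "p z = p u" using g(1) G_mult G_inv unfolding toric_proj_def orbit_def by fastforce
qed

lemma p_retr: "z \<in> U \<Longrightarrow> p (retr z) = p z"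
  unfolding p_eq_iff using retr_rep expv_Psi_in_G by metis

lemma orbit_act:
  assumes "z \<in> Z"
  shows "orbit H act z = (\<lambda>g. retr (g * z)) ` G"
proof -
  have "orbit H act z = (\<lambda>\<gamma>. act \<gamma> z) ` C_orbit \<Psi> ` G" by (auto simp: orbit_def carrier_H)
  then show ?thesis by (simp add: image_image act_eq[OF assms])
qed

text \<open>An orbit of the quotient group on the moment-angle manifold is the retraction of a
  \<open>G\<close>-orbit, and the retraction moves points only within their \<open>G\<close>-orbits,
  because \<open>C\<close> is contained in \<open>G\<close>.\<close>

lemma orbit_act_eq_iff:
  assumes z: "z \<in> Z" "u \<in> Z"
  shows "orbit H act z = orbit H act u \<longleftrightarrow> p z = p u"
proof
  assume "orbit H act z = orbit H act u"
  moreover have "z \<in> orbit H act z" unfolding orbit_act[OF z(1)]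
    using retr_id[OF z(1)] G_1 by (intro image_eqI[of _ _ 1]) auto
  ultimately obtain g where g: "g \<in> G" "z = retr (g * u)" unfolding orbit_act[OF z(2)] by blast
  have "p z = p (g * u)" using g z(2) Z_subset_U G_act_U p_retr by auto
  also have "\<dots> = p u" unfolding p_eq_iff using g(1) by blast
  finally show "p z = p u" .
next
  have sub: "orbit H act z \<subseteq> orbit H act u" if zu: "z \<in> Z" "u \<in> Z" "p z = p u" for z u
  proof
    fix x assume "x \<in> orbit H act z"
    then obtain g where g: "g \<in> G" "x = retr (g * z)" unfolding orbit_act[OF zu(1)] by blast
    obtain h where h: "h \<in> G" "z = h * u" using zu(3) unfolding p_eq_iff by blast
    then show "x \<in> orbit H act u"
      unfolding orbit_act[OF zu(2)] using g G_mult by (intro image_eqI[of _ _ "g * h"]) (auto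
          simp: mult.assoc)
  qed
  assume "p z = p u"
  then show "orbit H act z = orbit H act u" using sub z by (metis subset_antisym)
qed

text \<open>Both spaces are quotients of the moment-angle manifold with the same fibres. That
  \<open>p\<close> remains a quotient map after restriction follows from
  \<open>p \<circ> retr = p\<close> on \<open>U\<close> and the continuity of the
  retraction.\<close>

lemma quotient_homeomorphism:
  "\<exists>h. homeomorphic_map (quotient_topology (top_of_set Z) (orbit H act)) (quotient_topology
      (top_of_set U) p) h \<and>
     (\<forall>z\<in>Z. h (orbit H act z) = p z)"
proof -
  let ?X = "quotient_topology (top_of_set U) p"
  have qp: "quotient_map (top_of_set U) ?X p" by (rule quotient_map_quotient_topology)
  have "quotient_map (top_of_set Z) ?X p"
  proof (rule quotient_map_from_composition)
    show "continuous_map (top_of_set U) (top_of_set Z) retr"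
      using continuous_on_retr retr_in_Z by auto
    show "continuous_map (top_of_set Z) ?X p"
      using continuous_map_from_subtopology[OF quotient_imp_continuous_map[OF qp], of Z] Z_subset_U
      by (simp add: subtopology_subtopology Int_absorb1)
    show "quotient_map (top_of_set U) ?X (p \<circ> retr)"
      by (rule quotient_map_eq[OF qp]) (simp add: p_retr)
  qed
  from quotient_maps_homeomorphic[OF quotient_map_quotient_topology this, of "orbit H act"] show
      ?thesis
    using orbit_act_eq_iff by simp
qed

end

section \<open>The principal bundle over a regular toric variety\<close>

text \<open>The condition \<open>dual\<close> makes the vectors \<open>a i\<close> with
  \<open>i \<in> J\<close> a basis of the integral vectors, with \<open>b\<close> as dual
  basis.\<close>

locale regular_toric_chart = toric_chart a K \<Psi> J T
  for a :: "'m::finite \<Rightarrow> int^'n" and K :: "'m set set" and \<Psi> :: "complex^'l \<Rightarrow> complex^'m"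
    and J :: "'m set" and T :: "real^'m \<Rightarrow> complex^'l" +
  fixes b :: "'m \<Rightarrow> int^'n"
  assumes dual: "y $ j = (\<Sum>i\<in>J. (\<Sum>k\<in>UNIV. b i $ k * y $ k) * a i $ j)"
begin

definition pair :: "'m \<Rightarrow> int^'n \<Rightarrow> int" where "pair i y = (\<Sum>k\<in>UNIV. b i $ k * y $ k)"

lemma dual_pair: "(\<Sum>i\<in>J. pair i y * a i $ j) = y $ j"
  unfolding pair_def by (rule dual[symmetric])

lemma dual_pair_complex: "(\<Sum>i\<in>J. of_int (pair i y) * of_int (a i $ j) :: complex) = of_int (y $ j)"
  using arg_cong[OF dual_pair[of y j], of complex_of_int] by simp

text \<open>The linear relation expressing \<open>a l\<close> through the basis \<open>a i\<close>,
  \<open>i \<in> J\<close>, read as an integral vector in the kernel of \<Lambda>. For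
  \<open>l\<close> outside \<open>J\<close> these relations form an integral basis of the integral
  points of the kernel.\<close>

definition tvec :: "'m \<Rightarrow> real^'m" where
  "tvec l = (\<chi> i. (if i = l then 1 else 0) - (if i \<in> J then of_int (pair i (a l)) else 0))"

lemma tvec_off: "i \<notin> J \<Longrightarrow> tvec l $ i = (if i = l then 1 else 0)"
  by (simp add: tvec_def)

lemma Lambda_tvec: "\<Lambda> (tvec l) = 0"
proof -
  have "\<Lambda> (tvec l) $ j = of_int (a l $ j) - of_int (\<Sum>i\<in>J. pair i (a l) * a i $ j)" for j
  proof -
    have "(\<Sum>i\<in>UNIV. (if i = l then 1 else 0) * real_of_int (a i $ j)) = of_int (a l $ j)"
      by (simp add: if_distrib[of "\<lambda>c. c * _"] sum.delta cong: if_cong)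
    moreover have "(\<Sum>i\<in>UNIV. (if i \<in> J then of_int (pair i (a l)) else 0) * real_of_int (a i $ j)) =
        of_int (\<Sum>i\<in>J. pair i (a l) * a i $ j)"
      unfolding of_int_sum by (rule sum.mono_neutral_cong_right) auto
    ultimately show ?thesis by (simp add: Lambda_R_nth tvec_def left_diff_distrib sum_subtractf)
  qed
  then show ?thesis by (simp add: vec_eq_iff dual_pair)
qed

text \<open>For \<open>l \<in> J\<close> the relation \<open>tvec l\<close> is supported on the
  simplex \<open>J\<close>, so it is trivial.\<close>

lemma pair_delta:
  assumes "i \<in> J" "l \<in> J"
  shows "pair i (a l) = (if i = l then 1 else 0)"
proof -
  have "tvec l = 0" using assms(2) by (intro kernel_supp[OF JK Lambda_tvec]) (auto simp: tvec_off)
  then have "tvec l $ i = 0" by simp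
  then show ?thesis using assms(1) by (auto simp: tvec_def split: if_splits)
qed

lemma sum_UNIV_split: "(\<Sum>i\<in>UNIV. f i) = (\<Sum>i\<in>J. f i) + (\<Sum>i\<in>-J. f i)" for f :: "'m \<Rightarrow> complex"
  using sum.subset_diff[of J UNIV f] by (simp add: Compl_eq_Diff_UNIV add.commute)

text \<open>\<open>gam z\<close> is the unique element of \<open>G\<close> with the coordinates of \<open>z\<close> outside \<open>J\<close>.\<close>
definition gam :: "complex^'m \<Rightarrow> complex^'m" where
  "gam z = (\<chi> i. if i \<in> J then (\<Prod>k\<in>-J. (z $ k) powi (- pair i (a k))) else z $ i)"

text \<open>The invariant affine coordinates: dividing by the element \<open>gam z\<close> of
  \<open>G\<close> moves \<open>z\<close> into the slice \<open>iota\<close>, where its n remaining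
  coordinates are read off.\<close>

definition qJ :: "complex^'m \<Rightarrow> complex^'n" where
  "qJ z = (\<chi> k. z $ enum k / gam z $ enum k)"

lemma gam_off [simp]: "i \<notin> J \<Longrightarrow> gam z $ i = z $ i" by (simp add: gam_def)

lemma gam_mult: "gam (z * u) = gam z * gam u"
  by (auto simp: vec_eq_iff gam_def power_int_mult_distrib prod.distrib)

lemma gam_nonzero: "z \<in> UJ \<Longrightarrow> gam z $ i \<noteq> 0"
  by (auto simp: gam_def UJ_def)

lemma gam_expv:
  assumes "\<And>i. i \<notin> J \<Longrightarrow> z $ i = exp (l $ i)"
  shows "gam z = expv (\<chi> i. if i \<in> J then - (\<Sum>k\<in>-J. of_int (pair i (a k)) * l $ k) else l $ i)"
proof -
  have "(\<Prod>k\<in>-J. (z $ k) powi (- pair i (a k))) = exp (- (\<Sum>k\<in>-J. of_int (pair i (a k)) * l $ k))"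
      for i
  proof -
    have "(\<Prod>k\<in>-J. (z $ k) powi (- pair i (a k))) = (\<Prod>k\<in>-J. exp (- (of_int (pair i (a k)) * l $ k)))"
      using assms by (intro prod.cong) (simp_all add: exp_power_int)
    also have "\<dots> = exp (- (\<Sum>k\<in>-J. of_int (pair i (a k)) * l $ k))"
      by (simp add: exp_sum flip: sum_negf)
    finally show ?thesis .
  qed
  then show ?thesis using assms by (simp add: vec_eq_iff gam_def)
qed

text \<open>After choosing logarithms outside \<open>J\<close>, the exponents on \<open>J\<close>
  are those that cancel the other terms in each sum over the generators, by
  \<open>dual_pair\<close>. The exponent vector is therefore in the complexified kernel of
  \<Lambda>.\<close>

lemma gam_in_G:
  assumes z: "z \<in> UJ"
  shows "gam z \<in> G"
proof -
  define l where "l = (\<chi> i. Ln (z $ i))"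
  define x where "x = (\<chi> i. if i \<in> J then - (\<Sum>k\<in>-J. of_int (pair i (a k)) * l $ k) else l $ i)"
  have "gam z = expv x" unfolding x_def
    by (rule gam_expv) (use z in \<open>simp add: l_def UJ_def\<close>)
  moreover have "(\<Sum>i\<in>UNIV. x $ i * of_int (a i $ j)) = 0" for j
  proof -
    have "(\<Sum>i\<in>J. x $ i * of_int (a i $ j)) = - (\<Sum>i\<in>J. \<Sum>k\<in>-J. of_int (pair i (a k)) * l $ k *
        of_int (a i $ j))"
      by (simp add: x_def sum_distrib_right sum_negf)
    also have "\<dots> = - (\<Sum>k\<in>-J. l $ k * (\<Sum>i\<in>J. of_int (pair i (a k)) * of_int (a i $ j)))"
      by (subst sum.swap) (simp add: sum_distrib_left mult_ac)
    also have "\<dots> = - (\<Sum>k\<in>-J. x $ k * of_int (a k $ j))"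
      by (simp add: dual_pair_complex x_def)
    finally show ?thesis unfolding sum_UNIV_split by simp
  qed
  ultimately show ?thesis using expv_in_G by simp
qed

text \<open>For fixed \<open>i\<close>, the character with exponents \<open>pair i (a k)\<close> is
  an integral combination of the equations defining \<open>G\<close>, hence trivial on
  \<open>G\<close>. By \<open>pair_delta\<close> its only factor inside \<open>J\<close> is
  coordinate \<open>i\<close>, which is thus expressed by the coordinates outside
  \<open>J\<close>.\<close>

lemma gam_G:
  assumes g: "g \<in> G"
  shows "gam g = g"
proof (rule vec_eq_iff[THEN iffD2, OF allI])
  fix i
  define l where "l = (\<chi> i. Ln (g $ i))"
  have l: "g $ i = exp (l $ i)" for i using G_nonzero[OF g] by (simp add: l_def)
  show "gam g $ i = g $ i"
  proof (cases "i \<in> J")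
    case True
    have 1: "exp (\<Sum>k\<in>UNIV. l $ k * of_int (a k $ j)) = 1" for j
    proof -
      have "(\<Prod>k\<in>UNIV. (g $ k) powi (a k $ j)) = 1" using g unfolding G_fan_def by blast
      then show ?thesis by (simp add: l exp_power_int exp_sum mult.commute)
    qed
    have "(\<Sum>k\<in>UNIV. of_int (pair i (a k)) * l $ k) = (\<Sum>k\<in>UNIV. \<Sum>j\<in>UNIV. of_int (b i $ j) * (l $ k
        * of_int (a k $ j)))"
      by (simp add: pair_def sum_distrib_right sum_distrib_left mult_ac)
    also have "\<dots> = (\<Sum>j\<in>UNIV. of_int (b i $ j) * (\<Sum>k\<in>UNIV. l $ k * of_int (a k $ j)))"
      by (subst sum.swap) (simp add: sum_distrib_left)
    finally have "exp (\<Sum>k\<in>UNIV. of_int (pair i (a k)) * l $ k) =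
        exp (\<Sum>j\<in>UNIV. of_int (b i $ j) * (\<Sum>k\<in>UNIV. l $ k * of_int (a k $ j)))" by (rule arg_cong)
    also have "\<dots> = (\<Prod>j\<in>UNIV. exp (\<Sum>k\<in>UNIV. l $ k * of_int (a k $ j)) powi (b i $ j))"
      unfolding exp_power_int by (rule exp_sum) simp
    finally have "exp (\<Sum>k\<in>UNIV. of_int (pair i (a k)) * l $ k) =
        (\<Prod>j\<in>UNIV. exp (\<Sum>k\<in>UNIV. l $ k * of_int (a k $ j)) powi (b i $ j))" .
    then have "exp (\<Sum>k\<in>UNIV. of_int (pair i (a k)) * l $ k) = 1" by (simp add: 1)
    moreover have "(\<Sum>k\<in>J. of_int (pair i (a k)) * l $ k) = l $ i"
    proof -
      have "(\<Sum>k\<in>J. of_int (pair i (a k)) * l $ k) = (\<Sum>k\<in>J. if k = i then l $ k else 0)"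
        by (rule sum.cong) (auto simp: pair_delta True)
      then show ?thesis using True by (simp add: sum.delta)
    qed
    ultimately have "exp (l $ i + (\<Sum>k\<in>-J. of_int (pair i (a k)) * l $ k)) = 1"
      unfolding sum_UNIV_split by simp
    then have "exp (- (\<Sum>k\<in>-J. of_int (pair i (a k)) * l $ k)) = exp (l $ i)"
      by (simp add: exp_add exp_minus field_simps)
    moreover have "gam g $ i = exp (- (\<Sum>k\<in>-J. of_int (pair i (a k)) * l $ k))"
      using gam_expv[of g l] l True by simp
    ultimately show ?thesis by (simp add: l)
  qed simp
qed

lemma gam_iota: "gam (iota \<zeta>) = 1"
  by (auto simp: vec_eq_iff gam_def)

lemma iota_UJ: "iota \<zeta> \<in> UJ" by (simp add: UJ_def)

lemma G_act_UJ: "g \<in> G \<Longrightarrow> z \<in> UJ \<Longrightarrow> g * z \<in> UJ"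
  using G_nonzero by (auto simp: UJ_def)

lemma gam_iota_qJ: "z \<in> UJ \<Longrightarrow> gam z * iota (qJ z) = z"
  using gam_nonzero by (intro vec_eq_J) (auto simp: qJ_def)

lemma qJ_act: "g \<in> G \<Longrightarrow> qJ (g * z) = qJ z"
  using G_nonzero by (auto simp: qJ_def vec_eq_iff gam_mult gam_G)

lemma qJ_iota: "qJ (iota \<zeta>) = \<zeta>"
  by (simp add: qJ_def vec_eq_iff gam_iota)

lemma p_eq_UJ:
  assumes "z \<in> UJ" "u \<in> UJ"
  shows "p z = p u \<longleftrightarrow> qJ z = qJ u"
proof
  assume "p z = p u" then show "qJ z = qJ u" unfolding p_eq_iff using qJ_act by blast
next
  assume q: "qJ z = qJ u"
  have *: "p v = p (iota (qJ v))" if v: "v \<in> UJ" for v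
    unfolding p_eq_iff by (rule bexI[OF _ gam_in_G[OF v]]) (rule gam_iota_qJ[OF v, symmetric])
  have "p z = p (iota (qJ z))" by (rule *[OF assms(1)])
  also have "\<dots> = p u" unfolding q by (rule *[OF assms(2), symmetric])
  finally show "p z = p u" .
qed

lemma UJ_saturated: "p z = p u \<Longrightarrow> u \<in> UJ \<Longrightarrow> z \<in> UJ"
  unfolding p_eq_iff using G_act_UJ by blast

lemma open_UJ: "open UJ"
proof -
  have "open (\<Inter>i\<in>-J. (\<lambda>z :: complex^'m. z $ i) -` (- {0}))"
    by (intro open_INT ballI open_vimage continuous_intros) auto
  moreover have "(\<Inter>i\<in>-J. (\<lambda>z :: complex^'m. z $ i) -` (- {0})) = UJ" by (auto simp: UJ_def)
  ultimately show ?thesis by simp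
qed

lemma holo_at_gam: "y \<in> UJ \<Longrightarrow> holo_at gam y"
  unfolding holo_at_iff
proof
  fix i assume "y \<in> UJ"
  then show "cdiff_at (\<lambda>z. gam z $ i) y"
    unfolding gam_def UJ_def
    by (cases "i \<in> J") (auto intro!: cdiff_at_prod cdiff_at_powi cdiff_at_nth)
qed

lemma holo_at_qJ: "y \<in> UJ \<Longrightarrow> holo_at qJ y"
  unfolding holo_at_iff qJ_def
  by (auto intro!: cdiff_at_divide cdiff_at_nth holo_at_nth holo_at_gam gam_nonzero)

text \<open>\<open>UJ\<close> is the product of \<open>G\<close> and an affine n-space by
  \<open>gam_iota_qJ\<close>. All translates of the slice \<open>iota\<close> give the same
  coordinates, namely \<open>qJ\<close>, and no shrinking of the parameter domain is needed.\<close>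

lemma chart_X: "\<exists>\<phi>. qchart U p (p ` UJ) (\<phi> :: _ \<Rightarrow> complex^'n)"
proof -
  let ?F = "\<lambda>g \<zeta>. g * iota \<zeta>"
  have pF: "p (?F g \<zeta>) = p (iota \<zeta>)" if "g \<in> G" for g \<zeta> unfolding p_eq_iff using that by blast
  have FU: "?F g \<zeta> \<in> UJ" if "g \<in> G" for g \<zeta> using that G_act_UJ iota_UJ by blast
  have "\<exists>\<phi>. qchart U p {p (?F g \<zeta>) | g \<zeta>. g \<in> G \<and> \<zeta> \<in> UNIV} (\<phi> :: _ \<Rightarrow> complex^'n)"
  proof (rule qchart_slice[OF open_UNIV])
    show "?F g \<zeta> \<in> U" if "g \<in> G" for g \<zeta> using FU[OF that] UJ_subset_U by blast
    show "holo_on (?F g) UNIV" for g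
      by (intro holo_on_openI holo_at_mult holo_at_const holo_at_iota holo_at_ident) simp
    show "p (?F g \<zeta>) = p (?F g' \<zeta>') \<longleftrightarrow> \<zeta> = \<zeta>'" if "g \<in> G" "g' \<in> G" for g g' \<zeta> \<zeta>'
      using that by (simp add: pF p_eq_UJ iota_UJ qJ_iota)
    show "\<exists>g'\<in>G. u = ?F g' \<zeta>" if "g \<in> G" "p u = p (?F g \<zeta>)" for u g \<zeta>
      using that unfolding pF[OF that(1)] p_eq_iff by blast
    show "\<exists>N \<delta>. open N \<and> ?F g \<zeta> \<in> N \<and> (\<forall>y\<in>N. holo_at \<delta> y) \<and> \<delta> (?F g \<zeta>) \<in> UNIV \<and>
        (\<forall>u\<in>N \<inter> U. \<delta> u \<in> UNIV \<longrightarrow> p u = p (?F g (\<delta> u)))" if "g \<in> G" for g \<zeta>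
      using open_UJ FU[OF that] holo_at_qJ pF[OF that]
      by (intro exI[of _ UJ] exI[of _ qJ]) (auto simp: p_eq_UJ iota_UJ qJ_iota)
  qed
  moreover have "{p (?F g \<zeta>) | g \<zeta>. g \<in> G \<and> \<zeta> \<in> UNIV} = p ` UJ"
  proof (intro equalityI subsetI)
    fix x assume "x \<in> p ` UJ"
    then obtain z where "z \<in> UJ" "x = p z" by blast
    then show "x \<in> {p (?F g \<zeta>) | g \<zeta>. g \<in> G \<and> \<zeta> \<in> UNIV}"
      using gam_iota_qJ gam_in_G by (metis (mono_tags, lifting) UNIV_I mem_Collect_eq)
  qed (use FU in blast)
  ultimately show ?thesis by simp
qed

text \<open>Since \<open>gam\<close> is multiplicative and the identity on \<open>G\<close>, it
  splits \<open>UJ\<close> equivariantly; modulo \<open>C\<close> it provides the fibre coordinate.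
  The inverse starts from the slice point over \<open>x\<close> and moves it by the group. That the
  charts cover all of the base is assumed, because a single simplex cannot show it.\<close>

lemma local_trivialization:
  defines "X \<equiv> quotient_topology (top_of_set U) p"
    and "AX \<equiv> quotient_atlas U p :: (_, 'n) chart set"
    and "V \<equiv> p ` UJ"
  assumes QX: "quot_mfd X AX U p"
  obtains \<tau> where "openin X V"
    "biholomorphic_map
       (prod_topology (subtopology X V) TH) (prod_atlas (sub_atlas AX V) AH)
       (subtopology (top_of_set Z) {e \<in> Z. p e \<in> V}) (sub_atlas AZ {e \<in> Z. p e \<in> V}) \<tau>"
    "\<And>x h. x \<in> V \<Longrightarrow> h \<in> carrier H \<Longrightarrow> p (\<tau> (x, h)) = x"
    "\<And>x h g. x \<in> V \<Longrightarrow> h \<in> carrier H \<Longrightarrow> g \<in> carrier H \<Longrightarrow> \<tau> (x, g \<otimes>\<^bsub>H\<^esub> h) = act g (\<tau> (x, h))"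
proof -
  let ?VZ = "{e \<in> Z. p e \<in> V}"
  let ?XH = "prod_topology (subtopology X V) TH" and ?AXH = "prod_atlas (sub_atlas AX V) AH"
  let ?ZV = "subtopology (top_of_set Z) ?VZ" and ?AZV = "sub_atlas AZ ?VZ"
  have mem_V: "p u \<in> V \<longleftrightarrow> u \<in> UJ" for u unfolding V_def using UJ_saturated by blast
  have preV: "{u \<in> U. p u \<in> V} = UJ" using mem_V UJ_subset_U by blast
  have preVZ: "{u \<in> U. retr u \<in> ?VZ} = UJ"
  proof -
    have "{u \<in> U. retr u \<in> ?VZ} = {u \<in> U. p u \<in> V}" using p_retr retr_in_Z by auto
    then show ?thesis unfolding preV .
  qed
  have oUJ: "openin (top_of_set U) UJ" using open_UJ UJ_subset_U by (auto simp: open_subset)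
  have oV: "openin X V" unfolding quot_mfd_openin[OF QX] preV using oUJ UJ_subset_U by (auto
      simp: V_def)
  have oVZ: "openin (top_of_set Z) ?VZ"
    unfolding quot_mfd_openin[OF quot_mfd_Z] preVZ using oUJ UJ_subset_U quot_mfd_topspace[OF
        quot_mfd_Z] by auto
  have QV: "quot_mfd (subtopology X V) (sub_atlas AX V) UJ p"
    using quot_mfd_sub_atlas[OF QX oV] unfolding preV .
  have QVZ: "quot_mfd ?ZV ?AZV UJ retr"
    using quot_mfd_sub_atlas[OF quot_mfd_Z oVZ] unfolding preVZ .
  note QP = quot_mfd_prod_atlas[OF QV quot_mfd_GC]
  \<comment> \<open>The representative of the orbit is arbitrary, but \<open>qJ\<close> is
    invariant, so the slice point does not depend on it.\<close>
  define \<xi> where "\<xi> x = iota (qJ (SOME u. u \<in> x))" for x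
  have xi: "\<xi> (p u) = iota (qJ u)" if "u \<in> UJ" for u
  proof -
    have "u \<in> p u" using G_1 by (force simp: toric_proj_def orbit_def)
    then have "(SOME v. v \<in> p u) \<in> p u" by (rule someI)
    then obtain g where "g \<in> G" "(SOME v. v \<in> p u) = g * u" by (auto simp: toric_proj_def orbit_def)
    then show ?thesis by (simp add: \<xi>_def qJ_act)
  qed
  \<comment> \<open>The slice point is not on the moment-angle manifold in general and has to be
    retracted before the group can act on it. Lifted to \<open>UJ\<close>, the retraction disappears
    and only multiplication remains.\<close>
  define \<tau> where "\<tau> = (\<lambda>(x, h). act h (retr (\<xi> x)))"
  define \<sigma> where "\<sigma> z = (p z, C_orbit \<Psi> (gam z))" for z
  have iota_U: "iota \<zeta> \<in> U" for \<zeta> using iota_UJ UJ_subset_U by blast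
  have tau: "\<tau> (p u, C_orbit \<Psi> g) = retr (g * iota (qJ u))" if "u \<in> UJ" for u g
    using that by (simp add: \<tau>_def xi act_retr iota_U)
  have ph: "p (\<tau> (x, h)) = x" if xh: "x \<in> V" "h \<in> carrier H" for x h
  proof -
    obtain u g where u: "u \<in> UJ" "x = p u" "g \<in> G" "h = C_orbit \<Psi> g"
      using xh unfolding V_def carrier_H by blast
    have "p (\<tau> (x, h)) = p (g * iota (qJ u))" using u by (simp add: tau p_retr G_act_U iota_U)
    also have "\<dots> = x" using u G_act_UJ iota_UJ by (simp add: p_eq_UJ qJ_act qJ_iota)
    finally show ?thesis .
  qed
  have "biholomorphic_map ?XH ?AXH ?ZV ?AZV \<tau>"
    unfolding biholomorphic_map_def
  proof (intro exI[of _ \<sigma>] conjI)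
    show h\<tau>: "holomorphic_map ?XH ?AXH ?ZV ?AZV \<tau>"
    proof (rule holomorphic_map_lift[OF QP QVZ])
      let ?N = "vec_left -` UJ :: (complex^('m + 'm)) set"
      let ?f = "\<lambda>u :: complex^('m + 'm). vec_right u * iota (qJ (vec_left u))"
      have oN: "open ?N" by (intro open_vimage open_UJ continuous_on_vec_left)
      have "holo_at (\<lambda>u. qJ (vec_left u)) y" if "y \<in> ?N" for y
      proof -
        have "holo_at vec_left y" by (simp add: holo_at_iff cdiff_at_nth)
        from holo_at_compose[OF this, of qJ] holo_at_qJ that show ?thesis by (simp add: o_def)
      qed
      then have "holo_at ?f y" if "y \<in> ?N" for y
        using that by (intro holo_at_mult holo_at_iota) (simp_all add: holo_at_iff cdiff_at_nth)
      then show "holo_on ?f (vec_prod UJ G)"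
        by (intro holo_on_subset[OF holo_on_openI[OF oN]]) (auto simp: vec_prod_def)
      show "?f u \<in> UJ \<and> retr (?f u) = \<tau> (pair_map p (C_orbit \<Psi>) u)" if "u \<in> vec_prod UJ G" for u
        using that by (simp add: vec_prod_def pair_map_def tau G_act_UJ iota_UJ)
    qed
    show h\<sigma>: "holomorphic_map ?ZV ?AZV ?XH ?AXH \<sigma>"
    proof (rule holomorphic_map_lift[OF QVZ QP])
      let ?f = "\<lambda>z. vec_join z (gam z)"
      show "holo_on ?f UJ"
        by (intro holo_on_openI[OF open_UJ] holo_at_vec_join holo_at_ident holo_at_gam)
      fix z assume z: "z \<in> UJ"
      then have zU: "z \<in> U" using UJ_subset_U by blast
      obtain w where w: "retr z = expv (\<Psi> w) * z" using retr_rep[OF zU] by blast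
      have "gam (retr z) = expv (\<Psi> w) * gam z"
        by (simp add: w gam_mult gam_G expv_Psi_in_G)
      then have "C_orbit \<Psi> (gam (retr z)) = C_orbit \<Psi> (gam z)" unfolding C_orbit_eq_iff by blast
      then show "?f z \<in> vec_prod UJ G \<and> pair_map p (C_orbit \<Psi>) (?f z) = \<sigma> (retr z)"
        using z zU by (simp add: gam_in_G \<sigma>_def p_retr)
    qed
    show "homeomorphic_maps ?XH ?ZV \<tau> \<sigma>"
      unfolding homeomorphic_maps_def
    proof (intro conjI ballI)
      show "continuous_map ?XH ?ZV \<tau>"
        using h\<tau> unfolding holomorphic_map_def by (rule conjunct1)
      show "continuous_map ?ZV ?XH \<sigma>"
        using h\<sigma> unfolding holomorphic_map_def by (rule conjunct1)
    next
      fix y assume "y \<in> topspace ?XH"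
      then have "y \<in> p ` UJ \<times> C_orbit \<Psi> ` G"
        using quot_mfd_topspace[OF QV] quot_mfd_topspace[OF quot_mfd_GC] by simp
      then obtain u g where u: "u \<in> UJ" "g \<in> G" "y = (p u, C_orbit \<Psi> g)" by blast
      let ?z = "g * iota (qJ u)"
      have zU: "?z \<in> U" using u G_act_U iota_U by blast
      obtain w where w: "retr ?z = expv (\<Psi> w) * ?z" using retr_rep[OF zU] by blast
      have "p (\<tau> y) = p u" using ph[of "p u" "C_orbit \<Psi> g"] u by (simp add: V_def carrier_H)
      moreover have "gam (\<tau> y) = expv (\<Psi> w) * g"
        using u by (simp add: tau w gam_mult gam_G expv_Psi_in_G gam_iota)
      then have "C_orbit \<Psi> (gam (\<tau> y)) = C_orbit \<Psi> g" unfolding C_orbit_eq_iff by blast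
      ultimately show "\<sigma> (\<tau> y) = y" using u(3) by (simp add: \<sigma>_def)
    next
      fix z assume "z \<in> topspace ?ZV"
      then have z: "z \<in> Z" "z \<in> UJ" using mem_V by auto
      then show "\<tau> (\<sigma> z) = z" by (simp add: \<sigma>_def tau gam_iota_qJ retr_id)
    qed
  qed
  moreover have "\<tau> (x, g \<otimes>\<^bsub>H\<^esub> h) = act g (\<tau> (x, h))" if xh: "x \<in> V" "h \<in> carrier H"
      "g \<in> carrier H" for x h g
  proof -
    obtain g' h' where g': "g' \<in> G" "h' \<in> G" "g = C_orbit \<Psi> g'" "h = C_orbit \<Psi> h'"
      using xh unfolding carrier_H by blast
    have "retr (\<xi> x) \<in> Z" by (simp add: \<xi>_def retr_in_Z iota_U)
    then show ?thesis using g' by (simp add: \<tau>_def act_mult)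
  qed
  ultimately show thesis using that oV ph by blast
qed

end

locale regular_toric_data = toric_data a K \<Psi>
  for a :: "'m::finite \<Rightarrow> int^'n" and K :: "'m set set" and \<Psi> :: "complex^'l \<Rightarrow> complex^'m" +
  assumes ex_dual: "J \<in> K \<Longrightarrow> card J = CARD('n) \<Longrightarrow>
    \<exists>b :: 'm \<Rightarrow> int^'n. \<forall>y j. y $ j = (\<Sum>i\<in>J. (\<Sum>k\<in>UNIV. b i $ k * y $ k) * a i $ j)"
begin

lemma ex_regular_toric_chart:
  assumes "u \<in> U"
  obtains J T b where "regular_toric_chart a K \<Psi> J T b" "u \<in> toric_chart.UJ J"
proof -
  obtain J T where JT: "toric_chart a K \<Psi> J T"
      "u \<in> toric_chart.UJ J" using ex_toric_chart_UJ[OF assms] by metis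
  interpret toric_chart a K \<Psi> J T by fact
  obtain b where "\<forall>y j. y $ j = (\<Sum>i\<in>J. (\<Sum>k\<in>UNIV. b i $ k * y $ k) * a i $ j)" using ex_dual[OF JK
      cardJ] by blast
  then have "regular_toric_chart a K \<Psi> J T b"
    by (intro regular_toric_chart.intro toric_chart_axioms regular_toric_chart_axioms.intro) blast+
  then show thesis using JT(2) that by blast
qed

abbreviation "X \<equiv> quotient_topology (top_of_set U) p"
abbreviation "AX \<equiv> quotient_atlas U p :: (_, 'n) chart set"

lemma quot_mfd_X: "quot_mfd X AX U p"
proof (rule quot_mfd_quotient_atlas)
  fix u assume "u \<in> U"
  then obtain J T b where JT: "regular_toric_chart a K \<Psi> J T b"
      "u \<in> toric_chart.UJ J" using ex_regular_toric_chart by metis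
  then show "\<exists>V \<phi>. qchart U p V (\<phi> :: _ \<Rightarrow> complex^'n) \<and> p u \<in> V"
    using regular_toric_chart.chart_X[OF JT(1)] by blast
qed

lemma Hausdorff_X: "Hausdorff_space X"
proof (rule quot_mfd_Hausdorff[OF quot_mfd_X])
  fix xs ys x y
  assume lim: "xs \<longlonglongrightarrow> x" "ys \<longlonglongrightarrow> y" "x \<in> U" "y \<in> U" "\<And>n::nat. p (xs n) = p (ys n)"
  have "\<exists>g\<in>G. x = g * y"
    by (rule orbit_relation_closed[OF subset_refl G_closed lim(2,4,1,3)]) (use lim(5) in \<open>auto
        simp: p_eq_iff\<close>)
  then show "p x = p y" unfolding p_eq_iff .
qed

lemma complex_manifold_X: "complex_manifold X AX"
  by (rule complex_manifold_quot_mfd[OF quot_mfd_X Hausdorff_X])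

lemma holomorphic_principal_bundle_Z:
  "holomorphic_principal_bundle (top_of_set Z) AZ X AX p H TH AH act"
  unfolding holomorphic_principal_bundle_def
proof (intro conjI ballI holomorphic_action_Z complex_manifold_X)
  show "holomorphic_map (top_of_set Z) AZ X AX p"
    \<comment> \<open>The identity of \<open>U\<close> is a lift, since \<open>p\<close> does not
      change under the retraction.\<close>
    by (rule holomorphic_map_lift[OF quot_mfd_Z quot_mfd_X holo_on_id]) (simp add: p_retr)
  fix x assume "x \<in> topspace X"
  then obtain u where u: "u \<in> U" "x = p u" using quot_mfd_topspace[OF quot_mfd_X] by auto
  obtain J T b where JT: "regular_toric_chart a K \<Psi> J T b"
      "u \<in> toric_chart.UJ J" using ex_regular_toric_chart[OF u(1)] by metis
  interpret regular_toric_chart a K \<Psi> J T b by fact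
  let ?V = "p ` UJ"
  obtain \<tau> where \<tau>: "openin X ?V"
    "biholomorphic_map
       (prod_topology (subtopology X ?V) TH) (prod_atlas (sub_atlas AX ?V) AH)
       (subtopology (top_of_set Z) {e \<in> Z. p e \<in> ?V}) (sub_atlas AZ {e \<in> Z. p e \<in> ?V}) \<tau>"
    "\<And>x h. x \<in> ?V \<Longrightarrow> h \<in> carrier H \<Longrightarrow> p (\<tau> (x, h)) = x"
    "\<And>x h g. x \<in> ?V \<Longrightarrow> h \<in> carrier H \<Longrightarrow> g \<in> carrier H \<Longrightarrow> \<tau> (x, g \<otimes>\<^bsub>H\<^esub> h) = act g (\<tau> (x, h))"
    by (rule local_trivialization[OF quot_mfd_X]) (rule that)
  show "\<exists>V \<tau>. openin X V \<and> x \<in> V \<and>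
        biholomorphic_map
          (prod_topology (subtopology X V) TH) (prod_atlas (sub_atlas AX V) AH)
          (subtopology (top_of_set Z) {e \<in> topspace (top_of_set Z). p e \<in> V}) (sub_atlas AZ {e \<in>
              topspace (top_of_set Z). p e \<in> V}) \<tau> \<and>
        (\<forall>x\<in>V. \<forall>h\<in>carrier H. p (\<tau> (x, h)) = x \<and>
           (\<forall>g\<in>carrier H. \<tau> (x, g \<otimes>\<^bsub>H\<^esub> h) = act g (\<tau> (x, h))))"
    unfolding topspace_euclidean_subtopology
  proof (intro exI[of _ ?V] exI[of _ \<tau>] conjI ballI)
    show "x \<in> ?V" using u(2) JT(2) by (rule image_eqI)
  qed (fact \<tau>(1,2) | rule \<tau>(3,4); assumption)+
qed

end

section \<open>The fibre as a compact complex torus\<close>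

lemma add_group_simps [simp]: "carrier add_group = UNIV" "mult add_group = (+)" "one add_group = 0"
  by (simp_all add: add_group_def)

lemma comm_group_add_group: "comm_group (add_group :: (complex^'l) monoid)"
  by (rule comm_groupI) (auto simp: add.assoc add.commute intro: exI[of _ "- x" for x] left_minus)

context regular_toric_chart
begin

text \<open>The periods: \<open>v\<close> belongs to it exactly if \<open>expv (Psibar v)\<close>
  lies in \<open>C\<close>, so it will be the kernel of \<open>torus_map\<close>.\<close>

definition lattice :: "(complex^'l) set" where
  "lattice = {v. \<exists>w. expv (\<Psi> w + Psibar v) = 1}"

text \<open>\<open>E\<close> maps the integral points of the kernel of \<open>Lambda_R\<close> onto the lattice.\<close>
definition E :: "real^'m \<Rightarrow> complex^'l" where "E y = cnjv (- \<i> *s T (pi *\<^sub>R y))"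

lemma linear_E: "linear E"
  by (rule linearI) (simp_all add: E_def scaleR_add_right linT_simps vec_eq_iff algebra_simps)

lemma Re_Psi_E:
  assumes "\<Lambda> y = 0"
  shows "Re_vec (\<Psi> (\<i> *s cnjv (E y))) = pi *\<^sub>R y"
proof -
  have "\<i> *s cnjv (E y) = T (pi *\<^sub>R y)" by (simp add: E_def vec_eq_iff)
  moreover have "Re_vec (\<Psi> (T (pi *\<^sub>R y))) = pi *\<^sub>R y"
    by (rule kernel_lift_kernel[OF JK T_off]) (simp_all add: linear_scale[OF linear_Lambda_R] assms)
  ultimately show ?thesis by simp
qed

text \<open>With \<open>w = - cnjv v\<close> the exponent is purely imaginary. It is a multiple of 2
  pi i exactly if the real part on the right is a multiple of pi, whence the factor pi in
  \<open>E\<close>.\<close>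

lemma Psi_Psibar_conj: "(\<Psi> (- cnjv v) + Psibar v) $ i = 2 * \<i> * of_real (Re (\<Psi> (\<i> *s cnjv v) $ i))"
  using vec.linear_neg[OF lin, of "cnjv v"] Im_Psi[of "cnjv v" i] by (simp add: Psibar_def
      complex_eq_iff)

text \<open>Moduli equal to 1 force \<open>w = - cnjv v\<close>; the phases then say that the real
  part of \<open>\<Psi> (\<i> *s cnjv v)\<close>, divided by pi, is integral. This vector in the
  kernel of \<Lambda> determines \<open>v\<close>, by injectivity of the real part of
  \<Psi>.\<close>

lemma lattice_iff: "v \<in> lattice \<longleftrightarrow> (\<exists>y. \<Lambda> y = 0 \<and> (\<forall>i. y $ i \<in> \<int>) \<and> v = E y)"
proof
  assume "v \<in> lattice"
  then obtain w where w: "expv (\<Psi> w + Psibar v) = 1" unfolding lattice_def by blast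
  have e1: "exp ((\<Psi> w + Psibar v) $ i) = 1" for i using arg_cong[OF w, of "\<lambda>x. x $ i"] by simp
  have "w + cnjv v = 0"
  proof (rule Psi_Re_zero[OF empty_in_K])
    fix i
    have "norm (exp ((\<Psi> w + Psibar v) $ i)) = 1" using e1[of i] by simp
    then show "Re (\<Psi> (w + cnjv v) $ i) = 0" by (simp add: Psi_add Psibar_def)
  qed
  then have w: "w = - cnjv v" by (simp add: eq_neg_iff_add_eq_0)
  define y where "y = (1 / pi) *\<^sub>R Re_vec (\<Psi> (\<i> *s cnjv v))"
  have y: "\<Lambda> y = 0" by (simp add: y_def Lambda_scale Lambda_Psi)
  have "y $ i \<in> \<int>" for i
  proof -
    have "exp (2 * \<i> * of_real (Re (\<Psi> (\<i> *s cnjv v) $ i))) = 1"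
      using e1[of i] unfolding w Psi_Psibar_conj .
    then have "\<exists>n::int. Im (2 * \<i> * of_real (Re (\<Psi> (\<i> *s cnjv v) $ i))) = of_int (2 * n) * pi"
      unfolding exp_eq_1 by (rule conjunct2)
    then obtain n :: int where "Im (2 * \<i> * of_real (Re (\<Psi> (\<i> *s cnjv v) $ i))) = of_int (2 * n)
        * pi" ..
    then have "Re (\<Psi> (\<i> *s cnjv v) $ i) = of_int n * pi" by simp
    then have "y $ i = of_int n" by (simp add: y_def)
    then show ?thesis by simp
  qed
  moreover have "v = E y"
  proof -
    have "(Re_vec \<circ> \<Psi>) (\<i> *s cnjv v) = (Re_vec \<circ> \<Psi>) (\<i> *s cnjv (E y))"
      using Re_Psi_E[OF y] by (simp add: y_def)
    then have "\<i> *s cnjv v = \<i> *s cnjv (E y)" using inj_Re by (rule injD[rotated])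
    then show ?thesis by (simp add: vec_eq_iff)
  qed
  ultimately show "\<exists>y. \<Lambda> y = 0 \<and> (\<forall>i. y $ i \<in> \<int>) \<and> v = E y" using y by blast
next
  assume "\<exists>y. \<Lambda> y = 0 \<and> (\<forall>i. y $ i \<in> \<int>) \<and> v = E y"
  then obtain y where y: "\<Lambda> y = 0" "\<And>i. y $ i \<in> \<int>" "v = E y" by blast
  have "exp ((\<Psi> (- cnjv v) + Psibar v) $ i) = 1" for i
  proof -
    have "Re (\<Psi> (\<i> *s cnjv v) $ i) = pi * y $ i"
      using arg_cong[OF Re_Psi_E[OF y(1)], of "\<lambda>x. x $ i"] y(3) by simp
    moreover obtain n where "y $ i = of_int n" using y(2)[of i] Ints_cases by blast
    ultimately show ?thesis unfolding Psi_Psibar_conj exp_eq_1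
      by (intro conjI exI[of _ n]) simp_all
  qed
  then show "v \<in> lattice" unfolding lattice_def by (auto simp: vec_eq_iff intro!: exI[of _ "-
      cnjv v"])
qed

lemma tvec_sum_nth:
  assumes "k \<notin> J"
  shows "(\<Sum>j\<in>-J. c j *\<^sub>R tvec j) $ k = c k"
  using assms by (simp add: tvec_off if_distrib[of "(*) _"] cong: if_cong)

text \<open>Outside \<open>J\<close> the vectors \<open>tvec k\<close> are standard unit vectors, so
  the difference is an element of the kernel supported on a simplex. The coefficients are
  coordinates of \<open>y\<close>, so integral points get integral coefficients.\<close>

lemma kernel_basis_rep:
  assumes y: "\<Lambda> y = 0"
  shows "y = (\<Sum>k\<in>-J. y $ k *\<^sub>R tvec k)"
proof -
  have "y - (\<Sum>k\<in>-J. y $ k *\<^sub>R tvec k) = 0"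
  proof (rule kernel_supp[OF JK])
    show "\<Lambda> (y - (\<Sum>k\<in>-J. y $ k *\<^sub>R tvec k)) = 0"
      by (simp add: Lambda_diff linear_sum[OF linear_Lambda_R] Lambda_scale Lambda_tvec y)
    fix i assume "i \<notin> J"
    then show "(y - (\<Sum>k\<in>-J. y $ k *\<^sub>R tvec k)) $ i = 0"
      using tvec_sum_nth[of i "\<lambda>k. y $ k"] by simp
  qed
  then show ?thesis by simp
qed

lemma indep_E: "indep_family (\<lambda>k. E (tvec k)) (-J)"
  unfolding indep_family_def
proof (intro allI impI ballI)
  fix c k assume c: "(\<Sum>k\<in>-J. c k *\<^sub>R E (tvec k)) = 0" and k: "k \<in> -J"
  let ?y = "\<Sum>k\<in>-J. c k *\<^sub>R tvec k"
  have "\<Lambda> ?y = 0" by (simp add: linear_sum[OF linear_Lambda_R] Lambda_scale Lambda_tvec)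
  moreover have "E ?y = 0" using c by (simp add: linear_sum[OF linear_E] linear_scale[OF linear_E])
  ultimately have "pi *\<^sub>R ?y = Re_vec (\<Psi> (\<i> *s cnjv 0))" using Re_Psi_E[of ?y] by simp
  also have "\<i> *s cnjv (0 :: complex^'l) = 0" by (simp add: vec_eq_iff)
  also have "Re_vec (\<Psi> 0) = 0" by (simp add: vec_eq_iff Psi_0)
  finally have "?y = 0" by simp
  then have "?y $ k = 0" by (metis zero_index)
  then show "c k = 0" using k tvec_sum_nth[of k c] by simp
qed

definition basis :: "(complex^'l) set" where "basis = (\<lambda>k. E (tvec k)) ` (-J)"

lemma independent_basis: "independent basis"
  unfolding basis_def by (rule indep_family_imp_independent(2)[OF indep_E]) simp

lemma inj_basis: "inj_on (\<lambda>k. E (tvec k)) (-J)"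
  by (rule indep_family_imp_independent(1)[OF indep_E]) simp

lemma span_basis: "span basis = UNIV"
proof -
  have "card basis = card (-J)" unfolding basis_def by (rule card_image[OF inj_basis])
  also have "\<dots> = 2 * CARD('l)" using card_m cardJ by (simp add: Compl_eq_Diff_UNIV card_Diff_subset)
  finally have "dim (UNIV :: (complex^'l) set) \<le> card basis" by (simp add: dim_UNIV)
  then show ?thesis using card_ge_dim_independent[OF subset_UNIV independent_basis] by blast
qed

lemma lattice_eq_int_span: "lattice = int_span basis"
proof (intro equalityI subsetI)
  fix v assume "v \<in> lattice"
  then obtain y where y: "\<Lambda> y = 0" "\<And>i. y $ i \<in> \<int>" "v = E y" unfolding lattice_iff by blast
  \<comment> \<open>The coordinates of \<open>y\<close> are integers, so the floor only changes
    their type.\<close>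
  let ?k = "\<lambda>b. \<lfloor>y $ inv_into (-J) (\<lambda>k. E (tvec k)) b\<rfloor>"
  have "v = (\<Sum>k\<in>-J. y $ k *\<^sub>R E (tvec k))"
    unfolding y(3) by (subst kernel_basis_rep[OF y(1)]) (simp add: linear_sum[OF linear_E]
        linear_scale[OF linear_E])
  also have "\<dots> = (\<Sum>k\<in>-J. of_int (?k (E (tvec k))) *\<^sub>R E (tvec k))"
    by (rule sum.cong) (use y(2) in \<open>auto simp: inv_into_f_f[OF inj_basis] elim!: Ints_cases\<close>)
  also have "\<dots> = (\<Sum>b\<in>basis. of_int (?k b) *\<^sub>R b)"
    unfolding basis_def by (simp add: sum.reindex[OF inj_basis])
  finally show "v \<in> int_span basis" unfolding int_span_def
    by (intro CollectI exI[of _ ?k] conjI TrueI)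
next
  fix v assume "v \<in> int_span basis"
  then obtain k where k: "v = (\<Sum>b\<in>basis. of_int (k b) *\<^sub>R b)" unfolding int_span_def by blast
  let ?y = "\<Sum>i\<in>-J. of_int (k (E (tvec i))) *\<^sub>R tvec i"
  have "v = E ?y"
    unfolding k basis_def
    by (simp add: sum.reindex[OF inj_basis] linear_sum[OF linear_E] linear_scale[OF linear_E])
  moreover have "\<Lambda> ?y = 0" by (simp add: linear_sum[OF linear_Lambda_R] Lambda_scale Lambda_tvec)
  moreover have "?y $ i \<in> \<int>" for i
    by (auto intro!: Ints_sum Ints_mult simp: tvec_def)
  ultimately show "v \<in> lattice" unfolding lattice_iff by blast
qed

lemma lattice_0: "0 \<in> lattice"
  unfolding lattice_def by (auto simp: Psi_0 Psibar_0 intro!: exI[of _ 0])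

lemma lattice_diff: "u \<in> lattice \<Longrightarrow> v \<in> lattice \<Longrightarrow> u - v \<in> lattice"
proof -
  assume "u \<in> lattice" "v \<in> lattice"
  then obtain x y where w: "expv (\<Psi> x + Psibar u) = 1"
      "expv (\<Psi> y + Psibar v) = 1" unfolding lattice_def by blast
  have "expv (\<Psi> (x - y) + Psibar (u - v)) * expv (\<Psi> y + Psibar v) = expv (\<Psi> x + Psibar u)"
    by (simp add: Psi_diff Psibar_diff flip: expv_add)
  then show ?thesis unfolding lattice_def using w by auto
qed

section \<open>The isomorphism with the quotient by the period lattice\<close>

abbreviation "coset \<equiv> r_coset add_group lattice"

lemma coset_eq: "coset v = {h + v | h. h \<in> lattice}"
  by (auto simp: r_coset_def)

lemma coset_eq_iff: "coset u = coset v \<longleftrightarrow> u - v \<in> lattice"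
proof
  assume "coset u = coset v"
  moreover have "u \<in> coset u" unfolding coset_eq using lattice_0 by force
  ultimately show "u - v \<in> lattice" unfolding coset_eq by auto
next
  have sub: "coset u \<subseteq> coset v" if uv: "u - v \<in> lattice" for u v
  proof
    fix x assume "x \<in> coset u"
    then obtain h where h: "h \<in> lattice" "x = h + u" unfolding coset_eq by blast
    then have "h - (0 - (u - v)) \<in> lattice" using lattice_diff lattice_0 uv by blast
    moreover have "x = (h - (0 - (u - v))) + v" using h by simp
    ultimately show "x \<in> coset v" unfolding coset_eq by blast
  qed
  assume "u - v \<in> lattice"
  moreover from this have "v - u \<in> lattice" using lattice_diff[OF lattice_0] by fastforce
  ultimately show "coset u = coset v" using sub by blast
qed

lemma normal_lattice: "lattice \<lhd> add_group"
proof (rule comm_group.subgroup_imp_normal[OF comm_group_add_group])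
  have inv: "inv\<^bsub>add_group\<^esub> x = - x" for x :: "complex^'l"
    by (rule group.inv_equality[OF comm_group.axioms(2)[OF comm_group_add_group]]) auto
  show "subgroup lattice add_group"
  proof
    fix x y assume xy: "x \<in> lattice" "y \<in> lattice"
    then have "x - (0 - y) \<in> lattice" using lattice_diff lattice_0 by blast
    then show "x \<otimes>\<^bsub>add_group\<^esub> y \<in> lattice" by simp
  next
    fix x assume "x \<in> lattice"
    then show "inv\<^bsub>add_group\<^esub> x \<in> lattice" using lattice_diff[OF lattice_0, of x] by (simp add: inv)
  qed (auto simp: lattice_0)
qed

definition torus_map :: "complex^'l \<Rightarrow> (complex^'m) set" where
  "torus_map v = C_orbit \<Psi> (expv (Psibar v))"

lemma expv_Psibar_in_G: "expv (Psibar v) \<in> G"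
  by (rule expv_in_G[OF Lambda_C_Psibar])

lemma torus_map_eq_iff: "torus_map u = torus_map v \<longleftrightarrow> u - v \<in> lattice"
proof
  assume "torus_map u = torus_map v"
  then obtain w where "expv (Psibar u) = expv (\<Psi> w) * expv (Psibar v)" unfolding torus_map_def
      C_orbit_eq_iff by blast
  then have "expv (\<Psi> (- w) + Psibar (u - v)) = 1"
    using vec.linear_neg[OF lin, of w]
    by (simp add: vec_eq_iff Psibar_diff exp_add exp_diff exp_minus)
  then show "u - v \<in> lattice" unfolding lattice_def by blast
next
  assume "u - v \<in> lattice"
  then obtain w where "expv (\<Psi> w + Psibar (u - v)) = 1" unfolding lattice_def by blast
  then have "expv (Psibar u) = expv (\<Psi> (- w)) * expv (Psibar v)"
    using vec.linear_neg[OF lin, of w]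
    by (simp add: vec_eq_iff Psibar_diff exp_add exp_diff exp_minus field_simps)
  then show "torus_map u = torus_map v" unfolding torus_map_def C_orbit_eq_iff by blast
qed

lemma torus_map_in_H: "torus_map v \<in> carrier H"
  unfolding torus_map_def carrier_H using expv_Psibar_in_G by blast

lemma torus_map_add: "torus_map (u + v) = torus_map u \<otimes>\<^bsub>H\<^esub> torus_map v"
  by (simp add: torus_map_def mult_H expv_Psibar_in_G Psibar_add expv_add)

text \<open>Logarithms of the coordinates satisfy the linear equations of the kernel only up to
  multiples \<open>n\<close> of 2 pi i. Since the generators of \<open>J\<close> span all integral
  vectors, \<open>n\<close> can be removed by changing the branches on \<open>J\<close>. In other
  words, regularity makes \<open>G\<close> connected.\<close>

lemma G_exp:
  assumes g: "g \<in> G"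
  obtains w v where "g = expv (\<Psi> w + Psibar v)"
proof -
  define x where "x = (\<chi> i. Ln (g $ i))"
  have x: "g $ i = exp (x $ i)" for i using G_nonzero[OF g] by (simp add: x_def)
  have "\<exists>n::int. (\<Sum>i\<in>UNIV. x $ i * of_int (a i $ j)) = 2 * \<i> * pi * n" for j
  proof -
    have "(\<Prod>i\<in>UNIV. (g $ i) powi (a i $ j)) = 1" using g unfolding G_fan_def by blast
    then have "exp (\<Sum>i\<in>UNIV. x $ i * of_int (a i $ j)) = 1"
      by (simp add: x exp_power_int exp_sum mult.commute)
    then obtain n :: int where "Re (\<Sum>i\<in>UNIV. x $ i * of_int (a i $ j)) = 0"
        "Im (\<Sum>i\<in>UNIV. x $ i * of_int (a i $ j)) = of_int (2 * n) * pi"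
      unfolding exp_eq_1 by blast
    then have "(\<Sum>i\<in>UNIV. x $ i * of_int (a i $ j)) = 2 * \<i> * pi * n"
      unfolding complex_eq_iff by simp
    then show ?thesis by blast
  qed
  then obtain n :: "'n \<Rightarrow> int" where n: "\<And>j. (\<Sum>i\<in>UNIV. x $ i * of_int (a i $ j)) = 2 * \<i> * pi * n
      j" by metis
  define c where "c = (\<chi> i. if i \<in> J then 2 * \<i> * pi * pair i (\<chi> j. n j) else 0)"
  have "(\<Sum>i\<in>UNIV. (x - c) $ i * of_int (a i $ j)) = 0" for j
  proof -
    have "(\<Sum>i\<in>UNIV. c $ i * of_int (a i $ j)) = (\<Sum>i\<in>J. 2 * \<i> * pi * (of_int (pair i (\<chi> j. n j)) *
        of_int (a i $ j)))"
      unfolding c_def by (rule sum.mono_neutral_cong_right) auto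
    also have "\<dots> = 2 * \<i> * pi * n j" unfolding sum_distrib_left[symmetric] dual_pair_complex by simp
    finally show ?thesis by (simp add: left_diff_distrib sum_subtractf n)
  qed
  then have "\<Psi> (Pw (x - c)) + Psibar (Pv (x - c)) = x - c" by (rule P_kernel)
  moreover have "expv (x - c) = g"
  proof -
    have "exp (c $ i) = 1" for i
    proof (cases "i \<in> J")
      case True
      then show ?thesis unfolding exp_eq_1
        by (intro conjI exI[of _ "pair i (\<chi> j. n j)"]) (simp_all add: c_def)
    qed (simp add: c_def)
    then show ?thesis by (simp add: vec_eq_iff exp_diff x)
  qed
  ultimately show thesis using that by metis
qed

lemma torus_map_expv: "C_orbit \<Psi> (expv (\<Psi> w + Psibar v)) = torus_map v"
  unfolding torus_map_def C_orbit_eq_iff expv_add by blast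

lemma torus_map_surj: "\<gamma> \<in> carrier H \<Longrightarrow> \<exists>v. \<gamma> = torus_map v"
  unfolding carrier_H using G_exp torus_map_expv by (metis imageE)

text \<open>No nonzero period is shorter than \<open>\<epsilon>\<close>, so a ball of radius
  \<open>\<epsilon> / 2\<close> contains no two distinct points with the same coset, and its
  translates by periods are the slices.\<close>

lemma quot_mfd_torus:
  "quot_mfd (quotient_topology euclidean coset) (quotient_atlas UNIV coset :: (_, 'l) chart set)
      UNIV coset"
proof -
  obtain \<epsilon> where \<epsilon>: "\<epsilon> > 0"
    "\<And>I w v. I \<in> K \<Longrightarrow> norm v < \<epsilon> \<Longrightarrow> (\<And>i. i \<notin> I \<Longrightarrow> exp ((\<Psi> w + Psibar v) $ i) = 1) \<Longrightarrow> w = 0 \<and> v = 0"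
    using Psi_Psibar_discrete by metis
  have disc: "v = 0" if v: "v \<in> lattice" "norm v < \<epsilon>" for v
  proof -
    obtain w where w: "expv (\<Psi> w + Psibar v) = 1" using v(1) unfolding lattice_def by blast
    have "exp ((\<Psi> w + Psibar v) $ i) = 1" for i using arg_cong[OF w, of "\<lambda>x. x $ i"] by simp
    then show ?thesis using \<epsilon>(2)[OF empty_in_K v(2)] by blast
  qed
  have "quot_mfd (quotient_topology (top_of_set UNIV) coset) (quotient_atlas UNIV coset :: (_,
      'l) chart set) UNIV coset"
  proof (rule quot_mfd_quotient_atlas)
    fix v0 :: "complex^'l"
    let ?D = "ball v0 (\<epsilon> / 2)" and ?F = "\<lambda>h d :: complex^'l. h + d"
    have pF: "coset (?F h d) = coset d" if "h \<in> lattice" for h d using that by (simp add: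
        coset_eq_iff)
    have "\<exists>\<phi>. qchart UNIV coset {coset (?F h d) | h d. h \<in> lattice \<and> d \<in> ?D} (\<phi> :: _ \<Rightarrow> complex^'l)"
    proof (rule qchart_slice)
      show "holo_on (?F h) ?D" for h
        by (intro holo_on_openI holo_at_add holo_at_const holo_at_ident) simp
      show "coset (?F h d) = coset (?F h' d') \<longleftrightarrow> d = d'"
        if "h \<in> lattice" "h' \<in> lattice" "d \<in> ?D" "d' \<in> ?D" for h h' d d'
      proof
        assume "coset (?F h d) = coset (?F h' d')"
        then have "d - d' \<in> lattice" using that by (simp add: pF coset_eq_iff)
        moreover have "norm (d - d') < \<epsilon>"
          using dist_triangle_half_r[of v0 d \<epsilon> d'] that by (simp add: dist_norm)
        ultimately show "d = d'" using disc by fastforce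
      qed (use that in \<open>simp add: pF\<close>)
      show "\<exists>h'\<in>lattice. u = ?F h' d" if "h \<in> lattice" "coset u = coset (?F h d)" for u h d
        using that by (intro bexI[of _ "u - d"]) (auto simp: pF coset_eq_iff)
      show "\<exists>N \<delta>. open N \<and> ?F h d \<in> N \<and> (\<forall>y\<in>N. holo_at \<delta> y) \<and> \<delta> (?F h d) \<in> ?D \<and>
          (\<forall>u\<in>N \<inter> UNIV. \<delta> u \<in> ?D \<longrightarrow> coset u = coset (?F h (\<delta> u)))" if "h \<in> lattice" "d \<in> ?D" for h d
      proof -
        have "holo_at (\<lambda>u. u - h) y" for y
          using holo_at_add[OF holo_at_ident holo_at_const[of "- h"]] by simp
        then show ?thesis using that by (intro exI[of _ UNIV] exI[of _ "\<lambda>u. u - h"]) auto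
      qed
    qed auto
    moreover have "coset v0 \<in> {coset (?F h d) | h d. h \<in> lattice \<and> d \<in> ?D}"
      using lattice_0 \<epsilon>(1) by (intro CollectI exI[of _ 0] exI[of _ v0]) simp
    ultimately show "\<exists>V \<phi>. qchart UNIV coset V (\<phi> :: _ \<Rightarrow> complex^'l) \<and> coset v0 \<in> V" by blast
  qed
  then show ?thesis by simp
qed

lemma compact_complex_torus_GC:
  "compact_complex_torus H TH AH"
proof -
  let ?T = "quotient_topology euclidean coset" and ?A = "quotient_atlas UNIV coset :: (_, 'l)
      chart set"
  define f where "f c = torus_map (SOME v. v \<in> c)" for c
  have f: "f (coset v) = torus_map v" for v
  proof -
    have "v \<in> coset v" unfolding coset_eq using lattice_0 by force
    then have "(SOME u. u \<in> coset v) \<in> coset v" by (rule someI)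
    then have "(SOME u. u \<in> coset v) - v \<in> lattice" unfolding coset_eq by auto
    then show ?thesis unfolding f_def torus_map_eq_iff .
  qed
  define f' where "f' \<gamma> = coset (SOME v. \<gamma> = torus_map v)" for \<gamma>
  have f': "f' (torus_map v) = coset v" for v
  proof -
    have "torus_map v = torus_map (SOME u. torus_map v = torus_map u)"
      by (rule someI[of "\<lambda>u. torus_map v = torus_map u"]) simp
    then have "v - (SOME u. torus_map v = torus_map u) \<in> lattice" unfolding torus_map_eq_iff .
    then show ?thesis unfolding f'_def coset_eq_iff[symmetric] by simp
  qed
  have carr: "carrier (add_group Mod lattice) = range coset" by (simp add: carrier_FactGroup)
  have iso: "f \<in> iso (add_group Mod lattice) H"
    unfolding iso_def
  proof (intro CollectI conjI)
    show "f \<in> hom (add_group Mod lattice) H"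
      unfolding hom_def
    proof (intro CollectI conjI ballI)
      show "f \<in> carrier (add_group Mod lattice) \<rightarrow> carrier H"
        unfolding carr by (auto simp: f torus_map_in_H)
      fix x y assume "x \<in> carrier (add_group Mod lattice)" "y \<in> carrier (add_group Mod lattice)"
      then obtain u v where uv: "x = coset u" "y = coset v" unfolding carr by blast
      have "x \<otimes>\<^bsub>add_group Mod lattice\<^esub> y = coset (u + v)"
        using normal.rcos_sum[OF normal_lattice, of u v] by (simp add: uv)
      then show "f (x \<otimes>\<^bsub>add_group Mod lattice\<^esub> y) = f x \<otimes>\<^bsub>H\<^esub> f y" by (simp add: uv f torus_map_add)
    qed
    show "bij_betw f (carrier (add_group Mod lattice)) (carrier H)"
    proof (rule bij_betw_byWitness[where f' = f'])
      show "\<forall>x\<in>carrier (add_group Mod lattice). f' (f x) = x" unfolding carr by (auto simp: f f')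
      show "\<forall>x\<in>carrier H. f (f' x) = x" using torus_map_surj f f' by metis
      show "f ` carrier (add_group Mod lattice) \<subseteq> carrier H" unfolding carr by (auto simp: f
          torus_map_in_H)
      show "f' ` carrier H \<subseteq> carrier (add_group Mod lattice)" unfolding carr using torus_map_surj
          f' by blast
    qed
  qed
  have "biholomorphic_map ?T ?A TH AH f"
    unfolding biholomorphic_map_def
  proof (intro exI[of _ f'] conjI)
    show hf: "holomorphic_map ?T ?A TH AH f"
    proof (rule holomorphic_map_lift[OF quot_mfd_torus quot_mfd_GC])
      show "holo_on (\<lambda>v. expv (Psibar v)) UNIV"
        by (intro holo_on_openI holo_at_expv holo_at_linear[OF linear_Psibar] holo_at_ident) simp
    qed (simp add: f expv_Psibar_in_G torus_map_def)
    \<comment> \<open>A lift of the inverse is a logarithm and is not single-valued on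
      \<open>G\<close>. Hence the criterion with local lifts is used, with the branch from
      \<open>G_local_log\<close> shifted by a preimage \<open>v0\<close> of the base point.\<close>
    show hf': "holomorphic_map TH AH ?T ?A f'"
    proof (rule holomorphic_map_quot_mfd[OF quot_mfd_GC quot_mfd_torus])
      fix g0 assume g0: "g0 \<in> G"
      obtain w0 v0 where wv: "g0 = expv (\<Psi> w0 + Psibar v0)" using G_exp[OF g0] by blast
      obtain N \<delta> where N: "open N" "g0 \<in> N" "\<And>y. y \<in> N \<Longrightarrow> holo_at \<delta> y" "\<delta> g0 = 0"
        "\<And>g. g \<in> N \<Longrightarrow> g \<in> G \<Longrightarrow> \<exists>w. g = expv (\<Psi> w + Psibar (\<delta> g)) * g0"
        using G_local_log[OF g0] by metis
      have "coset (v0 + \<delta> g) = f' (C_orbit \<Psi> g)" if g: "g \<in> N" "g \<in> G" for g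
      proof -
        obtain w where "g = expv (\<Psi> w + Psibar (\<delta> g)) * g0" using N(5)[OF g] by blast
        then have "g = expv (\<Psi> (w + w0) + Psibar (v0 + \<delta> g))"
          unfolding wv expv_add[symmetric] by (simp add: Psi_add Psibar_add add_ac)
        then have "C_orbit \<Psi> g = torus_map (v0 + \<delta> g)" using torus_map_expv by metis
        then show ?thesis by (simp add: f')
      qed
      moreover have "holo_on (\<lambda>g. v0 + \<delta> g) (N \<inter> G)"
        using N(1,3) by (intro holo_on_subset[OF holo_on_openI[OF N(1)]] holo_at_add
            holo_at_const) auto
      ultimately show "\<exists>N h. open N \<and> g0 \<in> N \<and> holo_on h (N \<inter> G) \<and> (\<forall>x\<in>N \<inter> G. h x \<in> UNIV \<and>
          coset (h x) = f' (C_orbit \<Psi> x))"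
        using N(1,2) by (intro exI[of _ N] exI[of _ "\<lambda>g. v0 + \<delta> g"]) auto
    qed
    show "homeomorphic_maps ?T TH f f'"
      unfolding homeomorphic_maps_def
    proof (intro conjI ballI)
      show "continuous_map ?T TH f"
        using hf unfolding holomorphic_map_def by (rule conjunct1)
      show "continuous_map TH ?T f'"
        using hf' unfolding holomorphic_map_def by (rule conjunct1)
      show "f' (f x) = x" if "x \<in> topspace ?T" for x
        using that quot_mfd_topspace[OF quot_mfd_torus] by (auto simp: f f')
      show "f (f' \<gamma>) = \<gamma>" if "\<gamma> \<in> topspace TH" for \<gamma>
        using that quot_mfd_topspace[OF quot_mfd_GC] torus_map_surj[of \<gamma>] unfolding carrier_H by
            (auto simp: f f')
    qed
  qed
  then show ?thesis
    unfolding compact_complex_torus_def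
    using complex_lie_group_GC independent_basis span_basis lattice_eq_int_span iso by blast
qed

end

theorem proposition5p2:
  fixes \<Sigma> :: "(real^'n) set set"
    and a :: "'m::finite \<Rightarrow> int^'n"
    and \<Psi> :: "complex^'l \<Rightarrow> complex^'m"
  assumes "complete_fan \<Sigma>" and "simplicial_fan \<Sigma>" and "rational_fan \<Sigma>"
    and "ray_generators \<Sigma> a"
    and "CARD('m) = CARD('n) + 2 * CARD('l)"
    and "Vector_Spaces.linear (*s) (*s) \<Psi>"
    and "inj (Re_vec \<circ> \<Psi>)"
    and "\<forall>w. Lambda_R a (Re_vec (\<Psi> w)) = 0"
  shows
    "let
       Z = moment_angle (fan_complex \<Sigma> a); AZ = moment_angle_atlas \<Sigma> a \<Psi>;
       X = toric_variety \<Sigma> a; AX = toric_atlas \<Sigma> a; p = toric_proj a;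
       H = GC_group a \<Psi>; T = GC_topology a \<Psi>; AH = GC_atlas a \<Psi>; act = GC_action \<Sigma> a \<Psi>
     in
       (holomorphic_action H T AH (top_of_set Z) AZ act \<and>
        (\<exists>h. homeomorphic_map (quotient_topology (top_of_set Z) (orbit H act)) X h \<and>
             (\<forall>z\<in>Z. h (orbit H act z) = p z))) \<and>
       (regular_fan \<Sigma> \<longrightarrow>
        holomorphic_principal_bundle (top_of_set Z) AZ X AX p H T AH act \<and>
        compact_complex_torus H T AH)"
proof -
  note fan = assms(1,2,4)
  interpret toric_data a "fan_complex \<Sigma> a" \<Psi>
  proof (rule toric_data.intro)
    show "J \<in> fan_complex \<Sigma> a" if "I \<in> fan_complex \<Sigma> a" "J \<subseteq> I" for I J
      using fan_complex_down[OF fan that] .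
    show "\<exists>c. (\<forall>i. 0 \<le> c $ i) \<and> {i. c $ i \<noteq> 0} \<in> fan_complex \<Sigma> a \<and> Lambda_R a c = x" for x
    proof -
      obtain c where "\<And>i. 0 \<le> c i" "{i. c i \<noteq> 0} \<in> fan_complex \<Sigma> a" "x = (\<Sum>i\<in>UNIV. c i *\<^sub>R int_vec (a i))"
        using fan_complex_cover[OF fan] by blast
      then show ?thesis by (intro exI[of _ "\<chi> i. c i"]) (simp add: Lambda_R_def)
    qed
    show "c = d" if "\<And>i. 0 \<le> c $ i" "{i. c $ i \<noteq> 0} \<in> fan_complex \<Sigma> a" "\<And>i. 0 \<le> d $ i"
      "{i. d $ i \<noteq> 0} \<in> fan_complex \<Sigma> a" "Lambda_R a c = Lambda_R a d" for c d :: "real^'m"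
      using fan_complex_uniq[OF fan that(1-4)] that(5) by (simp add: Lambda_R_def vec_eq_iff fun_eq_iff)
  qed (use assms in auto)
  have act_eq_GC: "GC_action \<Sigma> a \<Psi> = act" by (rule ext) (simp add: GC_action_def act_def)
  have principal: "holomorphic_principal_bundle (top_of_set Z) AZ (toric_variety \<Sigma> a) (toric_atlas \<Sigma> a)
        p H TH AH act \<and>
        compact_complex_torus H TH AH" if reg: "regular_fan \<Sigma>"
  proof -
    interpret regular_toric_data a "fan_complex \<Sigma> a" \<Psi>
    proof
      fix J assume "J \<in> fan_complex \<Sigma> a" "card J = CARD('n)"
      then show "\<exists>b :: 'm \<Rightarrow> int^'n. \<forall>y j. y $ j = (\<Sum>i\<in>J. (\<Sum>k\<in>UNIV. b i $ k * y $ k) * a i $ j)"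
        by (rule regular_fan_dual_basis[OF fan reg]) blast
    qed
    \<comment> \<open>The fibre does not depend on the base point, so any point of \<open>U\<close>
      may provide the simplex whose dual basis describes the lattice.\<close>
    have "1 \<in> U" using G_1 G_subset_U by (rule subsetD[rotated])
    then obtain J T b where "regular_toric_chart a (fan_complex \<Sigma> a) \<Psi> J T b"
      by (rule ex_regular_toric_chart)
    then have "compact_complex_torus H TH AH"
      by (rule regular_toric_chart.compact_complex_torus_GC)
    with holomorphic_principal_bundle_Z show ?thesis
      unfolding toric_variety_def toric_atlas_def by (rule conjI)
  qed
  show ?thesis
    unfolding Let_def moment_angle_atlas_def act_eq_GC
  proof (intro conjI impI)
    show "\<exists>h. homeomorphic_map (quotient_topology (top_of_set Z) (orbit H act)) (toric_variety \<Sigma> a) h \<and>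
        (\<forall>z\<in>Z. h (orbit H act z) = p z)"
      unfolding toric_variety_def by (rule quotient_homeomorphism)
  qed (use holomorphic_action_Z principal in simp_all)
qed

end
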